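(* Let $X$ be a compact complex manifold of complex dimension $n$. For all $p,q$ there are decompositions (isomorphisms of complex vector spaces, depending on a choice of hermitian metric) $$H^{p,q}_{BC}\cong\partial G^{p-1,q}_{\partial}\oplus\partial L^{p-1,q}_{\partial}\oplus\bar\partial L^{p,q-1}_{\bar\partial}\oplus K^{p,q},$$ $$H^{p,q}_{BC}\cong\bar\partial G^{p,q-1}_{\bar\partial}\oplus\bar\partial L^{p,q-1}_{\bar\partial}\oplus\partial L^{p-1,q}_{\partial}\oplus K^{p,q},$$ $$H^{p,q}_A\cong H^{p,q}_{\partial}/(\bar\partial L^{p,q-1}_{\bar\partial})\oplus G^{p,q}_{\partial}\oplus L^{p,q}_{\partial},$$ $$H^{p,q}_A\cong H^{p,q}_{\bar\partial}/(\partial L^{p-1,q}_{\partial})\oplus G^{p,q}_{\bar\partial}\oplus L^{p,q}_{\bar\partial}.$$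
   Context: On smooth complex-valued $(p,q)$-forms on $X$, define $$H^{p,q}_{BC}=\frac{\ker(\partial)\cap\ker(\bar\partial)}{\operatorname{im}(\partial\bar\partial)},\quad H^{p,q}_A=\frac{\ker(\partial\bar\partial)}{\operatorname{im}(\partial)+\operatorname{im}(\bar\partial)},\quad K^{p,q}=\frac{\ker(\partial)\cap\ker(\bar\partial)}{\operatorname{im}(\partial)\cap\ker(\bar\partial)+\operatorname{im}(\bar\partial)\cap\ker(\partial)},$$ $H^{p,q}_{\bar\partial}=\ker(\bar\partial)/\operatorname{im}(\bar\partial)$, $H^{p,q}_{\partial}=\ker(\partial)/\operatorname{im}(\partial)$ (all spaces in bidegree $(p,q)$, zero outside the range $0\le p,q\le n$). Consider the maps $\partial:H^{p,q}_A\to H^{p+1,q}_{\bar\partial}$, $[\theta]_A\mapsto[\partial\theta]_{\bar\partial}$, and $\bar\partial:H^{p,q}_A\to H^{p,q+1}_{\partial}$, $[\theta]_A\mapsto[\bar\partial\theta]_{\partial}$, and the natural maps $\pi_A$ from $H^{p,q}_{\partial}$ and $H^{p,q}_{\bar\partial}$ to $H^{p,q}_A$ induced by the identity on forms. Set $$\mathcal G^{p,q}_{\partial}=\ker(\partial:H^{p,q}_A\to H^{p+1,q}_{\bar\partial}),\quad G^{p,q}_{\partial}=\mathcal G^{p,q}_{\partial}/\operatorname{im}(\pi_A:H^{p,q}_{\partial}\to H^{p,q}_A),\quad L^{p,q}_{\partial}=H^{p,q}_A/\mathcal G^{p,q}_{\partial},$$ $$\mathcal G^{p,q}_{\bar\partial}=\ker(\bar\partial:H^{p,q}_A\to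 H^{p,q+1}_{\partial}),\quad G^{p,q}_{\bar\partial}=\mathcal G^{p,q}_{\bar\partial}/\operatorname{im}(\pi_A:H^{p,q}_{\bar\partial}\to H^{p,q}_A),\quad L^{p,q}_{\bar\partial}=H^{p,q}_A/\mathcal G^{p,q}_{\bar\partial}.$$ Using orthogonal complements for a hermitian metric, $G$ and $L$ (with either subscript) are regarded as subspaces of $H_A$. In the decompositions of $H^{p,q}_{BC}$, $\partial G$, $\partial L$ (resp. $\bar\partial G$, $\bar\partial L$) denote the images of these subspaces under $\partial:H^{p-1,q}_A\to H^{p,q}_{BC}$, $[\theta]_A\mapsto[\partial\theta]_{BC}$ (resp. $\bar\partial:H^{p,q-1}_A\to H^{p,q}_{BC}$, $[\theta]_A\mapsto[\bar\partial\theta]_{BC}$). In the decompositions of $H^{p,q}_A$, $\bar\partial L^{p,q-1}_{\bar\partial}$ denotes the (injective) image of $L^{p,q-1}_{\bar\partial}$ in $H^{p,q}_{\partial}$ under $\bar\partial$, and $\partial L^{p-1,q}_{\partial}$ the (injective) image of $L^{p-1,q}_{\partial}$ in $H^{p,q}_{\bar\partial}$ under $\partial$. *)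

theory Defs
  imports "HOL-Analysis.Analysis" "HOL-Combinatorics.Permutations" "HOL-Algebra.Module"
    "HOL-Algebra.AbelCoset"
begin

section \<open>Complex vector spaces with explicit carriers\<close>

text \<open>
  A complex vector space is a \<^typ>\<open>(complex, 'v) module\<close> record over the ring below. The fields
  \<open>mult\<close> and \<open>one\<close>, which the record inherits from rings, play no role.
\<close>

definition complex_ring :: "complex ring" where
  "complex_ring = \<lparr>carrier = UNIV, mult = (*), one = 1, zero = 0, add = (+)\<rparr>"

definition subsp :: "(complex, 'v) module \<Rightarrow> 'v set \<Rightarrow> (complex, 'v) module" where
  "subsp V S = V\<lparr>carrier := S\<rparr>"

definition quot :: "(complex, 'v) module \<Rightarrow> 'v set \<Rightarrow> (complex, 'v set) module" where
  "quot V W = \<lparr>carrier = a_rcosets\<^bsub>V\<^esub> W, mult = undefined, one = undefined,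
     zero = W, add = set_add V,
     smult = (\<lambda>c C. \<Union>x\<in>C. W +>\<^bsub>V\<^esub> (c \<odot>\<^bsub>V\<^esub> x))\<rparr>"

definition dsum :: "(complex, 'v) module \<Rightarrow> (complex, 'w) module \<Rightarrow> (complex, 'v \<times> 'w) module"
    (infixr \<open>\<boxplus>\<close> 65) where
  "V \<boxplus> W = \<lparr>carrier = carrier V \<times> carrier W, mult = undefined, one = undefined,
     zero = (\<zero>\<^bsub>V\<^esub>, \<zero>\<^bsub>W\<^esub>),
     add = (\<lambda>(v, w) (v', w'). (v \<oplus>\<^bsub>V\<^esub> v', w \<oplus>\<^bsub>W\<^esub> w')),
     smult = (\<lambda>c (v, w). (c \<odot>\<^bsub>V\<^esub> v, c \<odot>\<^bsub>W\<^esub> w))\<rparr>"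

definition lin_isomorphic :: "(complex, 'v) module \<Rightarrow> (complex, 'w) module \<Rightarrow> bool"
    (infix \<open>\<cong>\<^sub>L\<close> 50) where
  "V \<cong>\<^sub>L W \<longleftrightarrow> (\<exists>h. bij_betw h (carrier V) (carrier W) \<and>
     (\<forall>x\<in>carrier V. \<forall>y\<in>carrier V. h (x \<oplus>\<^bsub>V\<^esub> y) = h x \<oplus>\<^bsub>W\<^esub> h y) \<and>
     (\<forall>c. \<forall>x\<in>carrier V. h (c \<odot>\<^bsub>V\<^esub> x) = c \<odot>\<^bsub>W\<^esub> h x))"

definition complement_in :: "(complex, 'v) module \<Rightarrow> 'v set \<Rightarrow> 'v set \<Rightarrow> 'v set \<Rightarrow> bool" where
  "complement_in V U W L \<longleftrightarrow>
     submodule L complex_ring V \<and> L \<inter> W = {\<zero>\<^bsub>V\<^esub>} \<and> L <+>\<^bsub>V\<^esub> W = U"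

text \<open>
  The map \<open>[x] \<mapsto> [f x]\<close> from a space of cosets to the cosets of \<open>W\<close> in \<open>V\<close>. If \<open>f\<close> respects
  classes, the union below is the single coset \<open>[f x]\<close>, for any \<open>x\<close> in \<open>C\<close>.
\<close>

definition class_map :: "(complex, 'w) module \<Rightarrow> 'w set \<Rightarrow> ('v \<Rightarrow> 'w) \<Rightarrow> 'v set \<Rightarrow> 'w set" where
  "class_map V W f C = (\<Union>x\<in>C. W +>\<^bsub>V\<^esub> f x)"


section \<open>Complex manifolds\<close>

primrec Ck_on :: "nat \<Rightarrow> 'v::real_normed_vector set \<Rightarrow> ('v \<Rightarrow> 'w::real_normed_vector) \<Rightarrow> bool" where
  "Ck_on 0 U f \<longleftrightarrow> continuous_on U f"
| "Ck_on (Suc k) U f \<longleftrightarrow> (\<forall>x\<in>U. f differentiable (at x)) \<and>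
     (\<forall>v. Ck_on k U (\<lambda>x. frechet_derivative f (at x) v))"

text \<open>This and the next notion are used for open \<open>U\<close> only.\<close>

definition smooth_on :: "'v::real_normed_vector set \<Rightarrow> ('v \<Rightarrow> 'w::real_normed_vector) \<Rightarrow> bool" where
  "smooth_on U f \<longleftrightarrow> (\<forall>k. Ck_on k U f)"

definition holomorphic_map_on ::
    "(complex^'n::finite) set \<Rightarrow> (complex^'n \<Rightarrow> complex^'m) \<Rightarrow> bool" where
  "holomorphic_map_on U f \<longleftrightarrow> smooth_on U f \<and>
     (\<forall>x\<in>U. \<forall>c v. frechet_derivative f (at x) (c *s v) = c *s frechet_derivative f (at x) v)"

type_synonym ('a, 'n) chart = "'a set \<times> ('a \<Rightarrow> complex^'n)"

abbreviation chart_image :: "('a, 'n::finite) chart \<Rightarrow> (complex^'n) set" where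
  "chart_image c \<equiv> snd c ` fst c"

definition transition :: "('a, 'n::finite) chart \<Rightarrow> ('a, 'n) chart \<Rightarrow> complex^'n \<Rightarrow> complex^'n" where
  "transition c d = snd d \<circ> inv_into (fst c) (snd c)"

definition complex_atlas :: "'a topology \<Rightarrow> ('a, 'n::finite) chart set \<Rightarrow> bool" where
  "complex_atlas X A \<longleftrightarrow>
     (\<forall>c\<in>A. openin X (fst c) \<and> open (chart_image c) \<and>
        homeomorphic_map (subtopology X (fst c)) (top_of_set (chart_image c)) (snd c)) \<and>
     (\<Union>c\<in>A. fst c) = topspace X \<and>
     (\<forall>c\<in>A. \<forall>d\<in>A. holomorphic_map_on (snd c ` (fst c \<inter> fst d)) (transition c d))"

definition compact_complex_manifold :: "'a topology \<Rightarrow> ('a, 'n::finite) chart set \<Rightarrow> bool" where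
  "compact_complex_manifold X A \<longleftrightarrow> Hausdorff_space X \<and> second_countable X \<and> compact_space X \<and>
     complex_atlas X A"


section \<open>Smooth forms of bidegree \<open>(p, q)\<close>\<close>

text \<open>
  A \<open>k\<close>-covector is a function of a sequence of vectors of which only the entries \<open>0, \<dots>, k - 1\<close>
  matter. The wedge product is normalised by
  \<open>(a\<^sub>0 \<and> \<dots> \<and> a\<^sub>k\<^sub>-\<^sub>1) (v\<^sub>0, \<dots>, v\<^sub>k\<^sub>-\<^sub>1) = det (a\<^sub>i (v\<^sub>j))\<close>.
\<close>

definition wedge :: "nat \<Rightarrow> (nat \<Rightarrow> complex^'n::finite \<Rightarrow> complex) \<Rightarrow> (nat \<Rightarrow> complex^'n) \<Rightarrow> complex" where
  "wedge k a v = (\<Sum>\<sigma> | \<sigma> permutes {..<k}. of_int (sign \<sigma>) * (\<Prod>i<k. a i (v (\<sigma> i))))"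

text \<open>
  The span of the products of \<open>p\<close> complex-linear and \<open>q\<close> complex-antilinear functionals. It is
  zero as soon as \<open>p\<close> or \<open>q\<close> exceeds the dimension.
\<close>

definition pq_covectors :: "nat \<Rightarrow> nat \<Rightarrow> ((nat \<Rightarrow> complex^'n::finite) \<Rightarrow> complex) set" where
  "pq_covectors p q = {\<theta>. \<exists>m (s :: nat \<Rightarrow> complex) a.
     (\<forall>j<m. (\<forall>i<p. Vector_Spaces.linear (*s) (*) (a j i)) \<and>
            (\<forall>i. p \<le> i \<and> i < p + q \<longrightarrow> Vector_Spaces.linear (*s) (*) (cnj \<circ> a j i))) \<and>
     \<theta> = (\<lambda>v. \<Sum>j<m. s j * wedge (p + q) (a j) v)}"

text \<open>
  A form on the manifold is the family of its representatives in the charts of the atlas, which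
  are pullbacks of one another under the transition maps. It is zero at meaningless arguments, so
  that equality of forms is equality of functions.
\<close>

type_synonym ('a, 'n) form =
  "('a, 'n) chart \<Rightarrow> complex^'n \<Rightarrow> (nat \<Rightarrow> complex^'n) \<Rightarrow> complex"

definition smooth_pq_form :: "('a, 'n::finite) chart set \<Rightarrow> nat \<Rightarrow> nat \<Rightarrow> ('a, 'n) form \<Rightarrow> bool" where
  "smooth_pq_form A p q \<omega> \<longleftrightarrow>
     (\<forall>c\<in>A. \<forall>x\<in>chart_image c. \<omega> c x \<in> pq_covectors p q) \<and>
     (\<forall>c\<in>A. \<forall>v. smooth_on (chart_image c) (\<lambda>x. \<omega> c x v)) \<and>
     (\<forall>c\<in>A. \<forall>d\<in>A. \<forall>m\<in>fst c \<inter> fst d. \<forall>v.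
        \<omega> c (snd c m) v =
        \<omega> d (snd d m) (\<lambda>i. frechet_derivative (transition c d) (at (snd c m)) (v i))) \<and>
     (\<forall>c x v. c \<notin> A \<or> x \<notin> chart_image c \<longrightarrow> \<omega> c x v = 0)"

definition forms :: "('a, 'n::finite) chart set \<Rightarrow> int \<Rightarrow> int \<Rightarrow> (complex, ('a, 'n) form) module" where
  "forms A p q = \<lparr>
     carrier = (if 0 \<le> p \<and> 0 \<le> q then {\<omega>. smooth_pq_form A (nat p) (nat q) \<omega>}
                else {\<lambda>c x v. 0}),
     mult = undefined, one = undefined, zero = (\<lambda>c x v. 0),
     add = (\<lambda>\<omega> \<eta> c x v. \<omega> c x v + \<eta> c x v),
     smult = (\<lambda>s \<omega> c x v. s * \<omega> c x v)\<rparr>"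

text \<open>
  The complex-linear and complex-antilinear parts of the real differential:
  \<open>\<Sum>\<^sub>j \<partial>f/\<partial>z\<^sub>j dz\<^sub>j\<close> and \<open>\<Sum>\<^sub>j \<partial>f/\<partial>\<bar>z\<^sub>j d\<bar>z\<^sub>j\<close>, applied to \<open>v\<close>.
\<close>

definition d10 :: "(complex^'n::finite \<Rightarrow> complex) \<Rightarrow> complex^'n \<Rightarrow> complex^'n \<Rightarrow> complex" where
  "d10 f x v = (frechet_derivative f (at x) v - \<i> * frechet_derivative f (at x) (\<i> *s v)) / 2"

definition d01 :: "(complex^'n::finite \<Rightarrow> complex) \<Rightarrow> complex^'n \<Rightarrow> complex^'n \<Rightarrow> complex" where
  "d01 f x v = (frechet_derivative f (at x) v + \<i> * frechet_derivative f (at x) (\<i> *s v)) / 2"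

definition skip :: "nat \<Rightarrow> (nat \<Rightarrow> 'v) \<Rightarrow> nat \<Rightarrow> 'v" where
  "skip i v = (\<lambda>j. if j < i then v j else v (Suc j))"

text \<open>
  In a chart, \<open>\<partial> (f dz\<^sub>I \<and> d\<bar>z\<^sub>J) = \<partial>f \<and> dz\<^sub>I \<and> d\<bar>z\<^sub>J\<close>; expanding the determinant along \<open>\<partial>f\<close> gives
  \<open>\<partial>\<omega> (v\<^sub>0, \<dots>, v\<^sub>k) = \<Sum>\<^sub>i (-1)\<^sup>i \<partial>(\<omega> (v\<^sub>0, \<dots>, v\<^sub>i\<^sub>-\<^sub>1, v\<^sub>i\<^sub>+\<^sub>1, \<dots>, v\<^sub>k)) (v\<^sub>i)\<close>, where \<open>k = p + q\<close>.
\<close>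

definition del :: "('a, 'n::finite) chart set \<Rightarrow> int \<Rightarrow> int \<Rightarrow> ('a, 'n) form \<Rightarrow> ('a, 'n) form" where
  "del A p q \<omega> = (\<lambda>c x v. if c \<in> A \<and> x \<in> chart_image c
     then \<Sum>i\<le>nat (p + q). (- 1) ^ i * d10 (\<lambda>y. \<omega> c y (skip i v)) x (v i) else 0)"

definition delbar :: "('a, 'n::finite) chart set \<Rightarrow> int \<Rightarrow> int \<Rightarrow> ('a, 'n) form \<Rightarrow> ('a, 'n) form" where
  "delbar A p q \<omega> = (\<lambda>c x v. if c \<in> A \<and> x \<in> chart_image c
     then \<Sum>i\<le>nat (p + q). (- 1) ^ i * d01 (\<lambda>y. \<omega> c y (skip i v)) x (v i) else 0)"

definition ddbar :: "('a, 'n::finite) chart set \<Rightarrow> int \<Rightarrow> int \<Rightarrow> ('a, 'n) form \<Rightarrow> ('a, 'n) form" where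
  "ddbar A p q \<omega> = del A p (q + 1) (delbar A p q \<omega>)"


section \<open>Cohomology\<close>

text \<open>All kernels and images below are subspaces of the forms of bidegree \<open>(p, q)\<close>.\<close>

definition ker_del :: "('a, 'n::finite) chart set \<Rightarrow> int \<Rightarrow> int \<Rightarrow> ('a, 'n) form set" where
  "ker_del A p q = {\<omega> \<in> carrier (forms A p q). del A p q \<omega> = \<zero>\<^bsub>forms A (p + 1) q\<^esub>}"

definition ker_delbar :: "('a, 'n::finite) chart set \<Rightarrow> int \<Rightarrow> int \<Rightarrow> ('a, 'n) form set" where
  "ker_delbar A p q = {\<omega> \<in> carrier (forms A p q). delbar A p q \<omega> = \<zero>\<^bsub>forms A p (q + 1)\<^esub>}"

definition ker_ddbar :: "('a, 'n::finite) chart set \<Rightarrow> int \<Rightarrow> int \<Rightarrow> ('a, 'n) form set" where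
  "ker_ddbar A p q = {\<omega> \<in> carrier (forms A p q). ddbar A p q \<omega> = \<zero>\<^bsub>forms A (p + 1) (q + 1)\<^esub>}"

definition im_del :: "('a, 'n::finite) chart set \<Rightarrow> int \<Rightarrow> int \<Rightarrow> ('a, 'n) form set" where
  "im_del A p q = del A (p - 1) q ` carrier (forms A (p - 1) q)"

definition im_delbar :: "('a, 'n::finite) chart set \<Rightarrow> int \<Rightarrow> int \<Rightarrow> ('a, 'n) form set" where
  "im_delbar A p q = delbar A p (q - 1) ` carrier (forms A p (q - 1))"

definition im_ddbar :: "('a, 'n::finite) chart set \<Rightarrow> int \<Rightarrow> int \<Rightarrow> ('a, 'n) form set" where
  "im_ddbar A p q = ddbar A (p - 1) (q - 1) ` carrier (forms A (p - 1) (q - 1))"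

definition im_sum :: "('a, 'n::finite) chart set \<Rightarrow> int \<Rightarrow> int \<Rightarrow> ('a, 'n) form set" where
  "im_sum A p q = im_del A p q <+>\<^bsub>forms A p q\<^esub> im_delbar A p q"

definition H_BC :: "('a, 'n::finite) chart set \<Rightarrow> int \<Rightarrow> int \<Rightarrow> (complex, ('a, 'n) form set) module" where
  "H_BC A p q = quot (subsp (forms A p q) (ker_del A p q \<inter> ker_delbar A p q)) (im_ddbar A p q)"

definition H_A :: "('a, 'n::finite) chart set \<Rightarrow> int \<Rightarrow> int \<Rightarrow> (complex, ('a, 'n) form set) module" where
  "H_A A p q = quot (subsp (forms A p q) (ker_ddbar A p q)) (im_sum A p q)"

definition H_K :: "('a, 'n::finite) chart set \<Rightarrow> int \<Rightarrow> int \<Rightarrow> (complex, ('a, 'n) form set) module" where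
  "H_K A p q = quot (subsp (forms A p q) (ker_del A p q \<inter> ker_delbar A p q))
     ((im_del A p q \<inter> ker_delbar A p q) <+>\<^bsub>forms A p q\<^esub> (im_delbar A p q \<inter> ker_del A p q))"

definition H_del :: "('a, 'n::finite) chart set \<Rightarrow> int \<Rightarrow> int \<Rightarrow> (complex, ('a, 'n) form set) module" where
  "H_del A p q = quot (subsp (forms A p q) (ker_del A p q)) (im_del A p q)"

definition H_delbar :: "('a, 'n::finite) chart set \<Rightarrow> int \<Rightarrow> int \<Rightarrow> (complex, ('a, 'n) form set) module" where
  "H_delbar A p q = quot (subsp (forms A p q) (ker_delbar A p q)) (im_delbar A p q)"

text \<open>The maps out of \<open>H_A A p q\<close>; the suffix names the target.\<close>

definition del_to_H_delbar ::
    "('a, 'n::finite) chart set \<Rightarrow> int \<Rightarrow> int \<Rightarrow> ('a, 'n) form set \<Rightarrow> ('a, 'n) form set" where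
  "del_to_H_delbar A p q = class_map (forms A (p + 1) q) (im_delbar A (p + 1) q) (del A p q)"

definition delbar_to_H_del ::
    "('a, 'n::finite) chart set \<Rightarrow> int \<Rightarrow> int \<Rightarrow> ('a, 'n) form set \<Rightarrow> ('a, 'n) form set" where
  "delbar_to_H_del A p q = class_map (forms A p (q + 1)) (im_del A p (q + 1)) (delbar A p q)"

definition del_to_H_BC ::
    "('a, 'n::finite) chart set \<Rightarrow> int \<Rightarrow> int \<Rightarrow> ('a, 'n) form set \<Rightarrow> ('a, 'n) form set" where
  "del_to_H_BC A p q = class_map (forms A (p + 1) q) (im_ddbar A (p + 1) q) (del A p q)"

definition delbar_to_H_BC ::
    "('a, 'n::finite) chart set \<Rightarrow> int \<Rightarrow> int \<Rightarrow> ('a, 'n) form set \<Rightarrow> ('a, 'n) form set" where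
  "delbar_to_H_BC A p q = class_map (forms A p (q + 1)) (im_ddbar A p (q + 1)) (delbar A p q)"

definition pi_A ::
    "('a, 'n::finite) chart set \<Rightarrow> int \<Rightarrow> int \<Rightarrow> ('a, 'n) form set \<Rightarrow> ('a, 'n) form set" where
  "pi_A A p q = class_map (forms A p q) (im_sum A p q) (\<lambda>\<omega>. \<omega>)"

definition calG_del :: "('a, 'n::finite) chart set \<Rightarrow> int \<Rightarrow> int \<Rightarrow> ('a, 'n) form set set" where
  "calG_del A p q =
     {C \<in> carrier (H_A A p q). del_to_H_delbar A p q C = \<zero>\<^bsub>H_delbar A (p + 1) q\<^esub>}"

definition calG_delbar :: "('a, 'n::finite) chart set \<Rightarrow> int \<Rightarrow> int \<Rightarrow> ('a, 'n) form set set" where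
  "calG_delbar A p q =
     {C \<in> carrier (H_A A p q). delbar_to_H_del A p q C = \<zero>\<^bsub>H_del A p (q + 1)\<^esub>}"

text \<open>
  \<open>G\<close> and \<open>L\<close>, which are the quotients \<open>\<G> / im \<pi>\<^sub>A\<close> and \<open>H\<^sub>A / \<G>\<close>, enter as subspaces of \<open>H\<^sub>A\<close>:
  \<open>G\<close> as a complement of \<open>im \<pi>\<^sub>A\<close> in \<open>\<G>\<close> and \<open>L\<close> as a complement of \<open>\<G>\<close> in \<open>H\<^sub>A\<close>. The orthogonal
  complements with respect to a hermitian metric are one such choice.
\<close>

definition GL_del :: "('a, 'n::finite) chart set \<Rightarrow> (int \<Rightarrow> int \<Rightarrow> ('a, 'n) form set set) \<Rightarrow>
    (int \<Rightarrow> int \<Rightarrow> ('a, 'n) form set set) \<Rightarrow> bool" where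
  "GL_del A G L \<longleftrightarrow> (\<forall>p q.
     complement_in (H_A A p q) (calG_del A p q) (pi_A A p q ` carrier (H_del A p q)) (G p q) \<and>
     complement_in (H_A A p q) (carrier (H_A A p q)) (calG_del A p q) (L p q))"

definition GL_delbar :: "('a, 'n::finite) chart set \<Rightarrow> (int \<Rightarrow> int \<Rightarrow> ('a, 'n) form set set) \<Rightarrow>
    (int \<Rightarrow> int \<Rightarrow> ('a, 'n) form set set) \<Rightarrow> bool" where
  "GL_delbar A G L \<longleftrightarrow> (\<forall>p q.
     complement_in (H_A A p q) (calG_delbar A p q) (pi_A A p q ` carrier (H_delbar A p q)) (G p q) \<and>
     complement_in (H_A A p q) (carrier (H_A A p q)) (calG_delbar A p q) (L p q))"

end

theory Submission
  imports Defs
begin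

text \<open>
  Everything follows from the linear algebra of a double complex. Write \<open>f\<close> and \<open>f'\<close> for the maps
  \<open>H\<^sub>A \<rightarrow> H\<^sub>B\<^sub>C\<close> induced by \<open>\<partial>\<close> and \<open>\<bar>\<partial>\<close>. If \<open>\<partial>\<theta> = \<partial>\<bar>\<partial>\<eta>\<close> then \<open>\<theta> - \<bar>\<partial>\<eta>\<close> is \<open>\<partial>\<close>-closed, so \<open>ker f\<close> is the image
  of \<open>H\<^sub>\<partial>\<close> and \<open>f\<close> is injective on \<open>G \<oplus> L\<close>. The classes that \<open>f'\<close> maps into \<open>im f\<close> are exactly those of \<open>\<G>\<close>
  for \<open>\<bar>\<partial>\<close>, so \<open>im f + im f' = im f \<oplus> f' L'\<close>, and this sum is the kernel of \<open>H\<^sub>B\<^sub>C \<rightarrow> K\<close>. Likewise the kernel of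
  \<open>H\<^sub>\<partial> \<rightarrow> H\<^sub>A\<close> is the image of \<open>L'\<close>. That smooth forms are a double complex
  rests on a characterisation: the covectors of bidegree \<open>(p, q)\<close> are the alternating real multilinear
  \<open>\<theta>\<close> with \<open>\<theta> (z v) = z\<^sup>p (cnj z)\<^sup>q \<theta> v\<close>, a condition that is visibly respected by \<open>\<partial>\<close> and \<open>\<bar>\<partial>\<close>.
\<close>

section \<open>Smooth functions\<close>

text \<open>On the analytic side the obstacle is that bidegree is defined through wedge products,
  while the formula for \<open>del\<close> evaluates on vectors and contains no coordinates. The
  weight criterion bridges this: alternation is tested on adjacent swaps and type on one scalar z,
  so no basis of forms is ever differentiated. Holomorphy of the transition maps enters in the
  change of charts: their first derivatives are complex-linear, hence their second derivatives are
  symmetric and complex-bilinear, and these cancel in an alternating sum. Both operators are one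
  operator with a sign s, so that square zero is the case s = t of anticommutation. On the algebraic
  side, \<G> is defined by Dolbeault classes and must first be rewritten as a condition in H_BC. The
  space K comes without a chosen complement, so it is split off along one given by Zorn's lemma. The
  transpose of a double complex is again one, and it yields the second and fourth decompositions
  from the first and third.\<close>

abbreviation fd :: "('v::real_normed_vector \<Rightarrow> 'w::real_normed_vector) \<Rightarrow> 'v \<Rightarrow> 'v \<Rightarrow> 'w" where
  "fd f x \<equiv> frechet_derivative f (at x)"

lemma frechet_derivative_cong_open:
  assumes "open U" "x \<in> U" "\<And>y. y \<in> U \<Longrightarrow> f y = g y"
  shows "fd f x = fd g x"
proof -
  have "(f has_derivative f') (at x) \<longleftrightarrow> (g has_derivative f') (at x)" for f'
    using assms has_derivative_transform_within_open[of f f' x UNIV U g]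
      has_derivative_transform_within_open[of g f' x UNIV U f] by auto
  then show ?thesis
    by (simp add: frechet_derivative_def)
qed

lemma differentiable_cong_open:
  assumes "open U" "x \<in> U" "\<And>y. y \<in> U \<Longrightarrow> f y = g y"
  shows "f differentiable (at x) \<longleftrightarrow> g differentiable (at x)"
  unfolding differentiable_def
  using assms has_derivative_transform_within_open[of f _ x UNIV U g]
      has_derivative_transform_within_open[of g _ x UNIV U f] by metis

lemma frechet_derivative_has: "f differentiable (at x) \<Longrightarrow> (f has_derivative fd f x) (at x)"
  by (simp add: frechet_derivative_works)

lemma frechet_derivative_eqI: "(f has_derivative f') (at x) \<Longrightarrow> fd f x = f'"
  by (rule frechet_derivative_at[symmetric])

lemma linear_frechet: "f differentiable (at x) \<Longrightarrow> linear (fd f x)"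
  using frechet_derivative_has has_derivative_linear by blast

lemma Ck_on_cong:
  assumes "open U" "\<And>y. y \<in> U \<Longrightarrow> f y = g y"
  shows "Ck_on k U f \<longleftrightarrow> Ck_on k U g"
  using assms(2)
proof (induction k arbitrary: f g)
  case 0
  then show ?case by (simp cong: continuous_on_cong)
next
  case (Suc k)
  have "Ck_on k U (\<lambda>x. fd f x v) \<longleftrightarrow> Ck_on k U (\<lambda>x. fd g x v)" for v
    by (rule Suc.IH) (metis frechet_derivative_cong_open[OF assms(1)] Suc.prems)
  moreover have "f differentiable (at x) \<longleftrightarrow> g differentiable (at x)" if "x \<in> U" for x
    using differentiable_cong_open[OF assms(1) that] Suc.prems by blast
  ultimately show ?case by auto
qed

lemma smooth_on_cong:
  assumes "open U" "\<And>y. y \<in> U \<Longrightarrow> f y = g y"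
  shows "smooth_on U f \<longleftrightarrow> smooth_on U g"
  unfolding smooth_on_def using Ck_on_cong[OF assms(1), of f g] assms(2) by auto

lemma smooth_on_differentiable: "smooth_on U f \<Longrightarrow> x \<in> U \<Longrightarrow> f differentiable (at x)"
  unfolding smooth_on_def using Ck_on.simps(2) by blast

lemma smooth_on_frechet: "smooth_on U f \<Longrightarrow> smooth_on U (\<lambda>x. fd f x v)"
  unfolding smooth_on_def using Ck_on.simps(2) by blast

lemma smooth_on_continuous: "smooth_on U f \<Longrightarrow> continuous_on U f"
  unfolding smooth_on_def using Ck_on.simps(1) by blast

lemma Ck_on_bounded_linear:
  assumes "open U" "bounded_linear h" "Ck_on k U f"
  shows "Ck_on k U (\<lambda>x. h (f x))"
  using assms(3)
proof (induction k arbitrary: f)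
  case 0
  then show ?case using assms(2) by (simp add: linear_continuous_on_compose linear_linear bounded_linear.continuous_on)
next
  case (Suc k)
  have d: "((\<lambda>x. h (f x)) has_derivative (\<lambda>v. h (fd f x v))) (at x)" if "x \<in> U" for x
    using Suc.prems that by (intro bounded_linear.has_derivative[OF assms(2)] frechet_derivative_has) simp
  have "Ck_on k U (\<lambda>x. h (fd f x v))" for v
    using Suc.IH Suc.prems by simp
  then have "Ck_on k U (\<lambda>x. fd (\<lambda>x. h (f x)) x v)" for v
    using Ck_on_cong[OF assms(1), of "\<lambda>x. fd (\<lambda>x. h (f x)) x v" "\<lambda>x. h (fd f x v)" k]
      frechet_derivative_eqI[OF d] by simp
  then show ?case using d unfolding Ck_on.simps differentiable_def by blast
qed

lemma smooth_on_bounded_linear: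
  "open U \<Longrightarrow> bounded_linear h \<Longrightarrow> smooth_on U f \<Longrightarrow> smooth_on U (\<lambda>x. h (f x))"
  unfolding smooth_on_def using Ck_on_bounded_linear by blast

lemma Ck_on_add:
  assumes "open U" "Ck_on k U f" "Ck_on k U g"
  shows "Ck_on k U (\<lambda>x. f x + g x)"
  using assms(2,3)
proof (induction k arbitrary: f g)
  case 0
  then show ?case by (simp add: continuous_on_add)
next
  case (Suc k)
  have d: "((\<lambda>x. f x + g x) has_derivative (\<lambda>v. fd f x v + fd g x v)) (at x)"
    if "x \<in> U" for x
    using Suc.prems that by (intro has_derivative_add frechet_derivative_has) auto
  have "Ck_on k U (\<lambda>x. fd f x v + fd g x v)" for v
    using Suc.IH Suc.prems by simp
  then have "Ck_on k U (\<lambda>x. fd (\<lambda>x. f x + g x) x v)" for v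
    using Ck_on_cong[OF assms(1), of "\<lambda>x. fd (\<lambda>x. f x + g x) x v"
        "\<lambda>x. fd f x v + fd g x v" k]
      frechet_derivative_eqI[OF d] by simp
  then show ?case using d unfolding Ck_on.simps differentiable_def by blast
qed

lemma smooth_on_add:
  "open U \<Longrightarrow> smooth_on U f \<Longrightarrow> smooth_on U g \<Longrightarrow> smooth_on U (\<lambda>x. f x + g x)"
  unfolding smooth_on_def using Ck_on_add by blast

lemma Ck_on_const: "Ck_on k U (\<lambda>_. c)"
proof (induction k arbitrary: c)
  case (Suc k)
  have "fd (\<lambda>_. c) x = (\<lambda>_. 0)" for x :: 'a
    by (rule frechet_derivative_eqI) simp
  then show ?case using Suc by simp
qed simp

lemma smooth_on_const: "smooth_on U (\<lambda>_. c)"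
  unfolding smooth_on_def using Ck_on_const by blast

lemma smooth_on_sum:
  assumes "open U" "\<And>i. i \<in> I \<Longrightarrow> smooth_on U (f i)"
  shows "smooth_on U (\<lambda>x. \<Sum>i\<in>I. f i x)"
  using assms(2)
  by (induction I rule: infinite_finite_induct)
    (auto simp: smooth_on_const intro: smooth_on_add assms(1))

text \<open>Both mixed second derivatives are limits of the same difference quotient.\<close>

lemma second_difference_mvt:
  fixes f :: "'v::real_normed_vector \<Rightarrow> real"
  assumes "h > 0"
    and "\<And>s t. 0 \<le> s \<Longrightarrow> s \<le> h \<Longrightarrow> 0 \<le> t \<Longrightarrow> t \<le> h \<Longrightarrow> x + s *\<^sub>R u + t *\<^sub>R w \<in> U"
    and "\<And>y. y \<in> U \<Longrightarrow> f differentiable (at y)"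
    and "\<And>y. y \<in> U \<Longrightarrow> (\<lambda>z. fd f z u) differentiable (at y)"
  obtains s t where "0 < s" "s < h" "0 < t" "t < h"
    "f (x + h *\<^sub>R u + h *\<^sub>R w) - f (x + h *\<^sub>R u) - f (x + h *\<^sub>R w) + f x
       = h * h * fd (\<lambda>z. fd f z u) (x + s *\<^sub>R u + t *\<^sub>R w) w"
proof -
  let ?D = "\<lambda>z. fd f z u"
  have d1: "((\<lambda>s. f (x + s *\<^sub>R u + t *\<^sub>R w)) has_real_derivative ?D (x + s *\<^sub>R u + t *\<^sub>R w)) (at s)"
    if "0 \<le> s" "s \<le> h" "0 \<le> t" "t \<le> h" for s t
  proof -
    have l: "linear (fd f (x + s *\<^sub>R u + t *\<^sub>R w))"
      by (rule linear_frechet[OF assms(3)[OF assms(2)[OF that]]])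
    have "((\<lambda>s. x + s *\<^sub>R u + t *\<^sub>R w) has_derivative (\<lambda>r. r *\<^sub>R u)) (at s)"
      by (auto intro!: derivative_eq_intros)
    from diff_chain_at[OF this frechet_derivative_has[OF assms(3)[OF assms(2)[OF that]]]]
    have "((\<lambda>s. f (x + s *\<^sub>R u + t *\<^sub>R w)) has_derivative
      (\<lambda>r. fd f (x + s *\<^sub>R u + t *\<^sub>R w) (r *\<^sub>R u))) (at s)"
      by (simp add: o_def)
    then show ?thesis
      unfolding has_field_derivative_def
      by (simp add: linear_cmul[OF l] mult_commute_abs)
  qed
  have d2: "((\<lambda>t. ?D (x + s *\<^sub>R u + t *\<^sub>R w)) has_real_derivative
      fd ?D (x + s *\<^sub>R u + t *\<^sub>R w) w) (at t)"
    if "0 \<le> s" "s \<le> h" "0 \<le> t" "t \<le> h" for s t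
  proof -
    have l: "linear (fd ?D (x + s *\<^sub>R u + t *\<^sub>R w))"
      by (rule linear_frechet[OF assms(4)[OF assms(2)[OF that]]])
    have "((\<lambda>t. x + s *\<^sub>R u + t *\<^sub>R w) has_derivative (\<lambda>r. r *\<^sub>R w)) (at t)"
      by (auto intro!: derivative_eq_intros)
    from diff_chain_at[OF this frechet_derivative_has[OF assms(4)[OF assms(2)[OF that]]]]
    have "((\<lambda>t. ?D (x + s *\<^sub>R u + t *\<^sub>R w)) has_derivative
      (\<lambda>r. fd ?D (x + s *\<^sub>R u + t *\<^sub>R w) (r *\<^sub>R w))) (at t)"
      by (simp add: o_def)
    then show ?thesis
      unfolding has_field_derivative_def
      by (simp add: linear_cmul[OF l] mult_commute_abs)
  qed
  \<comment> \<open>The mean value theorem is applied in s to the increment of f along h w, and then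
    in t to the derivative along u.\<close>
  have "((\<lambda>s. f (x + s *\<^sub>R u + h *\<^sub>R w) - f (x + s *\<^sub>R u)) has_real_derivative
      ?D (x + s *\<^sub>R u + h *\<^sub>R w) - ?D (x + s *\<^sub>R u + 0 *\<^sub>R w)) (at s)" if "0 \<le> s" "s \<le> h" for s
    using DERIV_diff[OF d1[OF that, of h] d1[OF that, of 0]] assms(1) by simp
  from MVT2[OF assms(1) this] obtain s where s: "0 < s" "s < h"
    "f (x + h *\<^sub>R u + h *\<^sub>R w) - f (x + h *\<^sub>R u) - (f (x + 0 *\<^sub>R u + h *\<^sub>R w) - f (x + 0 *\<^sub>R u))
      = (h - 0) * (?D (x + s *\<^sub>R u + h *\<^sub>R w) - ?D (x + s *\<^sub>R u + 0 *\<^sub>R w))" by blast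
  have "\<exists>t. 0 < t \<and> t < h \<and> ?D (x + s *\<^sub>R u + h *\<^sub>R w) - ?D (x + s *\<^sub>R u + 0 *\<^sub>R w) =
      (h - 0) * fd ?D (x + s *\<^sub>R u + t *\<^sub>R w) w"
    by (rule MVT2[OF assms(1)]) (use d2 s in auto)
  then obtain t where "0 < t" "t < h" "?D (x + s *\<^sub>R u + h *\<^sub>R w) - ?D (x + s *\<^sub>R u + 0 *\<^sub>R w) =
      (h - 0) * fd ?D (x + s *\<^sub>R u + t *\<^sub>R w) w" by blast
  with s show ?thesis
    by (intro that[of s t]) (auto simp: algebra_simps)
qed

lemma smooth_on_clairaut_real:
  fixes f :: "'v::real_normed_vector \<Rightarrow> real"
  assumes U: "open U" "x \<in> U" and f: "smooth_on U f"
  shows "fd (\<lambda>z. fd f z u) x w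
       = fd (\<lambda>z. fd f z w) x u" (is "?P x = ?Q x")
proof (rule ccontr)
  define P Q where "P = ?P" and "Q = ?Q"
  assume "?P x \<noteq> ?Q x"
  \<comment> \<open>Half the gap: values of P and Q at two nearby points, each closer than e to its
    value at x, cannot coincide.\<close>
  define e where "e = \<bar>P x - Q x\<bar> / 2"
  have e: "e > 0" using \<open>?P x \<noteq> ?Q x\<close> by (simp add: e_def P_def Q_def)
  have "continuous_on U P" "continuous_on U Q"
    unfolding P_def Q_def by (intro smooth_on_continuous smooth_on_frechet f)+
  then have "isCont P x" "isCont Q x"
    using U by (simp_all add: continuous_on_eq_continuous_at)
  then obtain d1 d2 where d: "d1 > 0" "\<And>y. dist y x < d1 \<Longrightarrow> dist (P y) (P x) < e"
     "d2 > 0" "\<And>y. dist y x < d2 \<Longrightarrow> dist (Q y) (Q x) < e"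
    using e unfolding continuous_at_eps_delta by metis
  obtain d3 where d3: "d3 > 0" "ball x d3 \<subseteq> U" using U open_contains_ball by blast
  define r where "r = min d1 (min d2 d3)"
  have r: "r > 0" using d d3 by (simp add: r_def)
  \<comment> \<open>The summand 1 keeps the denominator positive when u and w vanish; the
    parallelogram with sides h u and h w stays within distance r of x.\<close>
  define h where "h = r / (2 * (norm u + norm w + 1))"
  have h: "h > 0" using r by (simp add: h_def add_nonneg_pos)
  have near: "dist (x + s *\<^sub>R u + t *\<^sub>R w) x < r" if "0 \<le> s" "s \<le> h" "0 \<le> t" "t \<le> h" for s t
  proof -
    have "dist (x + s *\<^sub>R u + t *\<^sub>R w) x = norm (s *\<^sub>R u + t *\<^sub>R w)" by (simp add: dist_norm)
    also have "\<dots> \<le> s * norm u + t * norm w"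
      using norm_triangle_ineq[of "s *\<^sub>R u" "t *\<^sub>R w"] that by simp
    also have "\<dots> \<le> h * norm u + h * norm w" using that by (intro add_mono mult_right_mono) auto
    also have "\<dots> < 2 * (h * (norm u + norm w + 1))" using h
      by (simp add: algebra_simps add_nonneg_pos)
    also have "\<dots> = r" unfolding h_def using add_nonneg_pos[of "norm u + norm w" 1] by (simp add: field_simps)
    finally show ?thesis .
  qed
  have inU: "x + s *\<^sub>R u + t *\<^sub>R w \<in> U" if "0 \<le> s" "s \<le> h" "0 \<le> t" "t \<le> h" for s t
    using near[OF that] d3 by (auto simp: r_def dist_commute subset_iff)
  have inU': "x + s *\<^sub>R w + t *\<^sub>R u \<in> U" if "0 \<le> s" "s \<le> h" "0 \<le> t" "t \<le> h" for s t
    using inU[OF that(3,4,1,2)] by (simp add: add_ac)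
  have df: "f differentiable (at y)" "(\<lambda>z. fd f z v) differentiable (at y)" if "y \<in> U" for y v
    using f that smooth_on_differentiable smooth_on_frechet by blast+
  obtain s t where st: "0 < s" "s < h" "0 < t" "t < h"
    "f (x + h *\<^sub>R u + h *\<^sub>R w) - f (x + h *\<^sub>R u) - f (x + h *\<^sub>R w) + f x = h * h * P (x + s *\<^sub>R u + t *\<^sub>R w)"
    unfolding P_def by (rule second_difference_mvt[OF h inU df(1) df(2)])
  obtain s' t' where st': "0 < s'" "s' < h" "0 < t'" "t' < h"
    "f (x + h *\<^sub>R w + h *\<^sub>R u) - f (x + h *\<^sub>R w) - f (x + h *\<^sub>R u) + f x = h * h * Q (x + s' *\<^sub>R w + t' *\<^sub>R u)"
    unfolding Q_def by (rule second_difference_mvt[OF h inU' df(1) df(2)])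
  \<comment> \<open>The second difference does not change when u and w are exchanged, so both mean
    values describe the same number.\<close>
  have "h * h * P (x + s *\<^sub>R u + t *\<^sub>R w) = h * h * Q (x + s' *\<^sub>R w + t' *\<^sub>R u)"
    unfolding st(5)[symmetric] st'(5)[symmetric] by (simp add: add_ac)
  then have eq: "P (x + s *\<^sub>R u + t *\<^sub>R w) = Q (x + s' *\<^sub>R w + t' *\<^sub>R u)" using h by simp
  have "dist (P (x + s *\<^sub>R u + t *\<^sub>R w)) (P x) < e"
    using near[of s t] st d(2) by (simp add: r_def)
  moreover have "dist (Q (x + s' *\<^sub>R w + t' *\<^sub>R u)) (Q x) < e"
    using near[of t' s'] st' d(4) by (simp add: r_def add_ac)
  ultimately show False
    unfolding eq e_def dist_real_def by (auto simp: abs_if split: if_splits)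
qed

text \<open>The mean value theorem needs real values, so the claim is reduced to components along a
  basis, and taking a component commutes with differentiation.\<close>

lemma smooth_on_clairaut:
  fixes f :: "'v::real_normed_vector \<Rightarrow> 'w::euclidean_space"
  assumes U: "open U" "x \<in> U" and f: "smooth_on U f"
  shows "fd (\<lambda>z. fd f z u) x w
       = fd (\<lambda>z. fd f z w) x u"
proof (rule euclidean_eqI)
  fix b :: 'w
  have bl: "bounded_linear (\<lambda>z. z \<bullet> b)" by (rule bounded_linear_inner_left)
  have sm: "smooth_on U (\<lambda>x. f x \<bullet> b)" by (rule smooth_on_bounded_linear[OF U(1) bl f])
  have 1: "fd (\<lambda>x. g x \<bullet> b) y = (\<lambda>v. fd g y v \<bullet> b)"
    if "smooth_on U g" "y \<in> U" for g :: "'v \<Rightarrow> 'w" and y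
    by (intro frechet_derivative_eqI bounded_linear.has_derivative[OF bl] frechet_derivative_has
        smooth_on_differentiable[OF that])
  have 2: "fd (\<lambda>z. fd f z u) x w \<bullet> b
    = fd (\<lambda>z. fd (\<lambda>x. f x \<bullet> b) z u) x w" for u w
  proof -
    have "fd (\<lambda>z. fd (\<lambda>x. f x \<bullet> b) z u) x
      = fd (\<lambda>z. fd f z u \<bullet> b) x"
      by (rule frechet_derivative_cong_open[OF U]) (simp add: 1[OF f])
    then show ?thesis by (simp add: 1[OF smooth_on_frechet[OF f] U(2)])
  qed
  show "fd (\<lambda>z. fd f z u) x w \<bullet> b
       = fd (\<lambda>z. fd f z w) x u \<bullet> b"
    unfolding 2 by (rule smooth_on_clairaut_real[OF U sm])
qed

section \<open>Covectors of bidegree \<open>(p, q)\<close>\<close>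

text \<open>Linearity is over the reals, since a covector of mixed bidegree is in general neither
  complex-linear nor antilinear in a given slot. The second clause is needed because the arguments
  are infinite sequences.\<close>

definition multilin :: "nat \<Rightarrow> ((nat \<Rightarrow> 'v::real_vector) \<Rightarrow> complex) \<Rightarrow> bool" where
  "multilin k \<theta> \<longleftrightarrow> (\<forall>j<k. \<forall>v. linear (\<lambda>w. \<theta> (v(j := w)))) \<and>
     (\<forall>v w. (\<forall>i<k. v i = w i) \<longrightarrow> \<theta> v = \<theta> w)"

abbreviation adj :: "nat \<Rightarrow> nat \<Rightarrow> nat" where
  "adj a \<equiv> Transposition.transpose a (Suc a)"

text \<open>Adjacent swaps are the easiest to verify for a derivative, and they generate the rest:
  see \<open>alt_form_permutes\<close>.\<close>

definition alt_form :: "nat \<Rightarrow> ((nat \<Rightarrow> 'v::real_vector) \<Rightarrow> complex) \<Rightarrow> bool" where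
  "alt_form k \<theta> \<longleftrightarrow> multilin k \<theta> \<and>
     (\<forall>a v. Suc a < k \<longrightarrow> \<theta> (v \<circ> adj a) = - \<theta> v)"

definition bihom :: "nat \<Rightarrow> nat \<Rightarrow> ((nat \<Rightarrow> complex^'n::finite) \<Rightarrow> complex) \<Rightarrow> bool" where
  "bihom p q \<theta> \<longleftrightarrow> (\<forall>z v. \<theta> (\<lambda>i. z *s v i) = z ^ p * cnj z ^ q * \<theta> v)"

lemma multilin_cong: "multilin k \<theta> \<Longrightarrow> (\<And>i. i < k \<Longrightarrow> v i = w i) \<Longrightarrow> \<theta> v = \<theta> w"
  by (auto simp: multilin_def)

lemma multilin_linear: "multilin k \<theta> \<Longrightarrow> j < k \<Longrightarrow> linear (\<lambda>w. \<theta> (v(j := w)))"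
  by (auto simp: multilin_def)

text \<open>The form of \<open>multilin_expand\<close> that admits induction: the slots below m
  already carry basis vectors, the others still carry v.\<close>

lemma multilin_expand_slots:
  fixes \<theta> :: "(nat \<Rightarrow> 'v::euclidean_space) \<Rightarrow> complex"
  assumes "multilin k \<theta>" "m \<le> k"
  shows "\<theta> v = (\<Sum>K\<in>{..<m} \<rightarrow>\<^sub>E Basis. (\<Prod>j<m. of_real (v j \<bullet> K j)) *
                  \<theta> (\<lambda>j. if j < m then K j else v j))"
  using assms(2)
proof (induction m)
  case 0
  then show ?case by simp
next
  case (Suc m)
  let ?T = "\<lambda>m K j. if j < m then K j else v j"
  have step: "\<theta> (?T m K) = (\<Sum>b\<in>Basis. of_real (v m \<bullet> b) * \<theta> (?T (Suc m) (K(m := b))))" for K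
  proof -
    have l: "linear (\<lambda>w. \<theta> ((?T m K)(m := w)))"
      using multilin_linear[OF assms(1)] Suc.prems by simp
    have "\<theta> (?T m K) = \<theta> ((?T m K)(m := \<Sum>b\<in>Basis. (v m \<bullet> b) *\<^sub>R b))"
      by (rule arg_cong[of _ _ \<theta>]) (auto simp: euclidean_representation)
    also have "\<dots> = (\<Sum>b\<in>Basis. (v m \<bullet> b) *\<^sub>R \<theta> ((?T m K)(m := b)))"
      by (simp only: linear_sum[OF l] linear_cmul[OF l])
    also have "\<dots> = (\<Sum>b\<in>Basis. of_real (v m \<bullet> b) * \<theta> (?T (Suc m) (K(m := b))))"
    proof (rule sum.cong[OF refl])
      fix b :: 'v
      have "(?T m K)(m := b) = ?T (Suc m) (K(m := b))" by (auto simp: fun_eq_iff)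
      then show "(v m \<bullet> b) *\<^sub>R \<theta> ((?T m K)(m := b)) = of_real (v m \<bullet> b) * \<theta> (?T (Suc m) (K(m := b)))"
        by (simp add: scaleR_conv_of_real)
    qed
    finally show ?thesis .
  qed
  have "(\<Sum>K\<in>{..<Suc m} \<rightarrow>\<^sub>E Basis. (\<Prod>j<Suc m. of_real (v j \<bullet> K j)) * \<theta> (?T (Suc m) K))
    = (\<Sum>(b, K)\<in>Basis \<times> ({..<m} \<rightarrow>\<^sub>E Basis).
         (\<Prod>j<Suc m. of_real (v j \<bullet> (K(m := b)) j)) * \<theta> (?T (Suc m) (K(m := b))))"
    unfolding lessThan_Suc PiE_insert_eq
    by (subst sum.reindex[OF inj_combinator]) (auto simp: case_prod_unfold simp del: fun_upd_apply)
  also have "\<dots> = (\<Sum>(b, K)\<in>Basis \<times> ({..<m} \<rightarrow>\<^sub>E Basis).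
         (\<Prod>j<m. of_real (v j \<bullet> K j)) * (of_real (v m \<bullet> b) * \<theta> (?T (Suc m) (K(m := b)))))"
    by (intro sum.cong refl) (auto simp: mult.assoc simp del: of_real_mult)
  also have "\<dots> = (\<Sum>K\<in>{..<m} \<rightarrow>\<^sub>E Basis. \<Sum>b\<in>Basis.
         (\<Prod>j<m. of_real (v j \<bullet> K j)) * (of_real (v m \<bullet> b) * \<theta> (?T (Suc m) (K(m := b)))))"
    by (subst sum.swap) (simp add: sum.cartesian_product)
  also have "\<dots> = (\<Sum>K\<in>{..<m} \<rightarrow>\<^sub>E Basis. (\<Prod>j<m. of_real (v j \<bullet> K j)) * \<theta> (?T m K))"
    by (simp only: step sum_distrib_left)
  also have "\<dots> = \<theta> v"
    using Suc by simp
  finally show ?case by simp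
qed

lemma multilin_expand:
  fixes \<theta> :: "(nat \<Rightarrow> 'v::euclidean_space) \<Rightarrow> complex"
  assumes "multilin k \<theta>"
  shows "\<theta> v = (\<Sum>K\<in>{..<k} \<rightarrow>\<^sub>E Basis. (\<Prod>j<k. of_real (v j \<bullet> K j)) * \<theta> K)"
proof -
  have "\<theta> (\<lambda>j. if j < k then K j else v j) = \<theta> K" for K
    by (rule multilin_cong[OF assms]) simp
  then show ?thesis using multilin_expand_slots[OF assms order_refl, of v] by simp
qed

text \<open>A transposition of distant entries is the conjugate of a shorter one by an adjacent
  swap, and the three signs multiply to -1.\<close>

lemma alt_form_transpose:
  assumes "alt_form k \<theta>" "a < b" "b < k"
  shows "\<theta> (v \<circ> Transposition.transpose a b) = - \<theta> v"
  using assms(2,3)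
proof (induction b arbitrary: v)
  case (Suc b)
  have adj: "\<theta> (w \<circ> adj b) = - \<theta> w" for w
    using assms(1) Suc.prems by (simp add: alt_form_def)
  show ?case
  proof (cases "a = b")
    case False
    have "v \<circ> Transposition.transpose a (Suc b) = v \<circ> adj b
       \<circ> Transposition.transpose a b \<circ> adj b"
      using False Suc.prems by (auto simp: fun_eq_iff Transposition.transpose_def)
    then have "\<theta> (v \<circ> Transposition.transpose a (Suc b))
      = - \<theta> (v \<circ> adj b \<circ> Transposition.transpose a b)"
      by (simp only: adj)
    also have "\<theta> (v \<circ> adj b \<circ> Transposition.transpose a b)
      = - \<theta> (v \<circ> adj b)"
      using False Suc.prems by (intro Suc.IH) auto
    finally show ?thesis by (simp only: adj minus_minus)
  qed (simp only: adj)
qed simp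

lemma alt_form_permutes:
  assumes "alt_form k \<theta>" "\<sigma> permutes {..<k}"
  shows "\<theta> (v \<circ> \<sigma>) = of_int (sign \<sigma>) * \<theta> v"
proof -
  have "\<forall>v. \<theta> (v \<circ> \<sigma>) = of_int (sign \<sigma>) * \<theta> v"
    using assms(2) finite_lessThan
  proof (induction rule: permutes_induct)
    case id
    then show ?case by (simp add: sign_id)
  next
    case (swap a b \<sigma>)
    have "\<theta> (v \<circ> Transposition.transpose a b) = - \<theta> v" for v
      using alt_form_transpose[OF assms(1), of a b v] alt_form_transpose[OF assms(1), of b a v] swap
      by (cases a b rule: linorder_cases) (auto simp: Transposition.transpose_commute)
    then have "\<theta> (v \<circ> (Transposition.transpose a b \<circ> \<sigma>)) = - of_int (sign \<sigma>) * \<theta> v" for v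
      using swap.IH by (simp only: o_assoc) simp
    moreover have "sign (Transposition.transpose a b \<circ> \<sigma>) = - sign \<sigma>"
      using swap by (simp add: sign_compose permutation_swap_id permutation_permutes[THEN iffD2] sign_swap_id
          exI[of _ "{..<k}"] conjI)
    ultimately show ?case by (auto simp only: of_int_minus)
  qed
  then show ?thesis by blast
qed

text \<open>Signed averaging over all permutations of the arguments fixes an alternating form and
  turns each product of functionals into a wedge; \<open>fact k\<close> counts the
  permutations.\<close>

lemma alt_form_antisymmetrise:
  assumes "alt_form k \<theta>" and "\<And>v. \<theta> v = (\<Sum>K\<in>I. c K * (\<Prod>j<k. f K j (v j)))"
  shows "\<theta> v = (\<Sum>K\<in>I. c K / fact k * wedge k (f K) v)"
proof -
  have "fact k * \<theta> v = (\<Sum>\<sigma> | \<sigma> permutes {..<k}. \<theta> v)"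
    by (simp add: card_permutations)
  also have "\<dots> = (\<Sum>\<sigma> | \<sigma> permutes {..<k}. of_int (sign \<sigma>) * \<theta> (v \<circ> \<sigma>))"
    by (intro sum.cong refl) (auto simp: alt_form_permutes[OF assms(1)] sign_def)
  also have "\<dots> = (\<Sum>\<sigma> | \<sigma> permutes {..<k}. \<Sum>K\<in>I. c K * (of_int (sign \<sigma>) * (\<Prod>j<k. f K j (v (\<sigma> j)))))"
    by (simp add: assms(2) sum_distrib_left mult_ac)
  also have "\<dots> = (\<Sum>K\<in>I. c K * wedge k (f K) v)"
    unfolding wedge_def sum_distrib_left by (rule sum.swap)
  finally have "fact k * \<theta> v = (\<Sum>K\<in>I. c K * wedge k (f K) v)" .
  then have "\<theta> v = (\<Sum>K\<in>I. c K * wedge k (f K) v) / fact k"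
    by (metis fact_nonzero nonzero_mult_div_cancel_left)
  then show ?thesis by (simp add: sum_divide_distrib)
qed

section \<open>Wedge products and their symmetries\<close>

text \<open>Every permutation feeds slot j to exactly one factor, so each summand is a constant
  times one linear functional.\<close>

lemma linear_wedge:
  assumes "\<And>i. i < k \<Longrightarrow> linear (a i)" "j < k"
  shows "linear (\<lambda>w. wedge k a (v(j := w)))"
  unfolding wedge_def
proof (rule linear_compose_sum, safe)
  fix \<sigma> assume s: "\<sigma> permutes {..<k}"
  obtain i where i: "\<sigma> i = j" "i < k"
    using s assms(2) permutes_image[OF s] by (metis imageE lessThan_iff)
  have "(\<Prod>l<k. a l ((v(j := w)) (\<sigma> l))) = a i w * (\<Prod>l\<in>{..<k} - {i}. a l (v (\<sigma> l)))" for w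
  proof -
    have "(\<Prod>l<k. a l ((v(j := w)) (\<sigma> l))) = a i w * (\<Prod>l\<in>{..<k} - {i}. a l ((v(j := w)) (\<sigma> l)))"
      using i by (subst prod.remove[of _ i]) auto
    also have "(\<Prod>l\<in>{..<k} - {i}. a l ((v(j := w)) (\<sigma> l))) = (\<Prod>l\<in>{..<k} - {i}. a l (v (\<sigma> l)))"
      using i permutes_inj[OF s] by (intro prod.cong refl) (auto dest: injD)
    finally show ?thesis .
  qed
  then have eq: "(\<lambda>w. of_int (sign \<sigma>) * (\<Prod>l<k. a l ((v(j := w)) (\<sigma> l))))
    = (\<lambda>w. (of_int (sign \<sigma>) * (\<Prod>l\<in>{..<k} - {i}. a l (v (\<sigma> l)))) * a i w)"
    by (simp add: mult_ac)
  show "linear (\<lambda>w. of_int (sign \<sigma>) * (\<Prod>l<k. a l ((v(j := w)) (\<sigma> l))))"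
    unfolding eq using linear_compose[OF assms(1)[OF i(2)]
      bounded_linear.linear[OF bounded_linear_mult_right]] by (simp add: o_def)
qed

lemma wedge_compose:
  assumes "\<tau> permutes {..<k}"
  shows "wedge k a (v \<circ> \<tau>) = of_int (sign \<tau>) * wedge k a v"
proof -
  have "wedge k a v = (\<Sum>\<sigma> | \<sigma> permutes {..<k}. of_int (sign (\<tau> \<circ> \<sigma>)) * (\<Prod>i<k. a i (v ((\<tau> \<circ> \<sigma>) i))))"
    unfolding wedge_def by (rule setum_permutations_compose_left[OF assms])
  also have "\<dots> = (\<Sum>\<sigma> | \<sigma> permutes {..<k}. of_int (sign \<tau>) * (of_int (sign \<sigma>) * (\<Prod>i<k. a i ((v \<circ> \<tau>) (\<sigma> i)))))"
  proof (intro sum.cong refl, safe)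
    fix \<sigma> assume "\<sigma> permutes {..<k}"
    then have "sign (\<tau> \<circ> \<sigma>) = sign \<tau> * sign \<sigma>"
      using assms by (meson finite_lessThan permutation_permutes sign_compose)
    then show "of_int (sign (\<tau> \<circ> \<sigma>)) * (\<Prod>i<k. a i (v ((\<tau> \<circ> \<sigma>) i)))
      = of_int (sign \<tau>) * (of_int (sign \<sigma>) * (\<Prod>i<k. a i ((v \<circ> \<tau>) (\<sigma> i))))" by simp
  qed
  also have "\<dots> = of_int (sign \<tau>) * wedge k a (v \<circ> \<tau>)"
    by (simp add: wedge_def sum_distrib_left)
  finally have "wedge k a v = of_int (sign \<tau>) * wedge k a (v \<circ> \<tau>)" .
  then show ?thesis by (auto simp: sign_def)
qed

text \<open>The row counterpart of \<open>wedge_compose\<close>. It serves to bring the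
  complex-linear functionals to the front, the order that \<open>pq_covectors\<close>
  prescribes.\<close>

lemma wedge_permute_functionals:
  assumes "\<tau> permutes {..<k}"
  shows "wedge k (a \<circ> \<tau>) v = of_int (sign \<tau>) * wedge k a v"
proof -
  have "wedge k a v = (\<Sum>\<sigma> | \<sigma> permutes {..<k}. of_int (sign (\<sigma> \<circ> inv_into UNIV \<tau>)) * (\<Prod>i<k. a i (v ((\<sigma> \<circ> inv_into UNIV \<tau>) i))))"
    unfolding wedge_def by (rule sum_permutations_compose_right[OF permutes_inv[OF assms]])
  also have "\<dots> = (\<Sum>\<sigma> | \<sigma> permutes {..<k}. of_int (sign \<tau>) * (of_int (sign \<sigma>) * (\<Prod>i<k. (a \<circ> \<tau>) i (v (\<sigma> i)))))"
  proof (intro sum.cong refl, safe)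
    fix \<sigma> assume "\<sigma> permutes {..<k}"
    then have "sign (\<sigma> \<circ> inv_into UNIV \<tau>) = sign \<sigma> * sign (inv_into UNIV \<tau>)"
      using assms permutes_inv by (meson finite_lessThan permutation_permutes sign_compose)
    moreover have "sign (inv_into UNIV \<tau>) = sign \<tau>"
      using assms by (meson finite_lessThan permutation_permutes sign_inverse)
    moreover have "(\<Prod>i<k. a i (v ((\<sigma> \<circ> inv_into UNIV \<tau>) i))) = (\<Prod>i<k. (a \<circ> \<tau>) i (v (\<sigma> i)))"
      by (subst prod.permute[OF assms]) (simp add: o_def permutes_inverses[OF assms])
    ultimately show "of_int (sign (\<sigma> \<circ> inv_into UNIV \<tau>)) * (\<Prod>i<k. a i (v ((\<sigma> \<circ> inv_into UNIV \<tau>) i)))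
      = of_int (sign \<tau>) * (of_int (sign \<sigma>) * (\<Prod>i<k. (a \<circ> \<tau>) i (v (\<sigma> i))))" by simp
  qed
  also have "\<dots> = of_int (sign \<tau>) * wedge k (a \<circ> \<tau>) v"
    by (simp add: wedge_def sum_distrib_left)
  finally have "wedge k a v = of_int (sign \<tau>) * wedge k (a \<circ> \<tau>) v" .
  then show ?thesis by (auto simp: sign_def)
qed

lemma alt_form_wedge:
  assumes "\<And>i. i < k \<Longrightarrow> linear (a i)"
  shows "alt_form k (wedge k a)"
  unfolding alt_form_def multilin_def
proof (intro conjI allI impI)
  fix v w :: "nat \<Rightarrow> complex^'a" assume "\<forall>i<k. v i = w i"
  then show "wedge k a v = wedge k a w"
    unfolding wedge_def by (intro sum.cong refl arg_cong2[where f="(*)"] prod.cong)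
      (auto simp: permutes_in_image[where S="{..<k}", simplified])
next
  fix b v assume "Suc b < k"
  then show "wedge k a (v \<circ> adj b) = - wedge k a v"
    by (subst wedge_compose) (auto simp: sign_swap_id permutes_swap_id)
qed (rule linear_wedge[OF assms])

lemma alt_form_add:
  assumes "alt_form k \<theta>" "alt_form k \<eta>"
  shows "alt_form k (\<lambda>v. \<theta> v + \<eta> v)"
proof -
  have "\<theta> v + \<eta> v = \<theta> w + \<eta> w" if "\<forall>i<k. v i = w i" for v w
    using assms that unfolding alt_form_def multilin_def by metis
  then show ?thesis using assms unfolding alt_form_def multilin_def
    by (auto intro: linear_compose_add)
qed

lemma linear_cmult_left:
  fixes f :: "'v::real_vector \<Rightarrow> complex"
  assumes "linear f" shows "linear (\<lambda>w. c * f w)"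
  using linear_compose[OF assms bounded_linear.linear[OF bounded_linear_mult_right, of c]] by (simp add: o_def)

lemma alt_form_cmult:
  assumes "alt_form k \<theta>" shows "alt_form k (\<lambda>v. c * \<theta> v)"
proof -
  have "c * \<theta> v = c * \<theta> w" if "\<forall>i<k. v i = w i" for v w
    using assms that unfolding alt_form_def multilin_def by metis
  then show ?thesis using assms unfolding alt_form_def multilin_def by (auto intro: linear_cmult_left)
qed

lemma alt_form_0: "alt_form k (\<lambda>v. 0)"
  by (simp add: alt_form_def multilin_def linear_zero)

lemma alt_form_sum: "(\<And>i. i \<in> I \<Longrightarrow> alt_form k (\<theta> i)) \<Longrightarrow> alt_form k (\<lambda>v. \<Sum>i\<in>I. \<theta> i v)"
  by (induction I rule: infinite_finite_induct) (auto simp: alt_form_0 intro: alt_form_add)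

lemma bihom_sum: "(\<And>i. i \<in> I \<Longrightarrow> bihom p q (\<theta> i)) \<Longrightarrow> bihom p q (\<lambda>v. \<Sum>i\<in>I. \<theta> i v)"
  by (simp add: bihom_def sum_distrib_left)

lemma prod_lessThan_type:
  "(\<Prod>i<p + q. if i < p then x else y) = x ^ p * (y :: complex) ^ q"
  by (induction q) (auto simp: mult_ac)

section \<open>Complex-linear and antilinear functionals\<close>

lemma clinear_imp_linear:
  fixes f :: "complex^'n::finite \<Rightarrow> complex"
  assumes "Vector_Spaces.linear (*s) (*) f" shows "linear f"
proof
  interpret f: Vector_Spaces.linear "(*s)" "(*)" f by fact
  show "f (x + y) = f x + f y" for x y by (rule f.add)
  show "f (r *\<^sub>R x) = r *\<^sub>R f x" for r x
  proof -
    have "r *\<^sub>R x = complex_of_real r *s x" by (simp add: vec_eq_iff scaleR_conv_of_real[symmetric])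
    then show ?thesis by (simp add: f.scale scaleR_conv_of_real)
  qed
qed

lemma cantilinear_imp_linear:
  fixes f :: "complex^'n::finite \<Rightarrow> complex"
  assumes "Vector_Spaces.linear (*s) (*) (cnj \<circ> f)" shows "linear f"
proof -
  have "linear (cnj \<circ> (cnj \<circ> f))"
    by (intro linear_compose clinear_imp_linear assms bounded_linear.linear bounded_linear_cnj)
  then show ?thesis by (simp add: o_def)
qed

definition pq_functionals :: "nat \<Rightarrow> nat \<Rightarrow> (nat \<Rightarrow> complex^'n::finite \<Rightarrow> complex) \<Rightarrow> bool" where
  "pq_functionals p q a \<longleftrightarrow> (\<forall>i<p. Vector_Spaces.linear (*s) (*) (a i)) \<and>
     (\<forall>i. p \<le> i \<and> i < p + q \<longrightarrow> Vector_Spaces.linear (*s) (*) (cnj \<circ> a i))"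

lemma alt_form_pq_wedge: "pq_functionals p q a \<Longrightarrow> alt_form (p + q) (wedge (p + q) a)"
  by (rule alt_form_wedge)
    (metis pq_functionals_def clinear_imp_linear cantilinear_imp_linear linorder_not_less)

text \<open>In every summand of the determinant each of the p linear functionals contributes z and
  each of the q antilinear ones contributes its conjugate.\<close>

lemma bihom_pq_wedge:
  assumes "pq_functionals p q a"
  shows "bihom p q (wedge (p + q) a)"
proof -
  have sc: "a i (z *s v) = (if i < p then z else cnj z) * a i v" if "i < p + q" for i z v
  proof (cases "i < p")
    case True
    then interpret f: Vector_Spaces.linear "(*s)" "(*)" "a i"
      using assms by (simp add: pq_functionals_def)
    show ?thesis using True by (simp add: f.scale)
  next
    case False
    then interpret f: Vector_Spaces.linear "(*s)" "(*)" "cnj \<circ> a i"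
      using assms that by (simp add: pq_functionals_def)
    have "cnj (a i (z *s v)) = z * cnj (a i v)" using f.scale[of z v] by simp
    then have "a i (z *s v) = cnj z * a i v" by (metis complex_cnj_cnj complex_cnj_mult)
    then show ?thesis using False by simp
  qed
  have "(\<Prod>i<p + q. a i (z *s v (\<sigma> i))) = z ^ p * cnj z ^ q * (\<Prod>i<p + q. a i (v (\<sigma> i)))"
    for z and v :: "nat \<Rightarrow> complex^'a" and \<sigma>
    unfolding prod_lessThan_type[symmetric] prod.distrib[symmetric] by (intro prod.cong) (auto simp: sc)
  then show ?thesis
    unfolding bihom_def wedge_def sum_distrib_left by (intro allI sum.cong refl) (simp only: mult_ac)
qed

text \<open>The sums that arise run over pairs of a slot set and a basis choice; an enumeration
  brings them to the initial segment demanded by \<open>pq_covectors\<close>.\<close>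

lemma pq_covectors_sumI:
  assumes "finite I" "\<And>i. i \<in> I \<Longrightarrow> pq_functionals p q (a i)"
  shows "(\<lambda>v. \<Sum>i\<in>I. s i * wedge (p + q) (a i) v) \<in> pq_covectors p q"
proof -
  obtain h where h: "bij_betw h {0..<card I} I" using ex_bij_betw_nat_finite[OF assms(1)] by blast
  then have "(\<Sum>i\<in>I. s i * wedge (p + q) (a i) v) = (\<Sum>j<card I. s (h j) * wedge (p + q) (a (h j)) v)" for v
    by (simp add: sum.reindex_bij_betw[of h _ I, symmetric] atLeast0LessThan)
  moreover have "pq_functionals p q (a (h j))" if "j < card I" for j
    using assms(2) bij_betwE[OF h] that by simp
  ultimately show ?thesis
    unfolding pq_covectors_def pq_functionals_def
    by (auto intro!: exI[of _ "card I"] exI[of _ "\<lambda>j. s (h j)"] exI[of _ "\<lambda>j. a (h j)"])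
qed

text \<open>
  Twice the complex-linear part of the real functional \<open>v \<mapsto> v \<bullet> b\<close>, so that
  \<open>v \<bullet> b = (ell b v + cnj (ell b v)) / 2\<close>.
\<close>

definition ell :: "complex^'n::finite \<Rightarrow> complex^'n \<Rightarrow> complex" where
  "ell b v = of_real (v \<bullet> b) - \<i> * of_real ((\<i> *s v) \<bullet> b)"

lemma vector_space_vec_complex: "vector_space ((*s) :: complex \<Rightarrow> complex^'n::finite \<Rightarrow> _)"
  by unfold_locales (simp_all add: vec_eq_iff algebra_simps)

lemma ell_scale: "ell b (z *s v) = z * ell b v"
proof -
  have 1: "z *s v = Re z *\<^sub>R v + Im z *\<^sub>R (\<i> *s v)"
    by (simp add: vec_eq_iff complex_eq_iff)
  have 2: "\<i> *s (z *s v) = Re z *\<^sub>R (\<i> *s v) - Im z *\<^sub>R v"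
    by (simp add: vec_eq_iff complex_eq_iff)
  show ?thesis
    unfolding ell_def 2 unfolding 1 by (simp add: inner_add_left inner_diff_left complex_eq_iff)
qed

lemma linear_ell: "Vector_Spaces.linear (*s) (*) (ell b)"
proof -
  have "vector_space ((*) :: complex \<Rightarrow> complex \<Rightarrow> complex)"
    by unfold_locales (auto simp: algebra_simps)
  moreover have "ell b (x + y) = ell b x + ell b y" for x y
    by (simp add: ell_def inner_add_left algebra_simps vec.scale_right_distrib)
  ultimately show ?thesis
    by (simp add: Vector_Spaces.linear_iff vector_space_vec_complex ell_scale)
qed

lemma inner_eq_ell: "of_real (v \<bullet> b) = ell b v / 2 + cnj (ell b v) / 2"
  by (simp add: ell_def complex_eq_iff)

section \<open>Separation of weights by the unit circle\<close>

text \<open>A finite connected set has at most one point, but the circle is connected and contains 1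
  and -1.\<close>

lemma infinite_unit_circle: "infinite {z::complex. norm z = 1}"
proof
  assume "finite {z::complex. norm z = 1}"
  moreover have "connected {z::complex. norm z = 1}"
    using connected_sphere[of "0::complex" 1] by (simp add: sphere_def dist_norm)
  ultimately have "\<exists>a. {z::complex. norm z = 1} = {a}"
    using connected_finite_iff_sing[of "{z::complex. norm z = 1}"] norm_one[where 'a=complex] by blast
  moreover have "(1::complex) \<in> {z. norm z = 1}" "(-1::complex) \<in> {z. norm z = 1}" by auto
  ultimately show False by (metis one_neq_neg_one singletonD)
qed

text \<open>On the circle, multiplication by \<open>z ^ k\<close> turns the weight
  \<open>z ^ s * cnj z ^ (k - s)\<close> into the s-th power of w = z^2. The identity becomes
  polynomial in w with infinitely many roots, so coefficients can be compared.\<close>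

lemma unit_circle_weight_eq:
  fixes T :: "nat \<Rightarrow> complex"
  assumes "p \<le> k" and "\<And>z. norm z = 1 \<Longrightarrow> z ^ p * cnj z ^ (k - p) * t = (\<Sum>s\<le>k. z ^ s * cnj z ^ (k - s) * T s)"
  shows "t = T p"
proof -
  \<comment> \<open>The coefficients of the difference of the two sides, as a polynomial in
    w.\<close>
  define c where "c s = T s - (if s = p then t else 0)" for s
  have "(\<Sum>s\<le>k. c s * w ^ s) = 0" if w: "norm w = 1" for w
  proof -
    \<comment> \<open>Every w on the circle is the square of some z on the circle, so the hypothesis
      reaches all of them.\<close>
    define z where "z = csqrt w"
    have zw: "z ^ 2 = w" and nz: "norm z = 1"
      using w by (auto simp: z_def norm_csqrt)
    have "z * cnj z = 1" using nz by (simp add: complex_norm_square[symmetric] )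
    then have pow: "z ^ k * (z ^ s * cnj z ^ (k - s)) = w ^ s" if "s \<le> k" for s
    proof -
      have "z ^ k * (z ^ s * cnj z ^ (k - s)) = z ^ s * z ^ s * (z * cnj z) ^ (k - s)"
        using that by (simp add: power_mult_distrib power_add[symmetric] mult_ac)
      then show ?thesis
        using \<open>z * cnj z = 1\<close> zw by (simp add: power_mult_distrib[symmetric] power2_eq_square)
    qed
    have "w ^ p * t = z ^ k * (z ^ p * cnj z ^ (k - p) * t)"
      using pow[OF assms(1)] by (simp add: mult_ac)
    also have "\<dots> = (\<Sum>s\<le>k. z ^ k * (z ^ s * cnj z ^ (k - s)) * T s)"
      unfolding assms(2)[OF nz] by (simp add: sum_distrib_left mult_ac)
    also have "\<dots> = (\<Sum>s\<le>k. w ^ s * T s)" by (simp add: pow)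
    finally have e: "w ^ p * t = (\<Sum>s\<le>k. w ^ s * T s)" .
    have "(\<Sum>s\<le>k. c s * w ^ s) = (\<Sum>s\<le>k. w ^ s * T s) - (\<Sum>s\<le>k. if s = p then w ^ p * t else 0)"
      unfolding sum_subtractf[symmetric] by (intro sum.cong) (auto simp: c_def algebra_simps)
    then show ?thesis using e assms(1) by simp
  qed
  then have "{w::complex. norm w = 1} \<subseteq> {w. (\<Sum>s\<le>k. c s * w ^ s) = 0}" by blast
  then have "infinite {w. (\<Sum>s\<le>k. c s * w ^ s) = 0}"
    using infinite_unit_circle infinite_super by blast
  then have "c p = 0"
    using polyfun_rootbound_finite[of k c] assms(1) by blast
  then show ?thesis by (simp add: c_def)
qed

text \<open>Here S stands for the slots with a complex-linear functional; the permutation lists them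
  first.\<close>

lemma exists_permutation_onto:
  assumes "S \<subseteq> {..<p + q}" "card S = p"
  shows "\<exists>\<tau>. \<tau> permutes {..<p + q} \<and> (\<forall>i<p + q. \<tau> i \<in> S \<longleftrightarrow> i < p)"
proof -
  have fS: "finite S" using assms(1) finite_subset by blast
  obtain g where g: "bij_betw g {..<p} S"
    using finite_same_card_bij[of "{..<p}" S] fS assms by auto
  have "card ({..<p + q} - S) = card {p..<p + q}"
    using assms fS by (simp add: card_Diff_subset)
  then obtain h where h: "bij_betw h {p..<p + q} ({..<p + q} - S)"
    using finite_same_card_bij[of "{p..<p + q}" "{..<p + q} - S"] by auto
  define \<tau> where "\<tau> i = (if i < p then g i else if i < p + q then h i else i)" for i
  have "bij_betw \<tau> {..<p} S" using g by (rule bij_betw_cong[THEN iffD1, rotated]) (simp add: \<tau>_def)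
  moreover have "bij_betw \<tau> {p..<p + q} ({..<p + q} - S)"
    using h by (rule bij_betw_cong[THEN iffD1, rotated]) (simp add: \<tau>_def)
  ultimately have "bij_betw \<tau> ({..<p} \<union> {p..<p + q}) (S \<union> ({..<p + q} - S))"
    by (rule bij_betw_combine) auto
  moreover have "{..<p} \<union> {p..<p + q} = {..<p + q}" "S \<union> ({..<p + q} - S) = {..<p + q}" using assms by auto
  ultimately have "\<tau> permutes {..<p + q}"
    by (intro bij_imp_permutes) (auto simp: \<tau>_def)
  moreover have "\<tau> i \<in> S \<longleftrightarrow> i < p" if "i < p + q" for i
    using bij_betwE[OF g] bij_betwE[OF h] that by (auto simp: \<tau>_def)
  ultimately show ?thesis by blast
qed

text \<open>
  The basis expansion of \<open>\<theta>\<close> splits into parts of weight \<open>z\<^sup>s (cnj z)\<^sup>k\<^sup>-\<^sup>s\<close>, which the unit circle separates;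
  antisymmetrising the part with \<open>s = p\<close> turns the products of functionals into wedges.
\<close>

lemma pq_covectors_if_alt_bihom:
  fixes \<theta> :: "(nat \<Rightarrow> complex^'n::finite) \<Rightarrow> complex"
  assumes alt: "alt_form (p + q) \<theta>" and hom: "bihom p q \<theta>"
  shows "\<theta> \<in> pq_covectors p q"
proof -
  define k where "k = p + q"
  define Q :: "(nat \<Rightarrow> complex^'n) set" where "Q = {..<k} \<rightarrow>\<^sub>E Basis"
  \<comment> \<open>S collects the slots where the complex-linear half of the coordinate functional
    is chosen; the other slots receive the antilinear half.\<close>
  define f :: "nat set \<times> (nat \<Rightarrow> complex^'n) \<Rightarrow> nat \<Rightarrow> complex^'n \<Rightarrow> complex"
    where "f = (\<lambda>(S, K) j. if j \<in> S then ell (K j) else cnj \<circ> ell (K j))"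
  \<comment> \<open>Each of the k slots contributes a factor 1/2 from
    \<open>inner_eq_ell\<close>.\<close>
  define c where "c = (\<lambda>(S::nat set, K). \<theta> K / 2 ^ k)"
  let ?P = "{S. S \<in> Pow {..<k} \<and> card S = p}"
  have finQ: "finite Q" unfolding Q_def by (intro finite_PiE) auto
  have ml: "multilin k \<theta>" using alt by (simp add: alt_form_def k_def)
  have ex: "\<theta> v = (\<Sum>S\<in>Pow {..<k}. \<Sum>K\<in>Q. c (S, K) * (\<Prod>j<k. f (S, K) j (v j)))" for v
  proof -
    have "\<theta> v = (\<Sum>K\<in>Q. (\<Prod>j<k. ell (K j) (v j) / 2 + cnj (ell (K j) (v j)) / 2) * \<theta> K)"
      unfolding inner_eq_ell[symmetric] Q_def by (rule multilin_expand[OF ml])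
    also have "\<dots> = (\<Sum>K\<in>Q. \<Sum>S\<in>Pow {..<k}. c (S, K) * (\<Prod>j<k. f (S, K) j (v j)))"
    proof (rule sum.cong[OF refl])
      fix K
      have "(\<Prod>j\<in>S. ell (K j) (v j) / 2) * (\<Prod>j\<in>{..<k} - S. cnj (ell (K j) (v j)) / 2)
         = (\<Prod>j<k. f (S, K) j (v j)) / 2 ^ k" if "S \<in> Pow {..<k}" for S
      proof -
        have "(\<Prod>j\<in>S. ell (K j) (v j) / 2) * (\<Prod>j\<in>{..<k} - S. cnj (ell (K j) (v j)) / 2)
          = (\<Prod>j\<in>S. f (S, K) j (v j) / 2) * (\<Prod>j\<in>{..<k} - S. f (S, K) j (v j) / 2)"
          by (simp add: f_def)
        also have "\<dots> = (\<Prod>j<k. f (S, K) j (v j) / 2)"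
          using that by (subst prod.subset_diff[of S "{..<k}"]) (auto simp: mult.commute)
        finally show ?thesis by (simp add: prod_dividef)
      qed
      then show "(\<Prod>j<k. ell (K j) (v j) / 2 + cnj (ell (K j) (v j)) / 2) * \<theta> K
        = (\<Sum>S\<in>Pow {..<k}. c (S, K) * (\<Prod>j<k. f (S, K) j (v j)))"
        by (simp add: prod_add c_def sum_distrib_right sum_distrib_left mult_ac)
    qed
    also have "\<dots> = (\<Sum>S\<in>Pow {..<k}. \<Sum>K\<in>Q. c (S, K) * (\<Prod>j<k. f (S, K) j (v j)))"
      by (rule sum.swap)
    finally show ?thesis .
  qed
  \<comment> \<open>The terms with exactly s complex-linear slots, which all have the same
    weight.\<close>
  define T where "T s v = (\<Sum>S | S \<in> Pow {..<k} \<and> card S = s. \<Sum>K\<in>Q. c (S, K) * (\<Prod>j<k. f (S, K) j (v j)))" for s v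
  have \<theta>T: "\<theta> v = (\<Sum>s\<le>k. T s v)" for v
    unfolding ex T_def
    by (rule sum.group[symmetric]) (auto intro: card_mono[of "{..<k}", simplified])
  have Tz: "T s (\<lambda>i. z *s v i) = z ^ s * cnj z ^ (k - s) * T s v" for s z v
  proof -
    have "(\<Prod>j<k. f (S, K) j (z *s v j)) = z ^ s * cnj z ^ (k - s) * (\<Prod>j<k. f (S, K) j (v j))"
      if "S \<subseteq> {..<k}" "card S = s" for S K
    proof -
      have fS: "finite S" using that(1) finite_subset by blast
      have "(\<Prod>j<k. f (S, K) j (z *s v j)) = (\<Prod>j<k. (if j \<in> S then z else cnj z) * f (S, K) j (v j))"
        by (intro prod.cong) (auto simp: f_def ell_scale)
      also have "\<dots> = (\<Prod>j<k. if j \<in> S then z else cnj z) * (\<Prod>j<k. f (S, K) j (v j))"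
        by (rule prod.distrib)
      also have "(\<Prod>j<k. if j \<in> S then z else cnj z) = z ^ s * cnj z ^ (k - s)"
      proof -
        have "{..<k} \<inter> {j. j \<in> S} = S" "{..<k} \<inter> - {j. j \<in> S} = {..<k} - S" using that by auto
        then show ?thesis using that fS by (simp add: prod.If_cases card_Diff_subset)
      qed
      finally show ?thesis .
    qed
    then show ?thesis
      unfolding T_def sum_distrib_left by (intro sum.cong refl) (auto simp: mult_ac)
  qed
  have "\<theta> v = T p v" for v
  proof (rule unit_circle_weight_eq[of p k])
    fix z :: complex
    show "z ^ p * cnj z ^ (k - p) * \<theta> v = (\<Sum>s\<le>k. z ^ s * cnj z ^ (k - s) * T s v)"
      using hom \<theta>T[of "\<lambda>i. z *s v i"] unfolding Tz bihom_def k_def by simp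
  qed (simp add: k_def)
  then have "\<theta> v = (\<Sum>SK\<in>?P \<times> Q. c SK * (\<Prod>j<k. f SK j (v j)))" for v
    unfolding T_def by (simp add: sum.cartesian_product case_prod_unfold)
  from alt_form_antisymmetrise[OF alt[folded k_def] this]
  have w: "\<theta> v = (\<Sum>SK\<in>?P \<times> Q. c SK / fact k * wedge k (f SK) v)" for v .
  have "\<forall>S\<in>?P. \<exists>\<tau>. \<tau> permutes {..<k} \<and> (\<forall>i<k. \<tau> i \<in> S \<longleftrightarrow> i < p)"
    using exists_permutation_onto[of _ p q] unfolding k_def by blast
  from bchoice[OF this] obtain \<tau> where \<tau>0: "\<forall>S\<in>?P.
      \<tau> S permutes {..<k} \<and> (\<forall>i<k. \<tau> S i \<in> S \<longleftrightarrow> i < p)" by blast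
  have \<tau>: "\<And>S. S \<subseteq> {..<k} \<Longrightarrow> card S = p \<Longrightarrow> \<tau> S permutes {..<k}"
      "\<And>S i. S \<subseteq> {..<k} \<Longrightarrow> card S = p \<Longrightarrow> i < k \<Longrightarrow> \<tau> S i \<in> S \<longleftrightarrow> i < p"
    using \<tau>0 by auto
  let ?I = "?P \<times> Q"
  \<comment> \<open>Reordering the functionals changes the wedge by a sign; the coefficient carries
    the same sign, and its square is 1.\<close>
  let ?\<eta> = "\<lambda>v. \<Sum>SK\<in>?I. (c SK / fact k * of_int (sign (\<tau> (fst SK)))) * wedge (p + q) (f SK \<circ> \<tau> (fst SK)) v"
  have "\<theta> v = ?\<eta> v" for v
    unfolding w[of v] k_def[symmetric]
    by (intro sum.cong refl) (auto simp: wedge_permute_functionals[OF \<tau>(1)] sign_def)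
  then have \<theta>: "?\<eta> = \<theta>" by (intro ext) (simp only:)
  have "pq_functionals p q (f (S, K) \<circ> \<tau> S)" if "S \<subseteq> {..<k}" "card S = p" for S K
    using \<tau>(2)[OF that] linear_ell unfolding pq_functionals_def k_def f_def
    by (auto simp: o_def)
  then have "?\<eta> \<in> pq_covectors p q"
    using finQ by (intro pq_covectors_sumI) auto
  then show ?thesis by (simp only: \<theta>)
qed

lemma pq_covectors_iff:
  "\<theta> \<in> pq_covectors p q \<longleftrightarrow> alt_form (p + q) \<theta> \<and> bihom p q \<theta>"
proof
  assume "\<theta> \<in> pq_covectors p q"
  then obtain m and s :: "nat \<Rightarrow> complex" and a where
    a: "\<forall>j<m. pq_functionals p q (a j)" "\<theta> = (\<lambda>v. \<Sum>j<m. s j * wedge (p + q) (a j) v)"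
    unfolding pq_covectors_def pq_functionals_def by blast
  have "bihom p q (\<lambda>v. s j * wedge (p + q) (a j) v)" if "j < m" for j
    using bihom_pq_wedge[OF a(1)[rule_format, OF that]] by (simp add: bihom_def mult_ac)
  then show "alt_form (p + q) \<theta> \<and> bihom p q \<theta>"
    unfolding a(2) by (auto intro!: alt_form_sum alt_form_cmult alt_form_pq_wedge a(1)[rule_format] bihom_sum)
qed (simp add: pq_covectors_if_alt_bihom)

section \<open>The operators in a chart\<close>

text \<open>The sign \<open>s = 1\<close> gives \<open>\<partial>\<close> and \<open>s = -1\<close> gives \<open>\<bar>\<partial>\<close>.\<close>

definition dpart :: "complex \<Rightarrow> (complex^'n::finite \<Rightarrow> complex) \<Rightarrow> complex^'n \<Rightarrow> complex^'n \<Rightarrow> complex" where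
  "dpart s f x v = (fd f x v - s * \<i> * fd f x (\<i> *s v)) / 2"

definition loc_del :: "complex \<Rightarrow> nat \<Rightarrow> (complex^'n::finite \<Rightarrow> (nat \<Rightarrow> complex^'n) \<Rightarrow> complex)
    \<Rightarrow> complex^'n \<Rightarrow> (nat \<Rightarrow> complex^'n) \<Rightarrow> complex" where
  "loc_del s k \<phi> x v = (\<Sum>i\<le>k. (- 1) ^ i * dpart s (\<lambda>y. \<phi> y (skip i v)) x (v i))"

lemma d10_eq_dpart: "d10 = dpart 1"
  by (intro ext) (simp add: d10_def dpart_def)

lemma d01_eq_dpart: "d01 = dpart (- 1)"
  by (intro ext) (simp add: d01_def dpart_def)

lemma linear_complex_scale: "linear (\<lambda>v::complex^'n::finite. z *s v)"
  by (rule linearI) (simp_all add: vec_eq_iff algebra_simps)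

lemma dpart_cong_open:
  assumes "open U" "x \<in> U" "\<And>y. y \<in> U \<Longrightarrow> f y = g y"
  shows "dpart s f x = dpart s g x"
  using frechet_derivative_cong_open[OF assms] by (simp add: dpart_def fun_eq_iff)

lemma linear_dpart:
  assumes "f differentiable (at x)"
  shows "linear (dpart s f x)"
proof -
  note l = linear_frechet[OF assms]
  have "linear (\<lambda>v. fd f x (\<i> *s v))"
    using linear_compose[OF linear_complex_scale l] by (simp add: o_def)
  then have "linear (\<lambda>v. (1/2) * fd f x v - (s * \<i> / 2) * fd f x (\<i> *s v))"
    by (intro linear_compose_sub linear_cmult_left l)
  then show ?thesis by (simp add: dpart_def[abs_def] diff_divide_distrib)
qed

text \<open>The factor is z for s = 1 and its conjugate for s = -1, which is why one operator raises
  p and the other raises q.\<close>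

lemma dpart_scale:
  assumes "f differentiable (at x)" "s * s = 1"
  shows "dpart s f x (z *s v) = (of_real (Re z) + s * \<i> * of_real (Im z)) * dpart s f x v"
proof -
  note l = linear_frechet[OF assms(1)]
  have 1: "z *s v = Re z *\<^sub>R v + Im z *\<^sub>R (\<i> *s v)"
    by (simp add: vec_eq_iff complex_eq_iff)
  have 2: "\<i> *s (z *s v) = Re z *\<^sub>R (\<i> *s v) - Im z *\<^sub>R v"
    by (simp add: vec_eq_iff complex_eq_iff)
  have 3: "s * (s * w) = w" for w using assms(2) by (metis mult.assoc mult_1)
  have a: "fd f x (z *s v) = of_real (Re z) * fd f x v
      + of_real (Im z) * fd f x (\<i> *s v)"
    by (simp only: 1 linear_add[OF l] linear_cmul[OF l] scaleR_conv_of_real[where 'a=complex])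
  have b: "fd f x (\<i> *s (z *s v)) = of_real (Re z) * fd f x (\<i> *s v)
      - of_real (Im z) * fd f x v"
    by (simp only: 2 linear_diff[OF l] linear_cmul[OF l] scaleR_conv_of_real[where 'a=complex])
  show ?thesis
    unfolding dpart_def a b by (simp add: algebra_simps 3 add_divide_distrib diff_divide_distrib)
qed

lemma has_derivative_dpart:
  assumes "(f has_derivative f') (at x)"
  shows "dpart s f x v = (f' v - s * \<i> * f' (\<i> *s v)) / 2"
  using frechet_derivative_eqI[OF assms] by (simp add: dpart_def)

lemma dpart_add:
  assumes "f differentiable (at x)" "g differentiable (at x)"
  shows "dpart s (\<lambda>y. f y + g y) x v = dpart s f x v + dpart s g x v"
  by (subst has_derivative_dpart[OF has_derivative_add[OF assms[THEN frechet_derivative_has]]])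
    (simp add: dpart_def field_simps)

lemma dpart_cmult:
  assumes "f differentiable (at x)"
  shows "dpart s (\<lambda>y. c * f y) x v = c * dpart s f x v"
  by (subst has_derivative_dpart[OF has_derivative_mult_right[OF assms[THEN frechet_derivative_has]]])
    (simp add: dpart_def field_simps)

lemma dpart_const: "dpart s (\<lambda>y. c) x v = 0"
  by (subst has_derivative_dpart[OF has_derivative_const]) simp

lemma dpart_sum:
  assumes "\<And>i. i \<in> I \<Longrightarrow> f i differentiable (at x)"
  shows "dpart s (\<lambda>y. \<Sum>i\<in>I. f i y) x v = (\<Sum>i\<in>I. dpart s (f i) x v)"
  using assms
  by (induction I rule: infinite_finite_induct) (simp_all add: dpart_const dpart_add)

lemma smooth_on_cmult:
  fixes f :: "'v::real_normed_vector \<Rightarrow> complex"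
  shows "open U \<Longrightarrow> smooth_on U f \<Longrightarrow> smooth_on U (\<lambda>x. c * f x)"
  by (rule smooth_on_bounded_linear[OF _ bounded_linear_mult_right])

lemma smooth_on_dpart:
  assumes "open U" "smooth_on U f"
  shows "smooth_on U (\<lambda>x. dpart s f x v)"
proof -
  have "smooth_on U (\<lambda>x. (1/2) * fd f x v
      + (- s * \<i> / 2) * fd f x (\<i> *s v))"
    by (intro smooth_on_add smooth_on_cmult smooth_on_frechet assms)
  then show ?thesis by (simp add: dpart_def diff_divide_distrib)
qed

text \<open>Both sides are the same combination of second derivatives, because these are symmetric.
  The signs s and t are independent, so pure and mixed cases are treated together.\<close>

lemma dpart_commute:
  assumes "open U" "x \<in> U" "smooth_on U f"
  shows "dpart s (\<lambda>y. dpart t f y u) x w = dpart t (\<lambda>y. dpart s f y w) x u"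
proof -
  let ?B = "\<lambda>u w. fd (\<lambda>y. fd f y u) x w"
  have "((\<lambda>y. fd f y u) has_derivative ?B u) (at x)" for u
    by (intro frechet_derivative_has smooth_on_differentiable[OF _ assms(2)] smooth_on_frechet assms)
  then have "((\<lambda>y. (1/2) * fd f y u - (r * \<i> / 2) * fd f y (\<i> *s u))
      has_derivative (\<lambda>w. (1/2) * ?B u w - (r * \<i> / 2) * ?B (\<i> *s u) w)) (at x)" for r u
    by (intro has_derivative_diff has_derivative_mult_right)
  then have d: "((\<lambda>y. dpart r f y u) has_derivative (\<lambda>w. (1/2) * ?B u w - (r * \<i> / 2) * ?B (\<i> *s u) w)) (at x)" for r u
    by (simp add: dpart_def diff_divide_distrib)
  have "?B u w = ?B w u" for u w by (rule smooth_on_clairaut[OF assms])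
  then show ?thesis
    unfolding has_derivative_dpart[OF d] by (simp add: algebra_simps)
qed

lemma complex_eq_neg_self: "(z::complex) = - z \<Longrightarrow> z = 0"
  by (simp add: complex_eq_iff)

section \<open>Anticommutation\<close>

text \<open>A pair (i, j) encodes removing entry i of a sequence and then entry j of the rest. The
  involution in the proof is the removal of the same two entries in the opposite order.\<close>

lemma sum_skew_involution:
  fixes F H :: "nat \<Rightarrow> nat \<Rightarrow> complex"
  assumes "\<And>i j. j < i \<Longrightarrow> i \<le> k \<Longrightarrow> F i j = - H j (i - 1)"
    and "\<And>i j. i \<le> j \<Longrightarrow> j < k \<Longrightarrow> F i j = - H (Suc j) i"
  shows "(\<Sum>i\<le>k. \<Sum>j<k. F i j) = - (\<Sum>i\<le>k. \<Sum>j<k. H i j)"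
proof -
  define \<rho> :: "nat \<times> nat \<Rightarrow> nat \<times> nat" where "\<rho> = (\<lambda>(i, j). if j < i then (j, i - 1) else (Suc j, i))"
  have "(\<Sum>ij\<in>{..k} \<times> {..<k}. F (fst ij) (snd ij)) = (\<Sum>ij\<in>{..k} \<times> {..<k}. - H (fst ij) (snd ij))"
    by (rule sum.reindex_bij_witness[of _ \<rho> \<rho>])
      (auto simp: \<rho>_def assms split: if_splits)
  then show ?thesis
    by (simp add: sum.cartesian_product case_prod_unfold sum_negf)
qed

lemma skip_skip: "j < i \<Longrightarrow> skip j (skip i v) = skip (i - 1) (skip j v)"
  by (auto simp: skip_def fun_eq_iff less_Suc_eq)

text \<open>The double sum runs over ordered pairs of removed entries. Reversing the order exchanges
  the two derivatives, which commute, and changes the exponent of -1 by one.\<close>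

lemma loc_del_anticommute:
  assumes U: "open U" "x \<in> U" and sm: "\<And>v. smooth_on U (\<lambda>y. \<phi> y v)"
  shows "loc_del s (Suc k) (loc_del t k \<phi>) x v = - loc_del t (Suc k) (loc_del s k \<phi>) x v"
proof -
  let ?M = "\<lambda>s t i j. dpart s (\<lambda>y. dpart t (\<lambda>z. \<phi> z (skip j (skip i v))) y (skip i v j)) x (v i)"
  have ex: "loc_del s (Suc k) (loc_del t k \<phi>) x v = (\<Sum>i\<le>Suc k. \<Sum>j<Suc k. (- 1) ^ (i + j) * ?M s t i j)" for s t
  proof -
    have d: "(\<lambda>y. dpart t (\<lambda>z. \<phi> z w) y a) differentiable (at x)" for w a
      by (intro smooth_on_differentiable[OF _ U(2)] smooth_on_dpart U sm)
    have "dpart s (\<lambda>y. \<Sum>j\<le>k. (- 1) ^ j * dpart t (\<lambda>z. \<phi> z (skip j (skip i v))) y (skip i v j)) x (v i)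
      = (\<Sum>j\<le>k. (- 1) ^ j * ?M s t i j)" for i
      by (subst dpart_sum) (simp_all add: d dpart_cmult)
    then show ?thesis
      unfolding loc_del_def lessThan_Suc_atMost by (simp only: sum_distrib_left power_add mult.assoc)
  qed
  have sym: "dpart s (\<lambda>y. dpart t (\<lambda>z. \<phi> z w) y a) x b = dpart t (\<lambda>y. dpart s (\<lambda>z. \<phi> z w) y b) x a" for s t w a b
    by (rule dpart_commute[OF U sm])
  show ?thesis
    unfolding ex
  proof (rule sum_skew_involution)
    fix i j :: nat assume *: "j < i"
    have 1: "skip i v j = v j" "v i = skip j v (i - 1)" using * by (auto simp: skip_def)
    have "(- 1 :: complex) ^ (i + j) = - ((- 1) ^ (j + (i - 1)))"
      using * by (cases i) (auto simp: add.commute)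
    then show "(- 1) ^ (i + j) * ?M s t i j = - ((- 1) ^ (j + (i - 1)) * ?M t s j (i - 1))"
      unfolding skip_skip[OF *] 1 sym[of s t] by simp
  next
    fix i j :: nat assume *: "i \<le> j"
    have 1: "skip (Suc j) v i = v i" "v (Suc j) = skip i v j" using * by (auto simp: skip_def)
    have 2: "skip j (skip i v) = skip i (skip (Suc j) v)"
      using skip_skip[of i "Suc j" v] * by simp
    show "(- 1) ^ (i + j) * ?M s t i j = - ((- 1) ^ (Suc j + i) * ?M t s (Suc j) i)"
      unfolding 2 1 sym[of s t] by (simp add: add.commute)
  qed
qed

section \<open>Alternation, type and smoothness of the derivative\<close>

lemma skip_upd_same: "skip i (v(i := w)) = skip i v"
  by (auto simp: skip_def fun_eq_iff less_Suc_eq)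

lemma skip_upd_less: "j < i \<Longrightarrow> skip i (v(j := w)) = (skip i v)(j := w)"
  by (auto simp: skip_def fun_eq_iff less_Suc_eq)

lemma skip_upd_greater: "i < j \<Longrightarrow> skip i (v(j := w)) = (skip i v)(j - 1 := w)"
  by (auto simp: skip_def fun_eq_iff less_Suc_eq)

text \<open>Serves the slots other than the direction of differentiation: linearity at all nearby
  points y passes to the derivative in y.\<close>

lemma linear_dpart_parameter:
  assumes U: "open U" "x \<in> U" and "\<And>y. y \<in> U \<Longrightarrow> linear (f y)"
    and "\<And>w. (\<lambda>y. f y w) differentiable (at x)"
  shows "linear (\<lambda>w. dpart s (\<lambda>y. f y w) x a)"
proof (rule linearI)
  fix w w'
  have "dpart s (\<lambda>y. f y (w + w')) x = dpart s (\<lambda>y. f y w + f y w') x"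
    by (rule dpart_cong_open[OF U]) (simp add: assms(3) linear_add)
  then show "dpart s (\<lambda>y. f y (w + w')) x a = dpart s (\<lambda>y. f y w) x a + dpart s (\<lambda>y. f y w') x a"
    by (simp add: dpart_add assms(4))
next
  fix r w
  have "dpart s (\<lambda>y. f y (r *\<^sub>R w)) x = dpart s (\<lambda>y. of_real r * f y w) x"
    by (rule dpart_cong_open[OF U]) (simp add: assms(3) linear_cmul scaleR_conv_of_real)
  then show "dpart s (\<lambda>y. f y (r *\<^sub>R w)) x a = r *\<^sub>R dpart s (\<lambda>y. f y w) x a"
    by (simp add: dpart_cmult assms(4) scaleR_conv_of_real)
qed

text \<open>Under a swap of the entries a and a + 1, the terms i = a and i = a + 1 change places
  with opposite signs, and every other term changes sign because \<phi> alternates.\<close>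

lemma alt_form_loc_del:
  assumes U: "open U" "x \<in> U" and sm: "\<And>v. smooth_on U (\<lambda>y. \<phi> y v)"
    and alt: "\<And>y. y \<in> U \<Longrightarrow> alt_form k (\<phi> y)"
  shows "alt_form (Suc k) (loc_del s k \<phi> x)"
  unfolding alt_form_def multilin_def
proof (intro conjI allI impI)
  have ml: "multilin k (\<phi> y)" if "y \<in> U" for y using alt[OF that] by (simp add: alt_form_def)
  have df: "(\<lambda>y. \<phi> y v) differentiable (at x)" for v by (rule smooth_on_differentiable[OF sm U(2)])
  {
    fix v w :: "nat \<Rightarrow> complex^'a" assume vw: "\<forall>i<Suc k. v i = w i"
    have "dpart s (\<lambda>y. \<phi> y (skip i v)) x = dpart s (\<lambda>y. \<phi> y (skip i w)) x" if "i \<le> k" for i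
      by (rule dpart_cong_open[OF U], rule multilin_cong[OF ml]) (use vw in \<open>auto simp: skip_def\<close>)
    then show "loc_del s k \<phi> x v = loc_del s k \<phi> x w"
      using vw by (simp add: loc_del_def)
  next
    fix j and v :: "nat \<Rightarrow> complex^'a" assume j: "j < Suc k"
    have "linear (\<lambda>w. dpart s (\<lambda>y. \<phi> y (skip i (v(j := w)))) x ((v(j := w)) i))" if "i \<le> k" for i
    proof (cases "i = j")
      case True
      have "linear (\<lambda>w. dpart s (\<lambda>y. \<phi> y (skip i v)) x w)" by (rule linear_dpart[OF df])
      then show ?thesis by (simp add: True skip_upd_same)
    next
      case False
      define j' where "j' = (if j < i then j else j - 1)"
      have eq: "skip i (v(j := w)) = (skip i v)(j' := w)" for w
        using False by (simp add: j'_def skip_upd_less skip_upd_greater)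
      have "j' < k" using False j that by (auto simp: j'_def)
      then have "linear (\<lambda>w. dpart s (\<lambda>y. \<phi> y ((skip i v)(j' := w))) x (v i))"
        by (intro linear_dpart_parameter[OF U] multilin_linear[OF ml] df)
      then show ?thesis using False by (simp add: eq)
    qed
    then show "linear (\<lambda>w. loc_del s k \<phi> x (v(j := w)))"
      unfolding loc_del_def by (intro linear_compose_sum ballI linear_cmult_left) auto
  next
    fix a and v :: "nat \<Rightarrow> complex^'a" assume a: "Suc a < Suc k"
    let ?t = "adj a"
    let ?g = "\<lambda>i. (- 1) ^ i * dpart s (\<lambda>y. \<phi> y (skip i v)) x (v i)"
    have "(- 1) ^ i * dpart s (\<lambda>y. \<phi> y (skip i (v \<circ> ?t))) x ((v \<circ> ?t) i) = - ?g (?t i)" if "i \<le> k" for i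
    proof -
      consider "i = a" | "i = Suc a" | "i < a" | "i > Suc a" by linarith
      then show ?thesis
      proof cases
        case 1
        then have "skip i (v \<circ> ?t) = skip (Suc a) v"
          by (auto simp: skip_def fun_eq_iff Transposition.transpose_def less_Suc_eq)
        with 1 show ?thesis by simp
      next
        case 2
        then have "skip i (v \<circ> ?t) = skip a v"
          by (auto simp: skip_def fun_eq_iff Transposition.transpose_def less_Suc_eq)
        with 2 show ?thesis by simp
      next
        case 3
        \<comment> \<open>Entry i lies before the swapped pair, so skipping it moves the pair down
          by one position.\<close>
        then have eq: "skip i (v \<circ> ?t) = skip i v \<circ> adj (a - 1)"
          by (auto simp: skip_def fun_eq_iff Transposition.transpose_def less_Suc_eq)
        have adj: "\<phi> y (w \<circ> adj (a - 1)) = - \<phi> y w" if "y \<in> U" for y w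
          using conjunct2[OF alt[OF that, unfolded alt_form_def], rule_format, of "a - 1" w] a 3 by simp
        have "dpart s (\<lambda>y. \<phi> y (skip i (v \<circ> ?t))) x = dpart s (\<lambda>y. - 1 * \<phi> y (skip i v)) x"
          by (rule dpart_cong_open[OF U]) (simp only: adj eq mult_minus1)
        then show ?thesis using 3 by (simp add: dpart_cmult[OF df, of s "- 1", simplified])
      next
        case 4
        then have eq: "skip i (v \<circ> ?t) = skip i v \<circ> ?t"
          by (auto simp: skip_def fun_eq_iff Transposition.transpose_def less_Suc_eq)
        have adj: "\<phi> y (w \<circ> ?t) = - \<phi> y w" if "y \<in> U" for y w
          using alt[OF that] a 4 \<open>i \<le> k\<close> by (simp add: alt_form_def)
        have "dpart s (\<lambda>y. \<phi> y (skip i (v \<circ> ?t))) x = dpart s (\<lambda>y. - 1 * \<phi> y (skip i v)) x"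
          by (rule dpart_cong_open[OF U]) (simp only: adj eq mult_minus1)
        then show ?thesis using 4 by (simp add: dpart_cmult[OF df, of s "- 1", simplified])
      qed
    qed
    then have "loc_del s k \<phi> x (v \<circ> ?t) = (\<Sum>i\<le>k. - ?g (?t i))"
      unfolding loc_del_def by (intro sum.cong) auto
    also have "\<dots> = - (\<Sum>i\<le>k. ?g (?t i))" by (rule sum_negf)
    also have "(\<Sum>i\<le>k. ?g (?t i)) = (\<Sum>i\<le>k. ?g i)"
      using sum.permute[of ?t "{..k}" ?g] a by (simp add: permutes_swap_id o_def)
    finally show "loc_del s k \<phi> x (v \<circ> ?t) = - loc_del s k \<phi> x v" by (simp only: loc_del_def)
  }
qed

text \<open>The arguments left to \<phi> contribute its weight, and the direction of differentiation
  contributes the factor of \<open>dpart_scale\<close>.\<close>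

lemma loc_del_scale:
  assumes U: "open U" "x \<in> U" and sm: "\<And>v. smooth_on U (\<lambda>y. \<phi> y v)" and s: "s * s = 1"
    and hom: "\<And>y. y \<in> U \<Longrightarrow> bihom p q (\<phi> y)"
  shows "loc_del s k \<phi> x (\<lambda>i. z *s v i) =
     (of_real (Re z) + s * \<i> * of_real (Im z)) * (z ^ p * cnj z ^ q) * loc_del s k \<phi> x v"
proof -
  have df: "(\<lambda>y. \<phi> y v) differentiable (at x)" for v by (rule smooth_on_differentiable[OF sm U(2)])
  have "dpart s (\<lambda>y. \<phi> y (skip i (\<lambda>i. z *s v i))) x = dpart s (\<lambda>y. z ^ p * cnj z ^ q * \<phi> y (skip i v)) x" for i
  proof (rule dpart_cong_open[OF U])
    have "skip i (\<lambda>i. z *s v i) = (\<lambda>j. z *s skip i v j)" by (auto simp: skip_def)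
    then show "\<phi> y (skip i (\<lambda>i. z *s v i)) = z ^ p * cnj z ^ q * \<phi> y (skip i v)" if "y \<in> U" for y
      using hom[OF that] by (simp add: bihom_def)
  qed
  then show ?thesis
    unfolding loc_del_def sum_distrib_left
    by (intro sum.cong refl) (simp only: dpart_cmult[OF df] dpart_scale[OF df s], simp only: mult_ac)
qed

lemma smooth_on_loc_del:
  assumes "open U" and "\<And>v. smooth_on U (\<lambda>y. \<phi> y v)"
  shows "smooth_on U (\<lambda>x. loc_del s k \<phi> x v)"
  unfolding loc_del_def by (intro smooth_on_sum smooth_on_cmult smooth_on_dpart assms)

section \<open>Pullback under a holomorphic change of coordinates\<close>

text \<open>Differentiability of \<phi> is known for each fixed argument only. Expansion over tuples
  of basis vectors makes the composite a finite sum of products of scalar functions; the product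
  rule applies, and the expansion is then collapsed again.\<close>

lemma has_derivative_multilin:
  fixes \<phi> :: "'w::real_normed_vector \<Rightarrow> (nat \<Rightarrow> 'v::euclidean_space) \<Rightarrow> complex" and \<tau> :: "'u::real_normed_vector \<Rightarrow> 'w"
  assumes U: "open U" "\<tau> x \<in> U" and ml: "\<And>z. z \<in> U \<Longrightarrow> multilin k (\<phi> z)"
    and V: "open V" "x \<in> V" "\<And>y. y \<in> V \<Longrightarrow> \<tau> y \<in> U"
    and df: "\<And>v. (\<lambda>z. \<phi> z v) differentiable (at (\<tau> x))"
    and t: "(\<tau> has_derivative \<tau>') (at x)"
    and g: "\<And>j. j < k \<Longrightarrow> (g j has_derivative g' j) (at x)"
  shows "((\<lambda>y. \<phi> (\<tau> y) (\<lambda>j. g j y)) has_derivative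
     (\<lambda>u. fd (\<lambda>z. \<phi> z (\<lambda>j. g j x)) (\<tau> x) (\<tau>' u)
        + (\<Sum>i<k. \<phi> (\<tau> x) ((\<lambda>j. g j x)(i := g' i u))))) (at x)"
proof -
  let ?Q = "{..<k} \<rightarrow>\<^sub>E (Basis :: 'v set)"
  let ?G = "\<lambda>j. g j x"
  let ?D = "\<lambda>v. fd (\<lambda>z. \<phi> z v) (\<tau> x)"
  have D: "((\<lambda>z. \<phi> z v) has_derivative ?D v) (at (\<tau> x))" for v by (rule frechet_derivative_has[OF df])
  have "((\<lambda>y. \<Sum>K\<in>?Q. (\<Prod>j<k. of_real (g j y \<bullet> K j)) * \<phi> (\<tau> y) K) has_derivative
     (\<lambda>u. \<Sum>K\<in>?Q. (\<Prod>j<k. of_real (g j x \<bullet> K j)) * ?D K (\<tau>' u)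
       + (\<Sum>i<k. of_real (g' i u \<bullet> K i) * (\<Prod>j\<in>{..<k} - {i}. of_real (g j x \<bullet> K j))) * \<phi> (\<tau> x) K)) (at x)"
  proof (rule has_derivative_sum)
    fix K
    have 1: "((\<lambda>y. \<phi> (\<tau> y) K) has_derivative (\<lambda>u. ?D K (\<tau>' u))) (at x)"
      using diff_chain_at[OF t D[of K]] by (simp add: o_def)
    have 2: "((\<lambda>y. complex_of_real (g j y \<bullet> K j)) has_derivative (\<lambda>u. of_real (g' j u \<bullet> K j))) (at x)" if "j < k" for j
      by (intro has_derivative_of_real has_derivative_inner_left g that)
    have "((\<lambda>y. \<Prod>j<k. complex_of_real (g j y \<bullet> K j)) has_derivative
       (\<lambda>u. \<Sum>i<k. of_real (g' i u \<bullet> K i) * (\<Prod>j\<in>{..<k} - {i}. of_real (g j x \<bullet> K j)))) (at x)"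
      by (rule has_derivative_prod) (use 2 in auto)
    from has_derivative_mult[OF this 1]
    show "((\<lambda>y. (\<Prod>j<k. of_real (g j y \<bullet> K j)) * \<phi> (\<tau> y) K) has_derivative
     (\<lambda>u. (\<Prod>j<k. of_real (g j x \<bullet> K j)) * ?D K (\<tau>' u)
       + (\<Sum>i<k. of_real (g' i u \<bullet> K i) * (\<Prod>j\<in>{..<k} - {i}. of_real (g j x \<bullet> K j))) * \<phi> (\<tau> x) K)) (at x)" .
  qed
  then have A: "((\<lambda>y. \<phi> (\<tau> y) (\<lambda>j. g j y)) has_derivative
     (\<lambda>u. \<Sum>K\<in>?Q. (\<Prod>j<k. of_real (g j x \<bullet> K j)) * ?D K (\<tau>' u)
       + (\<Sum>i<k. of_real (g' i u \<bullet> K i) * (\<Prod>j\<in>{..<k} - {i}. of_real (g j x \<bullet> K j))) * \<phi> (\<tau> x) K)) (at x)"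
    by (rule has_derivative_transform_within_open[OF _ V(1,2)])
      (rule multilin_expand[OF ml[OF V(3)], symmetric])
  \<comment> \<open>The same expansion with the arguments frozen at x, which collapses the first
    part of the derivative.\<close>
  have "((\<lambda>z. \<Sum>K\<in>?Q. (\<Prod>j<k. of_real (g j x \<bullet> K j)) * \<phi> z K) has_derivative
     (\<lambda>u. \<Sum>K\<in>?Q. (\<Prod>j<k. of_real (g j x \<bullet> K j)) * ?D K u)) (at (\<tau> x))"
    by (intro has_derivative_sum has_derivative_mult_right D)
  then have "((\<lambda>z. \<phi> z ?G) has_derivative
     (\<lambda>u. \<Sum>K\<in>?Q. (\<Prod>j<k. of_real (g j x \<bullet> K j)) * ?D K u)) (at (\<tau> x))"
    by (rule has_derivative_transform_within_open[OF _ U])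
      (rule multilin_expand[OF ml, symmetric])
  then have B: "?D ?G u = (\<Sum>K\<in>?Q. (\<Prod>j<k. of_real (g j x \<bullet> K j)) * ?D K u)" for u
    using frechet_derivative_eqI by (metis (no_types, lifting))
  have "(\<Sum>K\<in>?Q. (\<Sum>i<k. of_real (g' i u \<bullet> K i) * (\<Prod>j\<in>{..<k} - {i}. of_real (g j x \<bullet> K j))) * \<phi> (\<tau> x) K)
     = (\<Sum>i<k. \<phi> (\<tau> x) (?G(i := g' i u)))" for u
  proof -
    have "(\<Prod>j<k. complex_of_real ((?G(i := g' i u)) j \<bullet> K j))
       = of_real (g' i u \<bullet> K i) * (\<Prod>j\<in>{..<k} - {i}. of_real (g j x \<bullet> K j))" if "i < k" for i K
    proof -
      have "(\<Prod>j<k. complex_of_real ((?G(i := g' i u)) j \<bullet> K j)) =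
        of_real ((?G(i := g' i u)) i \<bullet> K i) * (\<Prod>j\<in>{..<k} - {i}. complex_of_real ((?G(i := g' i u)) j \<bullet> K j))"
        using that by (intro prod.remove) auto
      also have "\<dots> = of_real (g' i u \<bullet> K i) * (\<Prod>j\<in>{..<k} - {i}. of_real (g j x \<bullet> K j))"
        by (intro arg_cong2[where f="(*)"] prod.cong) auto
      finally show ?thesis .
    qed
    then have "(\<Sum>i<k. \<phi> (\<tau> x) (?G(i := g' i u))) =
      (\<Sum>i<k. \<Sum>K\<in>?Q. (of_real (g' i u \<bullet> K i) * (\<Prod>j\<in>{..<k} - {i}. of_real (g j x \<bullet> K j))) * \<phi> (\<tau> x) K)"
      by (intro sum.cong refl, subst multilin_expand[OF ml[OF U(2)]]) (simp del: fun_upd_apply of_real_prod)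
    also have "\<dots> = (\<Sum>K\<in>?Q. \<Sum>i<k. (of_real (g' i u \<bullet> K i) * (\<Prod>j\<in>{..<k} - {i}. of_real (g j x \<bullet> K j))) * \<phi> (\<tau> x) K)"
      by (rule sum.swap)
    finally show ?thesis by (simp only: sum_distrib_right)
  qed
  with A show ?thesis by (simp only: B sum.distrib)
qed

text \<open>Both sequences list the entries of u other than j and Suc m in order, with c inserted at
  position m or at position j; m - j adjacent swaps lead from one to the other.\<close>

lemma alt_form_move:
  assumes "alt_form k \<theta>" "j \<le> m" "m < k"
  shows "\<theta> ((skip j u)(m := c)) = (- 1) ^ (m - j) * \<theta> ((skip (Suc m) u)(j := c))"
  using assms(2,3)
proof (induction m arbitrary: u rule: dec_induct)
  case base
  have "(skip j u)(j := c) = (skip (Suc j) u)(j := c)" by (auto simp: skip_def fun_eq_iff less_Suc_eq)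
  then show ?case by simp
next
  case (step m)
  \<comment> \<open>After one adjacent swap c stands at m and \<open>u (Suc m)\<close> behind it.
    Storing that vector at Suc (Suc m), an entry hidden by c before, restores the shape required by
    the induction hypothesis.\<close>
  let ?u = "u(Suc (Suc m) := u (Suc m))"
  have 1: "(skip j u)(Suc m := c) \<circ> adj m = (skip j ?u)(m := c)"
    using step.hyps by (auto simp: skip_def fun_eq_iff Transposition.transpose_def less_Suc_eq)
  have 2: "skip (Suc m) ?u = skip (Suc (Suc m)) u"
    by (auto simp: skip_def fun_eq_iff less_Suc_eq)
  have e1: "\<theta> ((skip j ?u)(m := c)) = - \<theta> ((skip j u)(Suc m := c))"
    unfolding 1[symmetric] using assms(1) step.prems by (simp only: alt_form_def)
  have e2: "\<theta> ((skip j ?u)(m := c)) = (- 1) ^ (m - j) * \<theta> ((skip (Suc m) ?u)(j := c))"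
    by (rule step.IH) (use step.prems in simp)
  have "\<theta> ((skip j u)(Suc m := c)) = - (\<theta> ((skip j ?u)(m := c)))"
    by (simp only: e1 minus_minus)
  also have "\<dots> = (- 1) ^ (Suc m - j) * \<theta> ((skip (Suc (Suc m)) u)(j := c))"
    using step.hyps unfolding e2 2 by (simp add: Suc_diff_le)
  finally show ?case .
qed

text \<open>
  The terms of a pulled-back derivative that contain the second derivative \<open>S\<close> of the coordinate
  change cancel, since \<open>S\<close> is symmetric and \<open>\<theta>\<close> is alternating.
\<close>

lemma alt_form_symmetric_cancel:
  assumes "alt_form k \<theta>" and S: "\<And>a b. S a b = S b a"
  shows "(\<Sum>i\<le>k. (- 1) ^ i * (\<Sum>j<k. \<theta> ((\<lambda>l. g (skip i v l))(j := S (skip i v j) (v i))))) = 0"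
proof -
  define u where "u = (\<lambda>l. g (v l))"
  have u: "(\<lambda>l. g (skip i v l)) = skip i u" for i by (auto simp: u_def skip_def)
  let ?F = "\<lambda>i j. (- 1) ^ i * \<theta> ((skip i u)(j := S (skip i v j) (v i)))"
  \<comment> \<open>Removing the same two entries in the other order gives the negative term, so the
    sum is its own negative.\<close>
  have "(\<Sum>i\<le>k. \<Sum>j<k. ?F i j) = - (\<Sum>i\<le>k. \<Sum>j<k. ?F i j)"
  proof (rule sum_skew_involution)
    fix i j :: nat assume *: "j < i" "i \<le> k"
    then have 1: "skip i v j = v j" "skip j v (i - 1) = v i" by (auto simp: skip_def)
    have "\<theta> ((skip j u)(i - 1 := c)) = (- 1) ^ (i - 1 - j) * \<theta> ((skip i u)(j := c))" for c
      using alt_form_move[OF assms(1), of j "i - 1" u c] * by simp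
    moreover have "(- 1 :: complex) ^ j * (- 1) ^ (i - 1 - j) = - ((- 1) ^ i)"
      using * by (cases i) (auto simp: power_add[symmetric])
    ultimately show "?F i j = - ?F j (i - 1)"
      unfolding 1 S[of "v i" "v j"] by (metis (no_types, opaque_lifting) minus_minus mult.assoc mult_minus_left)
  next
    fix i j :: nat assume *: "i \<le> j" "j < k"
    then have 1: "skip i v j = v (Suc j)" "skip (Suc j) v i = v i" by (auto simp: skip_def)
    have "\<theta> ((skip i u)(j := c)) = (- 1) ^ (j - i) * \<theta> ((skip (Suc j) u)(i := c))" for c
      using alt_form_move[OF assms(1), of i j u c] * by simp
    moreover have "(- 1 :: complex) ^ i * (- 1) ^ (j - i) = - ((- 1) ^ Suc j)"
      using * by (auto simp: power_add[symmetric])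
    ultimately show "?F i j = - ?F (Suc j) i"
      unfolding 1 S[of "v (Suc j)" "v i"] by (metis (no_types, opaque_lifting) mult.assoc mult_minus_left)
  qed
  then have "(\<Sum>i\<le>k. \<Sum>j<k. ?F i j) = 0" by (rule complex_eq_neg_self)
  then show ?thesis by (simp only: u sum_distrib_left)
qed

text \<open>The chain rule yields the pulled-back derivative plus terms in which the derivative
  falls on the arguments. Complex linearity of \<open>fd \<tau> x\<close> lets the direction
  \<open>\<i> *s v\<close> pass through the pullback, and the extra terms cancel by
  \<open>alt_form_symmetric_cancel\<close>.\<close>

lemma loc_del_pullback:
  fixes \<phi> :: "complex^'n::finite \<Rightarrow> (nat \<Rightarrow> complex^'n) \<Rightarrow> complex"
  assumes U: "open U" and V: "open V" "x \<in> V" "\<And>y. y \<in> V \<Longrightarrow> \<tau> y \<in> U"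
    and alt: "\<And>z. z \<in> U \<Longrightarrow> alt_form k (\<phi> z)" and sm: "\<And>v. smooth_on U (\<lambda>z. \<phi> z v)"
    and hol: "holomorphic_map_on V \<tau>"
    and pb: "\<And>y v. y \<in> V \<Longrightarrow> \<psi> y v = \<phi> (\<tau> y) (\<lambda>i. fd \<tau> y (v i))"
  shows "loc_del s k \<psi> x v = loc_del s k \<phi> (\<tau> x) (\<lambda>i. fd \<tau> x (v i))"
proof -
  let ?T = "fd \<tau> x"
  let ?B = "\<lambda>a u. fd (\<lambda>y. fd \<tau> y a) x u"
  have cl: "fd \<tau> y (c *s a) = c *s fd \<tau> y a"
    if "y \<in> V" for y c a
    using hol that by (auto simp: holomorphic_map_on_def)
  have st: "smooth_on V \<tau>" using hol by (auto simp: holomorphic_map_on_def)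
  have tU: "\<tau> x \<in> U" using V by blast
  have Bsym: "?B a u = ?B u a" for a u by (rule smooth_on_clairaut[OF V(1,2) st])
  have hB: "((\<lambda>y. fd \<tau> y a) has_derivative ?B a) (at x)" for a
    by (intro frechet_derivative_has smooth_on_differentiable[OF _ V(2)] smooth_on_frechet st)
  \<comment> \<open>The first derivative of \<tau> is complex-linear in its direction at every
    nearby point, so the second derivative is complex-linear in one slot, and by symmetry in the
    other.\<close>
  have Bi: "?B a (\<i> *s u) = \<i> *s ?B a u" for a u
  proof -
    have "((\<lambda>y. \<i> *s fd \<tau> y u) has_derivative (\<lambda>w. \<i> *s ?B u w)) (at x)"
      by (rule bounded_linear.has_derivative[OF _ hB])
        (simp add: linear_complex_scale linear_conv_bounded_linear[symmetric])
    then have "((\<lambda>y. fd \<tau> y (\<i> *s u)) has_derivative (\<lambda>w. \<i> *s ?B u w)) (at x)"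
      by (rule has_derivative_transform_within_open[OF _ V(1,2)]) (simp add: cl)
    then have "?B (\<i> *s u) = (\<lambda>w. \<i> *s ?B u w)" by (rule frechet_derivative_eqI)
    then show ?thesis by (metis Bsym)
  qed
  \<comment> \<open>The terms in which the derivative along u falls on one of the transformed
    arguments.\<close>
  define E where "E w u = (\<Sum>j<k. \<phi> (\<tau> x) ((\<lambda>l. ?T (w l))(j := ?B (w j) u)))" for w u
  have dp: "dpart s (\<lambda>y. \<psi> y w) x u = dpart s (\<lambda>z. \<phi> z (\<lambda>l. ?T (w l))) (\<tau> x) (?T u)
     + (E w u - s * \<i> * E w (\<i> *s u)) / 2" for w u
  proof -
    have "((\<lambda>y. \<phi> (\<tau> y) (\<lambda>j. fd \<tau> y (w j))) has_derivative
     (\<lambda>u. fd (\<lambda>z. \<phi> z (\<lambda>j. ?T (w j))) (\<tau> x) (?T u) + E w u)) (at x)"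
      unfolding E_def using U tU V alt hB by (intro has_derivative_multilin[where U=U and V=V] frechet_derivative_has
          smooth_on_differentiable[OF st] smooth_on_differentiable[OF sm]
          smooth_on_differentiable[OF smooth_on_frechet[OF st]]) (auto simp: alt_form_def)
    then have hd: "((\<lambda>y. \<psi> y w) has_derivative
     (\<lambda>u. fd (\<lambda>z. \<phi> z (\<lambda>j. ?T (w j))) (\<tau> x) (?T u) + E w u)) (at x)"
      by (rule has_derivative_transform_within_open[OF _ V(1,2)]) (simp add: pb)
    show ?thesis
      unfolding has_derivative_dpart[OF hd] dpart_def[of _ "\<lambda>z. \<phi> z (\<lambda>l. ?T (w l))"] cl[OF V(2)]
      by (simp add: algebra_simps add_divide_distrib diff_divide_distrib)
  qed
  have sk: "skip i (\<lambda>l. ?T (v l)) = (\<lambda>l. ?T (skip i v l))" for i by (auto simp: skip_def)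
  have 0: "(\<Sum>i\<le>k. (- 1) ^ i * E (skip i v) (v i)) = 0"
    unfolding E_def by (rule alt_form_symmetric_cancel[OF alt[OF tU], of ?B ?T v]) (rule Bsym)
  \<comment> \<open>The map taking a, u to \<open>?B a (\<i> *s u)\<close> is again symmetric, as
    the factor \<open>\<i>\<close> can be moved to either slot.\<close>
  have 1: "(\<Sum>i\<le>k. (- 1) ^ i * E (skip i v) (\<i> *s v i)) = 0"
    unfolding E_def by (rule alt_form_symmetric_cancel[OF alt[OF tU], of "\<lambda>a u. ?B a (\<i> *s u)" ?T v]) (metis Bi Bsym)
  have "loc_del s k \<psi> x v = loc_del s k \<phi> (\<tau> x) (\<lambda>i. ?T (v i))
    + ((\<Sum>i\<le>k. (- 1) ^ i * E (skip i v) (v i)) - s * \<i> * (\<Sum>i\<le>k. (- 1) ^ i * E (skip i v) (\<i> *s v i))) / 2"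
    unfolding loc_del_def dp sk sum_distrib_left[of "s * \<i>"] sum_subtractf[symmetric] sum_divide_distrib sum.distrib[symmetric]
    by (intro sum.cong refl) (simp add: algebra_simps diff_divide_distrib)
  then show ?thesis unfolding 0 1 by simp
qed

section \<open>Forms on the manifold\<close>

lemma complex_atlas_chart:
  assumes "complex_atlas X A" "c \<in> A"
  shows "open (chart_image c)" "inj_on (snd c) (fst c)"
proof -
  have op: "openin X (fst c)" and "homeomorphic_map (subtopology X (fst c)) (top_of_set (chart_image c)) (snd c)"
    using assms by (auto simp: complex_atlas_def)
  from homeomorphic_imp_injective_map[OF this(2)] show "inj_on (snd c) (fst c)"
    using openin_subset[OF op] by (simp add: inf_absorb2)
  show "open (chart_image c)" using assms by (auto simp: complex_atlas_def)
qed

lemma complex_atlas_overlap_open: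
  assumes "complex_atlas X A" "c \<in> A" "d \<in> A"
  shows "open (snd c ` (fst c \<inter> fst d))"
proof -
  have op: "openin X (fst c)" "openin X (fst d)"
    and hm: "homeomorphic_map (subtopology X (fst c)) (top_of_set (chart_image c)) (snd c)"
    using assms by (auto simp: complex_atlas_def)
  have "openin (subtopology X (fst c)) (fst c \<inter> fst d)"
    using op by (auto simp: openin_subtopology)
  then have "openin (top_of_set (chart_image c)) (snd c ` (fst c \<inter> fst d))"
    using homeomorphic_imp_open_map[OF hm] by (simp add: open_map_def)
  then show ?thesis
    using complex_atlas_chart(1)[OF assms(1,2)] openin_open_trans by blast
qed

lemma transition_chart:
  assumes "complex_atlas X A" "c \<in> A" "m \<in> fst c"
  shows "transition c d (snd c m) = snd d m"
  using complex_atlas_chart(2)[OF assms(1,2)] assms(3) by (simp add: transition_def)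

lemma smooth_pq_formD:
  assumes "smooth_pq_form A p q \<omega>"
  shows "c \<in> A \<Longrightarrow> x \<in> chart_image c \<Longrightarrow> \<omega> c x \<in> pq_covectors p q"
    and "c \<in> A \<Longrightarrow> smooth_on (chart_image c) (\<lambda>x. \<omega> c x v)"
    and "c \<in> A \<Longrightarrow> d \<in> A \<Longrightarrow> m \<in> fst c \<inter> fst d \<Longrightarrow> \<omega> c (snd c m) v =
        \<omega> d (snd d m) (\<lambda>i. fd (transition c d) (snd c m) (v i))"
    and "c \<notin> A \<or> x \<notin> chart_image c \<Longrightarrow> \<omega> c x v = 0"
  using assms unfolding smooth_pq_form_def by blast+

text \<open>Bidegree enters \<open>del\<close> and \<open>delbar\<close> only through the total
  degree k, so one operator with a sign s covers both.\<close>

definition form_del :: "complex \<Rightarrow> ('a, 'n::finite) chart set \<Rightarrow> nat \<Rightarrow> ('a, 'n) form \<Rightarrow> ('a, 'n) form" where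
  "form_del s A k \<omega> = (\<lambda>c x v. if c \<in> A \<and> x \<in> chart_image c then loc_del s k (\<omega> c) x v else 0)"

lemma del_eq_form_del: "del A p q = form_del 1 A (nat (p + q))"
  by (intro ext) (simp add: del_def form_del_def loc_del_def d10_eq_dpart)

lemma delbar_eq_form_del: "delbar A p q = form_del (- 1) A (nat (p + q))"
  by (intro ext) (simp add: delbar_def form_del_def loc_del_def d01_eq_dpart)

text \<open>The second condition of \<open>type\<close> says that the factor of
  \<open>loc_del_scale\<close> turns the weight (p, q) into (p', q'). Type and smoothness are
  checked in each chart; agreement between charts is \<open>loc_del_pullback\<close> for the
  transition map.\<close>

lemma smooth_pq_form_form_del:
  assumes at: "complex_atlas X A" and om: "smooth_pq_form A p q \<omega>" and s: "s * s = 1"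
    and type: "p' + q' = Suc (p + q)"
      "\<And>z. (of_real (Re z) + s * \<i> * of_real (Im z)) * (z ^ p * cnj z ^ q) = z ^ p' * cnj z ^ q'"
  shows "smooth_pq_form A p' q' (form_del s A (p + q) \<omega>)"
proof -
  have op: "open (chart_image c)" if "c \<in> A" for c using complex_atlas_chart(1)[OF at that] .
  have alt: "alt_form (p + q) (\<omega> c x)" and hom: "bihom p q (\<omega> c x)" if "c \<in> A" "x \<in> chart_image c" for c x
    using smooth_pq_formD(1)[OF om that] by (simp_all add: pq_covectors_iff)
  have sm: "smooth_on (chart_image c) (\<lambda>x. \<omega> c x v)" if "c \<in> A" for c v
    by (rule smooth_pq_formD(2)[OF om that])
  have covec: "loc_del s (p + q) (\<omega> c) x \<in> pq_covectors p' q'" if c: "c \<in> A" and x: "x \<in> chart_image c" for c x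
    unfolding pq_covectors_iff type(1)
  proof
    show "alt_form (Suc (p + q)) (loc_del s (p + q) (\<omega> c) x)"
      by (rule alt_form_loc_del[OF op[OF c] x sm[OF c] alt[OF c]])
    show "bihom p' q' (loc_del s (p + q) (\<omega> c) x)"
      unfolding bihom_def using loc_del_scale[OF op[OF c] x sm[OF c] s hom[OF c], of "p + q"] type(2) by simp
  qed
  have pull: "loc_del s (p + q) (\<omega> c) (snd c m) v =
      loc_del s (p + q) (\<omega> d) (snd d m) (\<lambda>i. fd (transition c d) (snd c m) (v i))"
    if c: "c \<in> A" and d: "d \<in> A" and m: "m \<in> fst c \<inter> fst d" for c d m v
  proof -
    \<comment> \<open>The pullback relation holds over the overlap only, whereas the representative
      in d is available on the whole image of d.\<close>
    let ?V = "snd c ` (fst c \<inter> fst d)"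
    have hol: "holomorphic_map_on ?V (transition c d)"
      using at c d by (auto simp: complex_atlas_def)
    have "transition c d y \<in> chart_image d" if "y \<in> ?V" for y
      using that transition_chart[OF at c, of _ d] by auto
    moreover have "\<omega> c y w = \<omega> d (transition c d y) (\<lambda>i. fd (transition c d) y (w i))"
      if y: "y \<in> ?V" for y w
    proof -
      obtain m' where m': "y = snd c m'" "m' \<in> fst c \<inter> fst d" using y by blast
      show ?thesis
        unfolding m'(1) using m'(2) transition_chart[OF at c, of m' d] smooth_pq_formD(3)[OF om c d m'(2), of w] by simp
    qed
    ultimately have "loc_del s (p + q) (\<omega> c) (snd c m) v = loc_del s (p + q) (\<omega> d) (transition c d (snd c m))
       (\<lambda>i. fd (transition c d) (snd c m) (v i))"
      using m alt[OF d] sm[OF d]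
      by (intro loc_del_pullback[OF op[OF d] complex_atlas_overlap_open[OF at c d] _ _ _ _ hol]) auto
    then show ?thesis using transition_chart[OF at c, of m d] m by simp
  qed
  show ?thesis
    unfolding smooth_pq_form_def
  proof (intro conjI)
    show "\<forall>c\<in>A. \<forall>x\<in>chart_image c. form_del s A (p + q) \<omega> c x \<in> pq_covectors p' q'"
      using covec by (simp add: form_del_def)
    have "smooth_on (chart_image c) (\<lambda>x. form_del s A (p + q) \<omega> c x v)" if c: "c \<in> A" for c v
      using smooth_on_loc_del[OF op[OF c] sm[OF c], where s=s and k="p + q" and v=v] c
        smooth_on_cong[OF op[OF c], of "\<lambda>x. loc_del s (p + q) (\<omega> c) x v" "\<lambda>x. form_del s A (p + q) \<omega> c x v"]
      by (auto simp: form_del_def)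
    then show "\<forall>c\<in>A. \<forall>v. smooth_on (chart_image c) (\<lambda>x. form_del s A (p + q) \<omega> c x v)" by blast
    show "\<forall>c\<in>A. \<forall>d\<in>A. \<forall>m\<in>fst c \<inter> fst d. \<forall>v. form_del s A (p + q) \<omega> c (snd c m) v =
        form_del s A (p + q) \<omega> d (snd d m) (\<lambda>i. fd (transition c d) (snd c m) (v i))"
    proof (intro ballI allI)
      fix c d m v assume "c \<in> A" "d \<in> A" "m \<in> fst c \<inter> fst d"
      with pull[OF this, of v] show "form_del s A (p + q) \<omega> c (snd c m) v =
        form_del s A (p + q) \<omega> d (snd d m) (\<lambda>i. fd (transition c d) (snd c m) (v i))"
        by (simp add: form_del_def)
    qed
  qed (auto simp: form_del_def)
qed

lemma form_del_anticommute:
  assumes at: "complex_atlas X A" and om: "smooth_pq_form A p q \<omega>"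
  shows "form_del s A (Suc k) (form_del t A k \<omega>) c x v = - form_del t A (Suc k) (form_del s A k \<omega>) c x v"
proof (cases "c \<in> A \<and> x \<in> chart_image c")
  case True
  have op: "open (chart_image c)" using complex_atlas_chart(1)[OF at] True by blast
  have sm: "smooth_on (chart_image c) (\<lambda>x. \<omega> c x v)" for v
    using smooth_pq_formD(2)[OF om] True by blast
  \<comment> \<open>\<open>form_del\<close> and \<open>loc_del\<close> agree on the chart image, and
    since that is open their derivatives agree there as well.\<close>
  have "dpart s (\<lambda>y. form_del t A k \<omega> c y w) x = dpart s (\<lambda>y. loc_del t k (\<omega> c) y w) x" for s t w
    by (rule dpart_cong_open[OF op]) (use True in \<open>auto simp: form_del_def\<close>)
  then have "loc_del s (Suc k) (form_del t A k \<omega> c) x v = loc_del s (Suc k) (loc_del t k (\<omega> c)) x v" for s t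
    by (simp only: loc_del_def[of s "Suc k"])
  moreover have "loc_del s (Suc k) (loc_del t k (\<omega> c)) x v = - loc_del t (Suc k) (loc_del s k (\<omega> c)) x v"
    using True by (intro loc_del_anticommute[OF op _ sm]) blast
  ultimately show ?thesis
    using True unfolding form_del_def[of _ A "Suc k"] by simp
qed (auto simp: form_del_def[of _ A "Suc k"])

text \<open>Anticommutation with equal signs makes every value its own negative.\<close>

lemma form_del_twice:
  assumes "complex_atlas X A" "smooth_pq_form A p q \<omega>"
  shows "form_del s A (Suc k) (form_del s A k \<omega>) = (\<lambda>c x v. 0)"
proof (intro ext)
  fix c x v
  have "form_del s A (Suc k) (form_del s A k \<omega>) c x v = - form_del s A (Suc k) (form_del s A k \<omega>) c x v"
    by (rule form_del_anticommute[OF assms])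
  then show "form_del s A (Suc k) (form_del s A k \<omega>) c x v = 0" by (rule complex_eq_neg_self)
qed

lemma form_del_add:
  assumes at: "complex_atlas X A" and "smooth_pq_form A p q \<omega>" "smooth_pq_form A p q \<eta>"
  shows "form_del s A k (\<lambda>c x v. \<omega> c x v + \<eta> c x v) = (\<lambda>c x v. form_del s A k \<omega> c x v + form_del s A k \<eta> c x v)"
proof (intro ext)
  fix c x v
  have "(\<lambda>x. \<omega> c x v) differentiable (at x)" "(\<lambda>x. \<eta> c x v) differentiable (at x)"
    if "c \<in> A" "x \<in> chart_image c" for v
    using smooth_pq_formD(2)[OF assms(2)] smooth_pq_formD(2)[OF assms(3)] that smooth_on_differentiable by blast+
  then show "form_del s A k (\<lambda>c x v. \<omega> c x v + \<eta> c x v) c x v = form_del s A k \<omega> c x v + form_del s A k \<eta> c x v"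
    by (simp add: form_del_def loc_del_def dpart_add sum.distrib algebra_simps)
qed

lemma form_del_smult:
  assumes at: "complex_atlas X A" and "smooth_pq_form A p q \<omega>"
  shows "form_del s A k (\<lambda>c x v. r * \<omega> c x v) = (\<lambda>c x v. r * form_del s A k \<omega> c x v)"
proof (intro ext)
  fix c x v
  have "(\<lambda>x. \<omega> c x v) differentiable (at x)" if "c \<in> A" "x \<in> chart_image c" for v
    using smooth_pq_formD(2)[OF assms(2)] that smooth_on_differentiable by blast
  then show "form_del s A k (\<lambda>c x v. r * \<omega> c x v) c x v = r * form_del s A k \<omega> c x v"
    by (simp add: form_del_def loc_del_def dpart_cmult sum_distrib_left mult_ac)
qed

lemma form_del_zero: "form_del s A k (\<lambda>c x v. 0) = (\<lambda>c x v. 0)"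
  by (intro ext) (simp add: form_del_def loc_del_def dpart_const)

lemma smooth_pq_form_zero: "smooth_pq_form A p q (\<lambda>c x v. 0)"
  by (simp add: smooth_pq_form_def smooth_on_const pq_covectors_iff alt_form_0 bihom_def)

lemma smooth_pq_form_add:
  assumes at: "complex_atlas X A" and "smooth_pq_form A p q \<omega>" "smooth_pq_form A p q \<eta>"
  shows "smooth_pq_form A p q (\<lambda>c x v. \<omega> c x v + \<eta> c x v)"
  unfolding smooth_pq_form_def
proof (intro conjI ballI allI impI)
  note 1 = smooth_pq_formD[OF assms(2)] and 2 = smooth_pq_formD[OF assms(3)]
  fix c d x m v assume c: "c \<in> A"
  show "(\<lambda>v. \<omega> c x v + \<eta> c x v) \<in> pq_covectors p q" if "x \<in> chart_image c"
    using 1(1)[OF c that] 2(1)[OF c that]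
    by (auto simp: pq_covectors_iff bihom_def algebra_simps intro: alt_form_add)
  show "smooth_on (chart_image c) (\<lambda>x. \<omega> c x v + \<eta> c x v)"
    by (intro smooth_on_add complex_atlas_chart(1)[OF at c] 1(2)[OF c] 2(2)[OF c])
  assume "d \<in> A" "m \<in> fst c \<inter> fst d"
  then show "\<omega> c (snd c m) v + \<eta> c (snd c m) v =
      \<omega> d (snd d m) (\<lambda>i. fd (transition c d) (snd c m) (v i)) +
      \<eta> d (snd d m) (\<lambda>i. fd (transition c d) (snd c m) (v i))"
    using 1(3)[OF c, of d m v] 2(3)[OF c, of d m v] by simp
qed (simp only: smooth_pq_formD(4)[OF assms(2)] smooth_pq_formD(4)[OF assms(3)] add_0)

lemma smooth_pq_form_smult:
  assumes at: "complex_atlas X A" and "smooth_pq_form A p q \<omega>"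
  shows "smooth_pq_form A p q (\<lambda>c x v. r * \<omega> c x v)"
  unfolding smooth_pq_form_def
proof (intro conjI ballI allI impI)
  note 1 = smooth_pq_formD[OF assms(2)]
  fix c d x m v assume c: "c \<in> A"
  show "(\<lambda>v. r * \<omega> c x v) \<in> pq_covectors p q" if "x \<in> chart_image c"
    using 1(1)[OF c that] by (auto simp: pq_covectors_iff bihom_def intro: alt_form_cmult)
  show "smooth_on (chart_image c) (\<lambda>x. r * \<omega> c x v)"
    by (intro smooth_on_cmult complex_atlas_chart(1)[OF at c] 1(2)[OF c])
  assume "d \<in> A" "m \<in> fst c \<inter> fst d"
  then show "r * \<omega> c (snd c m) v =
      r * \<omega> d (snd d m) (\<lambda>i. fd (transition c d) (snd c m) (v i))"
    using 1(3)[OF c, of d m v] by simp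
qed (simp only: smooth_pq_formD(4)[OF assms(2)] mult_zero_right)

lemma smooth_pq_form_del:
  assumes "complex_atlas X A" "smooth_pq_form A p q \<omega>"
  shows "smooth_pq_form A (Suc p) q (form_del 1 A (p + q) \<omega>)"
proof (rule smooth_pq_form_form_del[OF assms])
  fix z :: complex
  have "of_real (Re z) + 1 * \<i> * of_real (Im z) = z" by (simp add: complex_eq_iff)
  then show "(of_real (Re z) + 1 * \<i> * of_real (Im z)) * (z ^ p * cnj z ^ q) = z ^ Suc p * cnj z ^ q"
    by (metis mult.assoc power_Suc)
qed auto

lemma smooth_pq_form_delbar:
  assumes "complex_atlas X A" "smooth_pq_form A p q \<omega>"
  shows "smooth_pq_form A p (Suc q) (form_del (- 1) A (p + q) \<omega>)"
proof (rule smooth_pq_form_form_del[OF assms])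
  fix z :: complex
  have "of_real (Re z) + (- 1) * \<i> * of_real (Im z) = cnj z" by (simp add: complex_eq_iff)
  then show "(of_real (Re z) + (- 1) * \<i> * of_real (Im z)) * (z ^ p * cnj z ^ q) = z ^ p * cnj z ^ Suc q"
    by (metis mult.left_commute power_Suc)
qed auto

section \<open>Complex vector spaces and their quotients\<close>

abbreviation cvs :: "(complex, 'v) module \<Rightarrow> bool" where
  "cvs V \<equiv> module complex_ring V"

abbreviation csub :: "'v set \<Rightarrow> (complex, 'v) module \<Rightarrow> bool" where
  "csub S V \<equiv> submodule S complex_ring V"

definition linmap :: "(complex, 'v) module \<Rightarrow> (complex, 'w) module \<Rightarrow> ('v \<Rightarrow> 'w) \<Rightarrow> bool" where
  "linmap V W f \<longleftrightarrow> f \<in> carrier V \<rightarrow> carrier W \<and>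
     (\<forall>x\<in>carrier V. \<forall>y\<in>carrier V. f (x \<oplus>\<^bsub>V\<^esub> y) = f x \<oplus>\<^bsub>W\<^esub> f y) \<and>
     (\<forall>c. \<forall>x\<in>carrier V. f (c \<odot>\<^bsub>V\<^esub> x) = c \<odot>\<^bsub>W\<^esub> f x)"

definition ker_of :: "(complex, 'v) module \<Rightarrow> (complex, 'w) module \<Rightarrow> ('v \<Rightarrow> 'w) \<Rightarrow> 'v set" where
  "ker_of V W f = {x \<in> carrier V. f x = \<zero>\<^bsub>W\<^esub>}"

lemma complex_ring_simps [simp]:
  "carrier complex_ring = UNIV" "\<zero>\<^bsub>complex_ring\<^esub> = 0" "\<one>\<^bsub>complex_ring\<^esub> = 1"
  "x \<oplus>\<^bsub>complex_ring\<^esub> y = x + y" "x \<otimes>\<^bsub>complex_ring\<^esub> y = x * y"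
  by (simp_all add: complex_ring_def)

lemma cring_complex_ring: "cring complex_ring"
proof (rule cringI)
  show "abelian_group complex_ring"
  proof (rule abelian_groupI)
    fix x :: complex
    show "\<exists>y\<in>carrier complex_ring. y \<oplus>\<^bsub>complex_ring\<^esub> x = \<zero>\<^bsub>complex_ring\<^esub>"
      by (rule bexI[of _ "- x"]) auto
  qed (auto simp: algebra_simps)
  show "comm_monoid complex_ring"
    by (rule comm_monoidI) (auto simp: algebra_simps)
qed (auto simp: algebra_simps)

lemma subsp_simps [simp]:
  "carrier (subsp V S) = S" "\<zero>\<^bsub>subsp V S\<^esub> = \<zero>\<^bsub>V\<^esub>" "x \<oplus>\<^bsub>subsp V S\<^esub> y = x \<oplus>\<^bsub>V\<^esub> y"
  "c \<odot>\<^bsub>subsp V S\<^esub> x = c \<odot>\<^bsub>V\<^esub> x"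
  by (simp_all add: subsp_def)

lemma subsp_carrier: "subsp V (carrier V) = V"
  by (simp add: subsp_def)

lemma set_add_subsp [simp]: "set_add (subsp V S) = set_add V"
  by (intro ext) (simp add: set_add_def')

lemma a_r_coset_subsp [simp]: "W +>\<^bsub>subsp V S\<^esub> x = W +>\<^bsub>V\<^esub> x"
  by (simp add: a_r_coset_def')

lemma class_map_subsp [simp]: "class_map (subsp V S) = class_map V"
  by (intro ext) (simp add: class_map_def)

lemma in_set_add: "x \<in> S <+>\<^bsub>V\<^esub> T \<longleftrightarrow> (\<exists>s\<in>S. \<exists>t\<in>T. x = s \<oplus>\<^bsub>V\<^esub> t)"
  by (auto simp: set_add_def')

lemma cvs_smult_closed: "cvs V \<Longrightarrow> x \<in> carrier V \<Longrightarrow> c \<odot>\<^bsub>V\<^esub> x \<in> carrier V"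
  by (simp add: module.smult_closed)

lemma cvs_abelian_group: "cvs V \<Longrightarrow> abelian_group V"
  by (simp add: module_def)

text \<open>Makes closure under negation a consequence of closure under multiples, so that
  \<open>csubI\<close> needs no clause for it.\<close>

lemma cvs_neg:
  fixes V (structure)
  assumes "cvs V" "x \<in> carrier V" shows "\<ominus> x = (- 1) \<odot> x"
proof -
  interpret module complex_ring V by fact
  have "(1 + - 1) \<odot> x = 1 \<odot> x \<oplus> (- 1) \<odot> x"
    using smult_l_distr[of 1 "- 1" x] assms(2) by simp
  then have "x \<oplus> (- 1) \<odot> x = \<zero>"
    using smult_l_null[OF assms(2)] smult_one[OF assms(2)] by simp
  moreover have "(- 1) \<odot> x \<in> carrier V" using smult_closed[of "- 1" x] assms(2) by simp
  ultimately show ?thesis using assms(2) by (intro M.minus_equality) (simp_all add: M.a_comm)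
qed

lemma csubI:
  assumes "cvs V" "S \<subseteq> carrier V" "\<zero>\<^bsub>V\<^esub> \<in> S"
    "\<And>x y. x \<in> S \<Longrightarrow> y \<in> S \<Longrightarrow> x \<oplus>\<^bsub>V\<^esub> y \<in> S" "\<And>c x. x \<in> S \<Longrightarrow> c \<odot>\<^bsub>V\<^esub> x \<in> S"
  shows "csub S V"
  using assms by (intro module.submoduleI) (auto simp: cvs_neg subset_iff)

lemma csubD:
  fixes V (structure)
  assumes "cvs V" "csub S V"
  shows "S \<subseteq> carrier V" "\<zero> \<in> S"
    "\<And>x y. x \<in> S \<Longrightarrow> y \<in> S \<Longrightarrow> x \<oplus> y \<in> S" "\<And>c x. x \<in> S \<Longrightarrow> c \<odot> x \<in> S"
    "\<And>x. x \<in> S \<Longrightarrow> \<ominus> x \<in> S" "\<And>x y. x \<in> S \<Longrightarrow> y \<in> S \<Longrightarrow> x \<ominus> y \<in> S"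
proof -
  note E = module.submoduleE[OF assms]
  show "S \<subseteq> carrier V" "\<And>x y. x \<in> S \<Longrightarrow> y \<in> S \<Longrightarrow> x \<oplus> y \<in> S" "\<And>x. x \<in> S \<Longrightarrow> \<ominus> x \<in> S"
    "\<And>c x. x \<in> S \<Longrightarrow> c \<odot> x \<in> S" "\<And>x y. x \<in> S \<Longrightarrow> y \<in> S \<Longrightarrow> x \<ominus> y \<in> S"
    using E by (auto simp: a_minus_def)
  obtain x where x: "x \<in> S" using E(2) by blast
  then have "0 \<odot> x \<in> S" using E(4) by simp
  then show "\<zero> \<in> S"
    using module.smult_l_null[OF assms(1), of x] x E(1) by (auto simp: subset_iff)
qed

lemma cvs_subsp: "cvs V \<Longrightarrow> csub S V \<Longrightarrow> cvs (subsp V S)"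
  unfolding subsp_def by (rule submodule.submodule_is_module)

lemma csub_subsp:
  assumes "cvs V" "csub S V" "csub T V" "T \<subseteq> S" shows "csub T (subsp V S)"
  using assms(4) csubD[OF assms(1,3)] by (intro csubI[OF cvs_subsp[OF assms(1,2)]]) auto

lemma csub_carrier: "cvs V \<Longrightarrow> csub (carrier V) V"
  by (rule module.carrier_is_submodule)

lemma csub_set_add:
  fixes V (structure)
  assumes "cvs V" "csub S V" "csub T V" shows "csub (S <+>\<^bsub>V\<^esub> T) V"
proof -
  interpret module complex_ring V by fact
  note S = csubD[OF assms(1,2)] and T = csubD[OF assms(1,3)]
  show ?thesis
  proof (rule csubI[OF assms(1)])
    show "S <+>\<^bsub>V\<^esub> T \<subseteq> carrier V" using S(1) T(1) by (auto simp: in_set_add subset_iff)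
    show "\<zero> \<in> S <+>\<^bsub>V\<^esub> T" using S(2) T(2) by (force simp: in_set_add)
  next
    fix x y assume "x \<in> S <+>\<^bsub>V\<^esub> T" "y \<in> S <+>\<^bsub>V\<^esub> T"
    then obtain s t s' t' where *: "s \<in> S" "t \<in> T" "s' \<in> S" "t' \<in> T" "x = s \<oplus> t" "y = s' \<oplus> t'"
      by (auto simp: in_set_add)
    then have "x \<oplus> y = (s \<oplus> s') \<oplus> (t \<oplus> t')"
      using S(1) T(1) by (simp add: subset_iff M.a_ac)
    then show "x \<oplus> y \<in> S <+>\<^bsub>V\<^esub> T" using S(3) T(3) * in_set_add by metis
  next
    fix c x assume "x \<in> S <+>\<^bsub>V\<^esub> T"
    then obtain s t where *: "s \<in> S" "t \<in> T" "x = s \<oplus> t"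
      by (auto simp: in_set_add)
    then have "c \<odot> x = c \<odot> s \<oplus> c \<odot> t"
      using S(1) T(1) by (simp add: subset_iff smult_r_distr)
    then show "c \<odot> x \<in> S <+>\<^bsub>V\<^esub> T" using S(4) T(4) * in_set_add by metis
  qed
qed

lemma csub_Int: "cvs V \<Longrightarrow> csub S V \<Longrightarrow> csub T V \<Longrightarrow> csub (S \<inter> T) V"
  using csubD(1)[of V S] csubD(2-4)[of V S] csubD(2-4)[of V T] by (intro csubI) blast+

lemma set_add_comm: "cvs V \<Longrightarrow> S \<subseteq> carrier V \<Longrightarrow> T \<subseteq> carrier V \<Longrightarrow> S <+>\<^bsub>V\<^esub> T = T <+>\<^bsub>V\<^esub> S"
  using abelian_monoid.a_comm[OF abelian_group.axioms(1)[OF cvs_abelian_group, of V]]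
  unfolding set_eq_iff in_set_add by blast

lemma csub_le_set_add:
  fixes V (structure)
  assumes "cvs V" "csub S V" "csub T V" shows "S \<subseteq> S <+>\<^bsub>V\<^esub> T" "T \<subseteq> S <+>\<^bsub>V\<^esub> T"
proof -
  interpret module complex_ring V by fact
  note S = csubD[OF assms(1,2)] and T = csubD[OF assms(1,3)]
  show "S \<subseteq> S <+>\<^bsub>V\<^esub> T" "T \<subseteq> S <+>\<^bsub>V\<^esub> T"
    using S(1,2) T(1,2) by (force simp: in_set_add subset_iff)+
qed

lemma linmapD:
  assumes "linmap V W f"
  shows "\<And>x. x \<in> carrier V \<Longrightarrow> f x \<in> carrier W"
    "\<And>x y. x \<in> carrier V \<Longrightarrow> y \<in> carrier V \<Longrightarrow> f (x \<oplus>\<^bsub>V\<^esub> y) = f x \<oplus>\<^bsub>W\<^esub> f y"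
    "\<And>c x. x \<in> carrier V \<Longrightarrow> f (c \<odot>\<^bsub>V\<^esub> x) = c \<odot>\<^bsub>W\<^esub> f x"
  using assms by (auto simp: linmap_def)

lemma linmapI:
  assumes "\<And>x. x \<in> carrier V \<Longrightarrow> f x \<in> carrier W"
    "\<And>x y. x \<in> carrier V \<Longrightarrow> y \<in> carrier V \<Longrightarrow> f (x \<oplus>\<^bsub>V\<^esub> y) = f x \<oplus>\<^bsub>W\<^esub> f y"
    "\<And>c x. x \<in> carrier V \<Longrightarrow> f (c \<odot>\<^bsub>V\<^esub> x) = c \<odot>\<^bsub>W\<^esub> f x"
  shows "linmap V W f"
  using assms by (auto simp: linmap_def)

lemma linmap_zero:
  fixes V (structure)
  assumes "cvs V" "cvs W" "linmap V W f" shows "f \<zero> = \<zero>\<^bsub>W\<^esub>"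
proof -
  interpret V: module complex_ring V by fact
  interpret W: module complex_ring W by fact
  have "f (0 \<odot> \<zero>) = 0 \<odot>\<^bsub>W\<^esub> f \<zero>"
    by (rule linmapD(3)[OF assms(3) V.M.zero_closed])
  then show ?thesis using V.smult_r_null[of 0] W.smult_l_null[of "f \<zero>"] linmapD(1)[OF assms(3)] by simp
qed

lemma linmap_neg:
  assumes "cvs V" "cvs W" "linmap V W f" "x \<in> carrier V" shows "f (\<ominus>\<^bsub>V\<^esub> x) = \<ominus>\<^bsub>W\<^esub> f x"
  using linmapD(3)[OF assms(3,4), of "- 1"] cvs_neg[OF assms(1,4)] cvs_neg[OF assms(2) linmapD(1)[OF assms(3,4)]] by simp

lemma linmap_minus:
  assumes "cvs V" "cvs W" "linmap V W f" "x \<in> carrier V" "y \<in> carrier V"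
  shows "f (x \<ominus>\<^bsub>V\<^esub> y) = f x \<ominus>\<^bsub>W\<^esub> f y"
proof -
  interpret V: module complex_ring V by fact
  show ?thesis
    using linmapD(2)[OF assms(3,4) V.M.a_inv_closed[OF assms(5)]] linmap_neg[OF assms(1-3,5)]
    by (simp add: a_minus_def)
qed

lemma linmap_comp:
  assumes "linmap V W f" "linmap W U g" shows "linmap V U (\<lambda>x. g (f x))"
  using linmapD[OF assms(1)] linmapD[OF assms(2)] by (intro linmapI) metis+

lemma linmap_restrict:
  "linmap V W f \<Longrightarrow> S \<subseteq> carrier V \<Longrightarrow> f ` S \<subseteq> T \<Longrightarrow> linmap (subsp V S) (subsp W T) f"
  by (auto simp: linmap_def subset_iff)

lemma csub_image:
  assumes "cvs V" "cvs W" "linmap V W f" "csub S V" shows "csub (f ` S) W"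
proof -
  note S = csubD[OF assms(1,4)] and f = linmapD[OF assms(3)]
  show ?thesis
  proof (rule csubI[OF assms(2)])
    show "f ` S \<subseteq> carrier W" using S(1) f(1) by blast
    show "\<zero>\<^bsub>W\<^esub> \<in> f ` S" using S(2) linmap_zero[OF assms(1-3)] by force
  next
    fix x y assume "x \<in> f ` S" "y \<in> f ` S"
    then obtain a b where "a \<in> S" "b \<in> S" "x = f a" "y = f b" by blast
    then show "x \<oplus>\<^bsub>W\<^esub> y \<in> f ` S" using S(1,3) f(2)[of a b] by (metis imageI subsetD)
  next
    fix c x assume "x \<in> f ` S"
    then obtain a where "a \<in> S" "x = f a" by blast
    then show "c \<odot>\<^bsub>W\<^esub> x \<in> f ` S" using S(1,4) f(3)[of a c] by (metis imageI subsetD)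
  qed
qed

lemma csub_vimage:
  assumes "cvs V" "cvs W" "linmap V W f" "csub T W" shows "csub {x \<in> carrier V. f x \<in> T} V"
proof -
  interpret V: module complex_ring V by fact
  note T = csubD[OF assms(2,4)] and f = linmapD[OF assms(3)]
  show ?thesis
  proof (rule csubI[OF assms(1)])
    show "\<zero>\<^bsub>V\<^esub> \<in> {x \<in> carrier V. f x \<in> T}"
      using linmap_zero[OF assms(1-3)] T(2) by simp
  next
    fix x y assume "x \<in> {x \<in> carrier V. f x \<in> T}" "y \<in> {x \<in> carrier V. f x \<in> T}"
    then show "x \<oplus>\<^bsub>V\<^esub> y \<in> {x \<in> carrier V. f x \<in> T}" using T(3) f(2)[of x y] by simp
  next
    fix c x assume "x \<in> {x \<in> carrier V. f x \<in> T}"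
    then show "c \<odot>\<^bsub>V\<^esub> x \<in> {x \<in> carrier V. f x \<in> T}"
      using T(4) f(3)[of x c] cvs_smult_closed[OF assms(1)] by simp
  qed blast
qed

lemma csub_zero:
  fixes V (structure)
  assumes "cvs V" shows "csub {\<zero>} V"
proof -
  interpret module complex_ring V by fact
  have "c \<odot> \<zero> = \<zero>" for c using smult_r_null[of c] by simp
  then show ?thesis by (intro csubI[OF assms]) auto
qed

lemma csub_ker: "cvs V \<Longrightarrow> cvs W \<Longrightarrow> linmap V W f \<Longrightarrow> csub (ker_of V W f) V"
  unfolding ker_of_def using csub_vimage[OF _ _ _ csub_zero, of V W f] by simp

lemma cvs_minus_add_cancel:
  assumes "cvs V" "x \<in> carrier V" "y \<in> carrier V" shows "(x \<ominus>\<^bsub>V\<^esub> y) \<oplus>\<^bsub>V\<^esub> y = x"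
proof -
  interpret module complex_ring V by fact
  show ?thesis using assms(2,3) by (simp add: a_minus_def M.a_assoc M.l_neg)
qed

lemma cvs_add_minus_cancel:
  assumes "cvs V" "x \<in> carrier V" "y \<in> carrier V" shows "(x \<oplus>\<^bsub>V\<^esub> y) \<ominus>\<^bsub>V\<^esub> y = x"
proof -
  interpret module complex_ring V by fact
  show ?thesis using assms(2,3) by (simp add: a_minus_def M.a_assoc M.r_neg)
qed

lemma cvs_minus_eq_zero:
  assumes "cvs V" "x \<in> carrier V" "y \<in> carrier V" "x \<ominus>\<^bsub>V\<^esub> y = \<zero>\<^bsub>V\<^esub>" shows "x = y"
proof -
  interpret module complex_ring V by fact
  show ?thesis using cvs_minus_add_cancel[OF assms(1-3)] assms by simp
qed

lemma cvs_minus_self: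
  assumes "cvs V" "x \<in> carrier V" shows "x \<ominus>\<^bsub>V\<^esub> x = \<zero>\<^bsub>V\<^esub>"
proof -
  interpret module complex_ring V by fact
  show ?thesis using assms(2) by (simp add: a_minus_def M.r_neg)
qed

lemma linmap_inj:
  fixes V (structure)
  assumes "cvs V" "cvs W" "linmap V W f" "S \<subseteq> carrier V"
    and S: "csub S V" "\<And>x. x \<in> S \<Longrightarrow> f x = \<zero>\<^bsub>W\<^esub> \<Longrightarrow> x = \<zero>"
  shows "inj_on f S"
proof (rule inj_onI)
  fix x y assume xy: "x \<in> S" "y \<in> S" "f x = f y"
  have c: "x \<in> carrier V" "y \<in> carrier V" using xy assms(4) by auto
  have "f (x \<ominus> y) = f y \<ominus>\<^bsub>W\<^esub> f y"
    by (subst linmap_minus[OF assms(1-3) c]) (simp only: xy)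
  also have "\<dots> = \<zero>\<^bsub>W\<^esub>" by (rule cvs_minus_self[OF assms(2) linmapD(1)[OF assms(3) c(2)]])
  finally have "x \<ominus> y = \<zero>" by (rule S(2)[OF csubD(6)[OF assms(1) S(1) xy(1,2)]])
  then show "x = y" by (rule cvs_minus_eq_zero[OF assms(1) c])
qed

section \<open>Isomorphisms and direct sums\<close>

lemma lin_isomorphicI:
  assumes "cvs V" "cvs W" "linmap V W f" "f ` carrier V = carrier W"
    "\<And>x. x \<in> carrier V \<Longrightarrow> f x = \<zero>\<^bsub>W\<^esub> \<Longrightarrow> x = \<zero>\<^bsub>V\<^esub>"
  shows "V \<cong>\<^sub>L W"
  unfolding lin_isomorphic_def bij_betw_def
  using assms(4) linmap_inj[OF assms(1-3) order_refl csub_carrier[OF assms(1)] assms(5)] linmapD[OF assms(3)] by blast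

lemma lin_isomorphic_iff:
  "V \<cong>\<^sub>L W \<longleftrightarrow> (\<exists>f. bij_betw f (carrier V) (carrier W) \<and> linmap V W f)"
  unfolding lin_isomorphic_def linmap_def by (auto dest: bij_betwE)

lemma lin_isomorphic_refl: "V \<cong>\<^sub>L V"
  unfolding lin_isomorphic_def by (rule exI[of _ id]) auto

lemma lin_isomorphic_trans:
  assumes "V \<cong>\<^sub>L W" "W \<cong>\<^sub>L U" shows "V \<cong>\<^sub>L U"
proof -
  obtain f g where f: "bij_betw f (carrier V) (carrier W)" "linmap V W f"
    and g: "bij_betw g (carrier W) (carrier U)" "linmap W U g"
    using assms unfolding lin_isomorphic_iff by auto
  have "bij_betw (\<lambda>x. g (f x)) (carrier V) (carrier U)" using bij_betw_trans[OF f(1) g(1)] by (simp add: o_def)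
  then show ?thesis using linmap_comp[OF f(2) g(2)] unfolding lin_isomorphic_iff by (intro exI conjI)
qed

lemma lin_isomorphic_sym:
  assumes V: "cvs V" and "V \<cong>\<^sub>L W" shows "W \<cong>\<^sub>L V"
proof -
  interpret V: module complex_ring V by fact
  obtain f where f: "bij_betw f (carrier V) (carrier W)" "linmap V W f"
    using assms(2) unfolding lin_isomorphic_iff by auto
  define g where "g = inv_into (carrier V) f"
  have gf: "g (f x) = x" if "x \<in> carrier V" for x
    using f(1) that by (simp add: g_def bij_betw_def)
  have W: "carrier W = f ` carrier V" using f(1) by (simp add: bij_betw_def)
  have "linmap W V g"
  proof (rule linmapI)
    fix x assume "x \<in> carrier W"
    then obtain a where a: "a \<in> carrier V" "x = f a" unfolding W by auto
    then show "g x \<in> carrier V" by (simp add: gf)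
    show "g (c \<odot>\<^bsub>W\<^esub> x) = c \<odot>\<^bsub>V\<^esub> g x" for c
      using a linmapD(3)[OF f(2) a(1), symmetric] by (simp add: gf)
    fix y assume "y \<in> carrier W"
    then obtain b where b: "b \<in> carrier V" "y = f b" unfolding W by auto
    then show "g (x \<oplus>\<^bsub>W\<^esub> y) = g x \<oplus>\<^bsub>V\<^esub> g y"
      using a linmapD(2)[OF f(2) a(1) b(1), symmetric] by (simp add: gf)
  qed
  then show ?thesis
    unfolding lin_isomorphic_iff using bij_betw_inv_into[OF f(1)] by (auto simp: g_def)
qed

lemma dsum_simps [simp]:
  "carrier (V \<boxplus> W) = carrier V \<times> carrier W" "\<zero>\<^bsub>V \<boxplus> W\<^esub> = (\<zero>\<^bsub>V\<^esub>, \<zero>\<^bsub>W\<^esub>)"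
  "(a, b) \<oplus>\<^bsub>V \<boxplus> W\<^esub> (a', b') = (a \<oplus>\<^bsub>V\<^esub> a', b \<oplus>\<^bsub>W\<^esub> b')"
  "c \<odot>\<^bsub>V \<boxplus> W\<^esub> (a, b) = (c \<odot>\<^bsub>V\<^esub> a, c \<odot>\<^bsub>W\<^esub> b)"
  by (simp_all add: dsum_def)

lemma lin_isomorphic_dsum:
  assumes "V \<cong>\<^sub>L V'" "W \<cong>\<^sub>L W'" shows "V \<boxplus> W \<cong>\<^sub>L V' \<boxplus> W'"
proof -
  obtain f g where f: "bij_betw f (carrier V) (carrier V')" "linmap V V' f"
    and g: "bij_betw g (carrier W) (carrier W')" "linmap W W' g"
    using assms unfolding lin_isomorphic_iff by auto
  have "linmap (V \<boxplus> W) (V' \<boxplus> W') (map_prod f g)"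
    using linmapD[OF f(2)] linmapD[OF g(2)] by (intro linmapI) auto
  then show ?thesis
    using bij_betw_map_prod[OF f(1) g(1)] unfolding lin_isomorphic_iff by auto
qed

lemma lin_isomorphic_dsum_assoc: "(V \<boxplus> W) \<boxplus> U \<cong>\<^sub>L V \<boxplus> W \<boxplus> U"
  unfolding lin_isomorphic_def
  by (rule exI[of _ "\<lambda>((a, b), c). (a, b, c)"]) (auto simp: bij_betw_def inj_on_def image_def)

lemma lin_isomorphic_internal_sum:
  fixes V (structure)
  assumes "cvs V" "csub S V" "csub T V" "S \<inter> T = {\<zero>}"
  shows "subsp V (S <+>\<^bsub>V\<^esub> T) \<cong>\<^sub>L subsp V S \<boxplus> subsp V T"
proof -
  interpret module complex_ring V by fact
  note S = csubD[OF assms(1,2)] and T = csubD[OF assms(1,3)]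
  have uniq: "s = s' \<and> t = t'" if "s \<in> S" "t \<in> T" "s' \<in> S" "t' \<in> T" "s \<oplus> t = s' \<oplus> t'" for s t s' t'
  proof -
    have c: "s \<in> carrier V" "t \<in> carrier V" "s' \<in> carrier V" "t' \<in> carrier V" using that S(1) T(1) by auto
    have "s \<ominus> s' = t' \<ominus> t"
    proof -
      have "s = (s' \<oplus> t') \<ominus> t" using cvs_add_minus_cancel[OF assms(1) c(1,2)] that(5) by metis
      also have "\<dots> = (t' \<ominus> t) \<oplus> s'" using c by (simp add: a_minus_def M.a_ac)
      finally show ?thesis
        using cvs_add_minus_cancel[OF assms(1) M.minus_closed[OF c(4,2)] c(3)] by metis
    qed
    moreover have "s \<ominus> s' \<in> S" "t' \<ominus> t \<in> T" using that S(6) T(6) by auto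
    ultimately have "s \<ominus> s' = \<zero>" "t' \<ominus> t = \<zero>" using assms(4) by auto
    then show ?thesis using cvs_minus_eq_zero[OF assms(1) c(1,3)] cvs_minus_eq_zero[OF assms(1) c(4,2)] by simp
  qed
  \<comment> \<open>By \<open>uniq\<close> the decomposition of x is unique, so h is its inverse
    reading.\<close>
  define h where "h x = (THE st. st \<in> S \<times> T \<and> x = fst st \<oplus> snd st)" for x
  have h: "h (s \<oplus> t) = (s, t)" if "s \<in> S" "t \<in> T" for s t
    unfolding h_def by (rule the_equality) (use uniq that in auto)
  have C: "S <+>\<^bsub>V\<^esub> T = (\<lambda>(s, t). s \<oplus> t) ` (S \<times> T)" unfolding set_add_def' by force
  show ?thesis
    unfolding lin_isomorphic_def
  proof (intro exI[of _ h] conjI ballI allI)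
    show "bij_betw h (carrier (subsp V (S <+>\<^bsub>V\<^esub> T))) (carrier (subsp V S \<boxplus> subsp V T))"
      by (rule bij_betw_byWitness[where f'="\<lambda>(s, t). s \<oplus> t"]) (auto simp: C h)
  next
    fix x y assume "x \<in> carrier (subsp V (S <+>\<^bsub>V\<^esub> T))" "y \<in> carrier (subsp V (S <+>\<^bsub>V\<^esub> T))"
    then obtain s t s' t' where *: "s \<in> S" "t \<in> T" "s' \<in> S" "t' \<in> T" "x = s \<oplus> t" "y = s' \<oplus> t'"
      by (auto simp: in_set_add)
    then have "x \<oplus> y = (s \<oplus> s') \<oplus> (t \<oplus> t')"
      using S(1) T(1) by (simp add: subset_iff M.a_ac)
    then show "h (x \<oplus>\<^bsub>subsp V (S <+>\<^bsub>V\<^esub> T)\<^esub> y) = h x \<oplus>\<^bsub>subsp V S \<boxplus> subsp V T\<^esub> h y"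
      using * S(3) T(3) by (simp add: h)
  next
    fix c x assume "x \<in> carrier (subsp V (S <+>\<^bsub>V\<^esub> T))"
    then obtain s t where *: "s \<in> S" "t \<in> T" "x = s \<oplus> t"
      by (auto simp: in_set_add)
    then have "c \<odot> x = c \<odot> s \<oplus> c \<odot> t"
      using S(1) T(1) by (simp add: subset_iff smult_r_distr)
    then show "h (c \<odot>\<^bsub>subsp V (S <+>\<^bsub>V\<^esub> T)\<^esub> x) = c \<odot>\<^bsub>subsp V S \<boxplus> subsp V T\<^esub> h x"
      using * S(4) T(4) by (simp add: h)
  qed
qed

section \<open>Quotient spaces and induced maps\<close>

lemma csub_abelian_subgroup:
  assumes "cvs V" "csub W V" shows "abelian_subgroup W V"
  using assms by (intro abelian_subgroupI3 additive_subgroupI cvs_abelian_group submodule.axioms)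

lemma quot_simps [simp]:
  "\<zero>\<^bsub>quot V W\<^esub> = W" "C \<oplus>\<^bsub>quot V W\<^esub> D = C <+>\<^bsub>V\<^esub> D"
  by (simp_all add: quot_def)

lemma carrier_quot: "carrier (quot V W) = (\<lambda>x. W +>\<^bsub>V\<^esub> x) ` carrier V"
  by (auto simp: quot_def A_RCOSETS_def')

lemma coset_eq_iff:
  fixes V (structure)
  assumes "cvs V" "csub W V" "x \<in> carrier V" "y \<in> carrier V"
  shows "W +> x = W +> y \<longleftrightarrow> x \<ominus> y \<in> W"
proof -
  interpret abelian_subgroup W V by (rule csub_abelian_subgroup[OF assms(1,2)])
  have "W +> x = W +> y \<longleftrightarrow> x \<in> W +> y"
    using a_repr_independence'[of x y] a_repr_independenceD[of x y] assms(3,4) by auto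
  then show ?thesis using a_rcos_module[OF assms(4,3)] by (simp add: a_minus_def)
qed

lemma coset_zero:
  assumes "cvs V" "csub W V" shows "W +>\<^bsub>V\<^esub> \<zero>\<^bsub>V\<^esub> = W"
proof -
  interpret abelian_subgroup W V by (rule csub_abelian_subgroup[OF assms(1,2)])
  show ?thesis using a_rcos_const[OF csubD(2)[OF assms]] .
qed

lemma cvs_minus_zero:
  assumes "cvs V" "x \<in> carrier V" shows "x \<ominus>\<^bsub>V\<^esub> \<zero>\<^bsub>V\<^esub> = x"
proof -
  interpret module complex_ring V by fact
  show ?thesis using assms(2) by (simp add: a_minus_def)
qed

lemma coset_eq_zero_iff:
  assumes "cvs V" "csub W V" "x \<in> carrier V"
  shows "W +>\<^bsub>V\<^esub> x = W \<longleftrightarrow> x \<in> W"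
  using coset_eq_iff[OF assms csubD(2)[OF assms(1,2), THEN subsetD[OF csubD(1)[OF assms(1,2)]]]]
  by (simp add: coset_zero[OF assms(1,2)] cvs_minus_zero[OF assms(1,3)])

lemma coset_add:
  fixes V (structure)
  assumes "cvs V" "csub W V" "x \<in> carrier V" "y \<in> carrier V"
  shows "(W +> x) <+>\<^bsub>V\<^esub> (W +> y) = W +> (x \<oplus> y)"
proof -
  interpret abelian_subgroup W V by (rule csub_abelian_subgroup[OF assms(1,2)])
  show ?thesis by (rule a_rcos_sum[OF assms(3,4)])
qed

lemma coset_mem:
  assumes "cvs V" "csub W V" "x \<in> carrier V" "y \<in> W +>\<^bsub>V\<^esub> x"
  shows "y \<in> carrier V" "y \<ominus>\<^bsub>V\<^esub> x \<in> W"
proof -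
  interpret abelian_subgroup W V by (rule csub_abelian_subgroup[OF assms(1,2)])
  show "y \<in> carrier V" using a_elemrcos_carrier[OF assms(3,4)] .
  show "y \<ominus>\<^bsub>V\<^esub> x \<in> W" using a_rcos_module_imp[OF assms(3,4)] by (simp add: a_minus_def)
qed

lemma coset_self:
  assumes "cvs V" "csub W V" "x \<in> carrier V" shows "x \<in> W +>\<^bsub>V\<^esub> x"
proof -
  interpret abelian_subgroup W V by (rule csub_abelian_subgroup[OF assms(1,2)])
  show ?thesis by (rule a_rcos_self[OF assms(3)])
qed

lemma class_map_coset:
  assumes V: "cvs V" "csub W V" and V': "cvs V'" "csub W' V'"
    and f: "linmap V V' f" "f ` W \<subseteq> W'" and x: "x \<in> carrier V"
  shows "class_map V' W' f (W +>\<^bsub>V\<^esub> x) = W' +>\<^bsub>V'\<^esub> f x"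
proof -
  have "W' +>\<^bsub>V'\<^esub> f y = W' +>\<^bsub>V'\<^esub> f x" if y: "y \<in> W +>\<^bsub>V\<^esub> x" for y
  proof -
    note y = coset_mem[OF V x y]
    have "f y \<ominus>\<^bsub>V'\<^esub> f x = f (y \<ominus>\<^bsub>V\<^esub> x)" using linmap_minus[OF V(1) V'(1) f(1) y(1) x] by simp
    also have "\<dots> \<in> W'" using y(2) f(2) by blast
    finally show ?thesis using coset_eq_iff[OF V'] linmapD(1)[OF f(1)] y(1) x by blast
  qed
  then show ?thesis unfolding class_map_def using coset_self[OF V x] by blast
qed

text \<open>Scalar multiplication of cosets is the \<open>class_map\<close> of multiplication by c,
  so its independence of representatives is a case of \<open>class_map_coset\<close>.\<close>

lemma smult_coset:
  fixes V (structure)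
  assumes V: "cvs V" "csub W V" and x: "x \<in> carrier V"
  shows "c \<odot>\<^bsub>quot V W\<^esub> (W +> x) = W +> (c \<odot> x)"
proof -
  interpret module complex_ring V by fact
  have "linmap V V (\<lambda>x. c \<odot> x)"
  proof (rule linmapI)
    fix d x assume "x \<in> carrier V"
    then show "c \<odot> (d \<odot> x) = d \<odot> (c \<odot> x)"
      using smult_assoc1[of c d x] smult_assoc1[of d c x] by (simp add: mult.commute)
  qed (auto simp: smult_r_distr)
  from class_map_coset[OF V V this _ x] show ?thesis
    using csubD(4)[OF V] by (auto simp: quot_def class_map_def)
qed

lemma cvs_quot:
  fixes V (structure)
  assumes V: "cvs V" "csub W V"
  shows "cvs (quot V W)"
proof -
  let ?Q = "quot V W"
  interpret module complex_ring V by fact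
  note q = coset_add[OF V] smult_coset[OF V]
  have elim: "\<exists>x\<in>carrier V. C = W +> x" if "C \<in> carrier ?Q" for C
    using that by (auto simp: carrier_quot)
  have cl: "W +> x \<in> carrier ?Q" if "x \<in> carrier V" for x
    using that by (auto simp: carrier_quot)
  show ?thesis
  proof (rule moduleI[OF cring_complex_ring])
    show "abelian_group ?Q"
    proof (rule abelian_groupI)
      fix C assume "C \<in> carrier ?Q"
      then obtain x where x: "x \<in> carrier V" "C = W +> x" using elim by blast
      then show "\<zero>\<^bsub>?Q\<^esub> \<oplus>\<^bsub>?Q\<^esub> C = C"
        using coset_add[OF V, of "\<zero>" x] by (simp add: coset_zero[OF V])
      have "(W +> (\<ominus> x)) \<oplus>\<^bsub>?Q\<^esub> C = \<zero>\<^bsub>?Q\<^esub>"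
        using x coset_add[OF V, of "\<ominus> x" x] by (simp add: coset_zero[OF V] M.l_neg)
      then show "\<exists>D\<in>carrier ?Q. D \<oplus>\<^bsub>?Q\<^esub> C = \<zero>\<^bsub>?Q\<^esub>"
        using cl x by blast
      fix D assume "D \<in> carrier ?Q"
      then obtain y where y: "y \<in> carrier V" "D = W +> y" using elim by blast
      then show "C \<oplus>\<^bsub>?Q\<^esub> D \<in> carrier ?Q" using x by (simp add: q cl)
      show "C \<oplus>\<^bsub>?Q\<^esub> D = D \<oplus>\<^bsub>?Q\<^esub> C" using x y by (simp add: q M.a_comm)
      fix E assume "E \<in> carrier ?Q"
      then obtain z where z: "z \<in> carrier V" "E = W +> z" using elim by blast
      then show "C \<oplus>\<^bsub>?Q\<^esub> D \<oplus>\<^bsub>?Q\<^esub> E = C \<oplus>\<^bsub>?Q\<^esub> (D \<oplus>\<^bsub>?Q\<^esub> E)"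
        using x y by (simp add: q M.a_assoc)
    next
      show "\<zero>\<^bsub>?Q\<^esub> \<in> carrier ?Q" using cl[of "\<zero>"] by (simp add: coset_zero[OF V])
    qed
  next
    fix a b C assume "C \<in> carrier ?Q"
    then obtain x where x: "x \<in> carrier V" "C = W +> x" using elim by blast
    have cx: "c \<odot> x \<in> carrier V" for c using cvs_smult_closed[OF V(1) x(1)] .
    show "a \<odot>\<^bsub>?Q\<^esub> C \<in> carrier ?Q" using x cx by (simp add: q cl)
    show "(a \<oplus>\<^bsub>complex_ring\<^esub> b) \<odot>\<^bsub>?Q\<^esub> C = a \<odot>\<^bsub>?Q\<^esub> C \<oplus>\<^bsub>?Q\<^esub> b \<odot>\<^bsub>?Q\<^esub> C"
      using x cx smult_l_distr[of a b x] by (simp add: q)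
    show "(a \<otimes>\<^bsub>complex_ring\<^esub> b) \<odot>\<^bsub>?Q\<^esub> C = a \<odot>\<^bsub>?Q\<^esub> (b \<odot>\<^bsub>?Q\<^esub> C)"
      using x cx smult_assoc1[of a b x] by (simp add: q)
    show "\<one>\<^bsub>complex_ring\<^esub> \<odot>\<^bsub>?Q\<^esub> C = C"
      using x smult_one[of x] by (simp add: q)
    fix D assume "D \<in> carrier ?Q"
    then obtain y where y: "y \<in> carrier V" "D = W +> y" using elim by blast
    have cy: "c \<odot> y \<in> carrier V" for c using cvs_smult_closed[OF V(1) y(1)] .
    show "a \<odot>\<^bsub>?Q\<^esub> (C \<oplus>\<^bsub>?Q\<^esub> D) = a \<odot>\<^bsub>?Q\<^esub> C \<oplus>\<^bsub>?Q\<^esub> a \<odot>\<^bsub>?Q\<^esub> D"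
      using x y cx cy smult_r_distr[of a x y] by (simp add: q)
  qed
qed

lemma linmap_class_map:
  assumes V: "cvs V" "csub W V" and V': "cvs V'" "csub W' V'"
    and f: "linmap V V' f" "f ` W \<subseteq> W'"
  shows "linmap (quot V W) (quot V' W') (class_map V' W' f)"
proof (rule linmapI)
  interpret module complex_ring V by fact
  note c = class_map_coset[OF V V' f] and fc = linmapD[OF f(1)]
  {
    fix C assume "C \<in> carrier (quot V W)"
    then obtain x where x: "x \<in> carrier V" "C = W +>\<^bsub>V\<^esub> x" by (auto simp: carrier_quot)
    then show "class_map V' W' f C \<in> carrier (quot V' W')"
      using fc(1) by (simp add: c carrier_quot)
    have cx: "r \<odot>\<^bsub>V\<^esub> x \<in> carrier V" for r using cvs_smult_closed[OF V(1) x(1)] .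
    show "class_map V' W' f (r \<odot>\<^bsub>quot V W\<^esub> C) = r \<odot>\<^bsub>quot V' W'\<^esub> class_map V' W' f C" for r
      using x cx fc by (simp add: c smult_coset[OF V] smult_coset[OF V'])
    fix D assume "D \<in> carrier (quot V W)"
    then obtain y where y: "y \<in> carrier V" "D = W +>\<^bsub>V\<^esub> y" by (auto simp: carrier_quot)
    then show "class_map V' W' f (C \<oplus>\<^bsub>quot V W\<^esub> D) = class_map V' W' f C \<oplus>\<^bsub>quot V' W'\<^esub> class_map V' W' f D"
      using x fc by (simp add: c coset_add[OF V] coset_add[OF V'])
  }
qed

lemma first_isomorphism:
  fixes V (structure)
  assumes V: "cvs V" "cvs V'" and f: "linmap V V' f"
  shows "quot V (ker_of V V' f) \<cong>\<^sub>L subsp V' (f ` carrier V)"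
proof -
  let ?K = "ker_of V V' f"
  have K: "csub ?K V" by (rule csub_ker[OF V f])
  have I: "csub (f ` carrier V) V'" by (rule csub_image[OF V f csub_carrier[OF V(1)]])
  note fc = linmapD[OF f]
  have eq: "f x = f y" if "x \<in> carrier V" "y \<in> carrier V" "?K +> x = ?K +> y" for x y
  proof -
    have "x \<ominus> y \<in> ?K" using coset_eq_iff[OF V(1) K that(1,2)] that(3) by blast
    then have "f x \<ominus>\<^bsub>V'\<^esub> f y = \<zero>\<^bsub>V'\<^esub>"
      using linmap_minus[OF V f that(1,2)] by (simp add: ker_of_def)
    then show ?thesis by (rule cvs_minus_eq_zero[OF V(2) fc(1)[OF that(1)] fc(1)[OF that(2)]])
  qed
  \<comment> \<open>The representative is arbitrary; by \<open>eq\<close> the value of f does not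
    depend on it.\<close>
  define h where "h C = f (SOME x. x \<in> carrier V \<and> C = ?K +> x)" for C
  have h: "h (?K +> x) = f x" if "x \<in> carrier V" for x
  proof -
    let ?y = "SOME y. y \<in> carrier V \<and> ?K +> x = ?K +> y"
    have "?y \<in> carrier V \<and> ?K +> x = ?K +> ?y" by (rule someI[of _ x]) (simp add: that)
    then show ?thesis unfolding h_def using eq[OF that, of ?y] by metis
  qed
  show ?thesis
  proof (rule lin_isomorphicI[where f=h])
    show "cvs (quot V ?K)" "cvs (subsp V' (f ` carrier V))"
      by (rule cvs_quot[OF V(1) K], rule cvs_subsp[OF V(2) I])
    show "linmap (quot V ?K) (subsp V' (f ` carrier V)) h"
    proof (rule linmapI)
      interpret module complex_ring V by fact
      fix C assume "C \<in> carrier (quot V ?K)"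
      then obtain x where x: "x \<in> carrier V" "C = ?K +> x" by (auto simp: carrier_quot)
      then show "h C \<in> carrier (subsp V' (f ` carrier V))" by (simp add: h)
      have cx: "r \<odot> x \<in> carrier V" for r using cvs_smult_closed[OF V(1) x(1)] .
      show "h (r \<odot>\<^bsub>quot V ?K\<^esub> C) = r \<odot>\<^bsub>subsp V' (f ` carrier V)\<^esub> h C" for r
        using x cx fc by (simp add: h smult_coset[OF V(1) K])
      fix D assume "D \<in> carrier (quot V ?K)"
      then obtain y where y: "y \<in> carrier V" "D = ?K +> y" by (auto simp: carrier_quot)
      then show "h (C \<oplus>\<^bsub>quot V ?K\<^esub> D) = h C \<oplus>\<^bsub>subsp V' (f ` carrier V)\<^esub> h D"
        using x fc by (simp add: h coset_add[OF V(1) K])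
    qed
    show "h ` carrier (quot V ?K) = carrier (subsp V' (f ` carrier V))"
      by (simp add: carrier_quot image_image h)
    fix C assume "C \<in> carrier (quot V ?K)" and 0: "h C = \<zero>\<^bsub>subsp V' (f ` carrier V)\<^esub>"
    then obtain x where x: "x \<in> carrier V" "C = ?K +> x" by (auto simp: carrier_quot)
    then have "f x = \<zero>\<^bsub>V'\<^esub>" using 0 by (simp add: h)
    then have "x \<in> ?K" using x(1) by (simp add: ker_of_def)
    then show "C = \<zero>\<^bsub>quot V ?K\<^esub>" using coset_eq_zero_iff[OF V(1) K x(1)] x(2) by simp
  qed
qed

section \<open>Complements of subspaces\<close>

text \<open>Supplies the upper bounds for Zorn's lemma: two elements of the union lie together in
  the larger of two members of the chain.\<close>

lemma csub_Union_chain: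
  assumes V: "cvs V" and ne: "\<C> \<noteq> {}" and sub: "\<And>L. L \<in> \<C> \<Longrightarrow> csub L V"
    and lin: "\<And>L L'. L \<in> \<C> \<Longrightarrow> L' \<in> \<C> \<Longrightarrow> L \<subseteq> L' \<or> L' \<subseteq> L"
  shows "csub (\<Union>\<C>) V"
proof (rule csubI[OF V])
  note d = csubD[OF V sub]
  show "\<Union>\<C> \<subseteq> carrier V" using d(1) by (rule Union_least)
  show "\<zero>\<^bsub>V\<^esub> \<in> \<Union>\<C>" using d(2) ne by auto
next
  fix x y assume "x \<in> \<Union>\<C>" "y \<in> \<Union>\<C>"
  then obtain L L' where L: "L \<in> \<C>" "L' \<in> \<C>" "x \<in> L" "y \<in> L'" by auto
  show "x \<oplus>\<^bsub>V\<^esub> y \<in> \<Union>\<C>"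
  proof (cases "L \<subseteq> L'")
    case True
    then show ?thesis using csubD(3)[OF V sub[OF L(2)], of x y] L by (intro UnionI[OF L(2)]) auto
  next
    case False
    then have "L' \<subseteq> L" using lin L by metis
    then show ?thesis using csubD(3)[OF V sub[OF L(1)], of x y] L by (intro UnionI[OF L(1)]) auto
  qed
next
  fix c x assume "x \<in> \<Union>\<C>"
  then obtain L where L: "L \<in> \<C>" "x \<in> L" by auto
  then show "c \<odot>\<^bsub>V\<^esub> x \<in> \<Union>\<C>" using csubD(4)[OF V sub[OF L(1)] L(2)] by (intro UnionI[OF L(1)])
qed

lemma csub_line:
  fixes V (structure)
  assumes V: "cvs V" and x: "x \<in> carrier V"
  shows "csub (range (\<lambda>c. c \<odot> x)) V" (is "csub ?S V")
proof (rule csubI[OF V])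
  interpret module complex_ring V by fact
  show "?S \<subseteq> carrier V" using cvs_smult_closed[OF V x] by (rule image_subsetI)
  show "\<zero> \<in> ?S" using smult_l_null[OF x] by (intro range_eqI[of _ _ 0]) simp
  fix a assume "a \<in> ?S"
  then obtain c where a: "a = c \<odot> x" by auto
  have "r \<odot> a = (r * c) \<odot> x" for r using smult_assoc1[of r c x] x a by simp
  then show "r \<odot> a \<in> ?S" for r by (rule range_eqI)
  fix b assume "b \<in> ?S"
  then obtain c' where b: "b = c' \<odot> x" by auto
  have "a \<oplus> b = (c + c') \<odot> x" using smult_l_distr[of c c' x] x a b by simp
  then show "a \<oplus> b \<in> ?S" by (rule range_eqI)
qed

text \<open>An element l + c x of W with c nonzero could be solved for x, which would put x into the
  sum of L and W. This is the step that enlarges a subspace which is not yet a complement.\<close>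

lemma set_add_line_meets_trivially:
  fixes V (structure)
  assumes V: "cvs V" and W: "csub W V" and L: "csub L V" "L \<inter> W = {\<zero>}"
    and x: "x \<in> carrier V" "x \<notin> L <+>\<^bsub>V\<^esub> W"
  shows "(L <+>\<^bsub>V\<^esub> range (\<lambda>c. c \<odot> x)) \<inter> W = {\<zero>}" (is "?X \<inter> W = _")
proof
  interpret module complex_ring V by fact
  note Wd = csubD[OF V W] and Ld = csubD[OF V L(1)]
  show "{\<zero>} \<subseteq> ?X \<inter> W"
    using csubD(2)[OF V csub_set_add[OF V L(1) csub_line[OF V x(1)]]] Wd(2) by simp
  show "?X \<inter> W \<subseteq> {\<zero>}"
  proof
    fix w assume w: "w \<in> ?X \<inter> W"
    then obtain l c where l: "l \<in> L" "w = l \<oplus> c \<odot> x" by (auto simp: in_set_add)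
    have lc: "l \<in> carrier V" "w \<in> carrier V" using l(1) w Ld(1) Wd(1) by auto
    have cx: "c \<odot> x \<in> carrier V" by (rule cvs_smult_closed[OF V x(1)])
    have cxe: "c \<odot> x = \<ominus> l \<oplus> w" unfolding l(2) using M.r_neg1[OF lc(1) cx] by simp
    have "c = 0"
    proof (rule ccontr)
      assume c: "c \<noteq> 0"
      have "x = inverse c \<odot> (c \<odot> x)"
        using smult_assoc1[of "inverse c" c x] smult_one[OF x(1)] x(1) c by simp
      also have "\<dots> = inverse c \<odot> (\<ominus> l) \<oplus> inverse c \<odot> w"
        unfolding cxe using smult_r_distr[of "inverse c" "\<ominus> l" w] lc by simp
      finally have "x = inverse c \<odot> (\<ominus> l) \<oplus> inverse c \<odot> w" .
      moreover have "inverse c \<odot> w \<in> W" using w by (intro Wd(4)) simp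
      ultimately have "x \<in> L <+>\<^bsub>V\<^esub> W" unfolding in_set_add
        using Ld(4)[OF Ld(5)[OF l(1)]] by (intro bexI)
      then show False using x(2) by simp
    qed
    then have "w = l" using l(2) smult_l_null[OF x(1)] M.r_zero[OF lc(1)] by simp
    then have "w \<in> L \<inter> W" using l(1) w by simp
    then show "w \<in> {\<zero>}" by (simp only: L(2))
  qed
qed

text \<open>A subspace that is maximal among those meeting \<open>W\<close> trivially is a complement of \<open>W\<close>.\<close>

lemma complement_exists:
  fixes V (structure)
  assumes V: "cvs V" and W: "csub W V"
  shows "\<exists>L. complement_in V (carrier V) W L"
proof -
  define \<A> where "\<A> = {L. csub L V \<and> L \<inter> W = {\<zero>}}"
  note Wd = csubD[OF V W]
  have "\<exists>M\<in>\<A>. \<forall>X\<in>\<A>. M \<subseteq> X \<longrightarrow> X = M"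
  proof (rule subset_Zorn_nonempty)
    have "{\<zero>} \<in> \<A>" using csub_zero[OF V] Wd(2) by (simp add: \<A>_def)
    then show "\<A> \<noteq> {}" by auto
  next
    fix \<C> assume \<C>: "\<C> \<noteq> {}" "subset.chain \<A> \<C>"
    then have sub: "\<And>L. L \<in> \<C> \<Longrightarrow> csub L V" "\<And>L. L \<in> \<C> \<Longrightarrow> L \<inter> W = {\<zero>}"
      unfolding subset_chain_def \<A>_def by auto
    have lin: "\<And>L L'. L \<in> \<C> \<Longrightarrow> L' \<in> \<C> \<Longrightarrow> L \<subseteq> L' \<or> L' \<subseteq> L"
      using \<C>(2) unfolding subset_chain_def by auto
    have U: "csub (\<Union>\<C>) V" by (rule csub_Union_chain[OF V \<C>(1) sub(1) lin])
    have "\<Union>\<C> \<inter> W = {\<zero>}"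
    proof
      show "\<Union>\<C> \<inter> W \<subseteq> {\<zero>}"
      proof
        fix x assume "x \<in> \<Union>\<C> \<inter> W"
        then obtain L where "L \<in> \<C>" "x \<in> L \<inter> W" by auto
        then show "x \<in> {\<zero>}" by (simp only: sub(2))
      qed
      show "{\<zero>} \<subseteq> \<Union>\<C> \<inter> W" using csubD(2)[OF V U] Wd(2) by simp
    qed
    then show "\<Union>\<C> \<in> \<A>" using U by (simp add: \<A>_def)
  qed
  then obtain L where "L \<in> \<A>" and max: "\<forall>X\<in>\<A>. L \<subseteq> X \<longrightarrow> X = L" by auto
  then have L: "csub L V" "L \<inter> W = {\<zero>}" by (simp_all add: \<A>_def)
  have "x \<in> L <+>\<^bsub>V\<^esub> W" if x: "x \<in> carrier V" for x
  proof (rule ccontr)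
    assume nx: "x \<notin> L <+>\<^bsub>V\<^esub> W"
    let ?S = "range (\<lambda>c. c \<odot> x)"
    note S = csub_line[OF V x]
    have "L <+>\<^bsub>V\<^esub> ?S \<in> \<A>"
      using csub_set_add[OF V L(1) S] set_add_line_meets_trivially[OF V W L x nx] by (simp add: \<A>_def)
    then have "L <+>\<^bsub>V\<^esub> ?S = L" using max csub_le_set_add(1)[OF V L(1) S] by simp
    moreover have "x \<in> ?S" using module.smult_one[OF V x] by (intro range_eqI[of _ _ 1]) simp
    ultimately have "x \<in> L" using csub_le_set_add(2)[OF V L(1) S] by auto
    then show False using nx csub_le_set_add(1)[OF V L(1) W] by auto
  qed
  then have "L <+>\<^bsub>V\<^esub> W = carrier V"
    using csubD(1)[OF V csub_set_add[OF V L(1) W]] by auto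
  then show ?thesis unfolding complement_in_def using L by (intro exI[of _ L] conjI)
qed

lemma lin_isomorphic_complement:
  fixes V (structure)
  assumes V: "cvs V" and W: "csub W V" and L: "complement_in V U W L"
  shows "subsp V U \<cong>\<^sub>L subsp V W \<boxplus> subsp V L"
proof -
  have l: "csub L V" "L \<inter> W = {\<zero>}" "L <+>\<^bsub>V\<^esub> W = U" using L by (auto simp: complement_in_def)
  have "W <+>\<^bsub>V\<^esub> L = U"
    using set_add_comm[OF V csubD(1)[OF V W] csubD(1)[OF V l(1)]] l(3) by simp
  moreover have "W \<inter> L = {\<zero>}" using l(2) by blast
  ultimately show ?thesis using lin_isomorphic_internal_sum[OF V W l(1)] by simp
qed

text \<open>The surjection splits: r maps any complement of its kernel bijectively onto K.\<close>

lemma lin_isomorphic_ker_dsum: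
  fixes V (structure)
  assumes V: "cvs V" "cvs K" and r: "linmap V K r" "r ` carrier V = carrier K"
  shows "V \<cong>\<^sub>L subsp V (ker_of V K r) \<boxplus> K"
proof -
  let ?N = "ker_of V K r"
  have N: "csub ?N V" by (rule csub_ker[OF V r(1)])
  obtain L where L: "complement_in V (carrier V) ?N L" using complement_exists[OF V(1) N] by blast
  then have l: "csub L V" "L \<inter> ?N = {\<zero>}" "L <+>\<^bsub>V\<^esub> ?N = carrier V" by (auto simp: complement_in_def)
  have lc: "L \<subseteq> carrier V" by (rule csubD(1)[OF V(1) l(1)])
  have "r ` L = carrier K"
  proof
    show "r ` L \<subseteq> carrier K" using linmapD(1)[OF r(1)] lc by blast
    show "carrier K \<subseteq> r ` L"
    proof
      fix y assume "y \<in> carrier K"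
      then obtain x where x: "x \<in> carrier V" "y = r x" using r(2) by blast
      then have "x \<in> L <+>\<^bsub>V\<^esub> ?N" using l(3) by simp
      then obtain a n where a: "a \<in> L" "n \<in> ?N" "x = a \<oplus> n" unfolding in_set_add by blast
      interpret K: module complex_ring K by fact
      have "r x = r a \<oplus>\<^bsub>K\<^esub> r n" using a lc linmapD(2)[OF r(1)] by (auto simp: ker_of_def)
      then have "r x = r a" using a lc linmapD(1)[OF r(1)] by (auto simp: ker_of_def)
      then show "y \<in> r ` L" using a x by blast
    qed
  qed
  then have "subsp V L \<cong>\<^sub>L K"
    using l lc linmap_restrict[OF r(1) lc, of "carrier K"]
    by (intro lin_isomorphicI[where f=r] cvs_subsp V) (auto simp: subsp_carrier ker_of_def)
  from lin_isomorphic_dsum[OF lin_isomorphic_refl this]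
  show ?thesis
    using lin_isomorphic_trans[OF lin_isomorphic_complement[OF V(1) N L, unfolded subsp_carrier]] by blast
qed

section \<open>Decompositions from images and kernels\<close>

lemma linmap_image_set_add:
  assumes V: "cvs V" "cvs W" and f: "linmap V W f" and S: "csub S V" "csub T V"
  shows "f ` (S <+>\<^bsub>V\<^esub> T) = f ` S <+>\<^bsub>W\<^esub> f ` T"
proof -
  have "f (s \<oplus>\<^bsub>V\<^esub> t) = f s \<oplus>\<^bsub>W\<^esub> f t" if "s \<in> S" "t \<in> T" for s t
    using linmapD(2)[OF f] csubD(1)[OF V(1) S(1)] csubD(1)[OF V(1) S(2)] that by auto
  then show ?thesis by (force simp: set_add_def')
qed

lemma set_add_zero:
  fixes V (structure)
  assumes "cvs V" "csub S V" shows "S <+>\<^bsub>V\<^esub> {\<zero>} = S"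
proof -
  interpret module complex_ring V by fact
  have "s \<oplus> \<zero> = s" if "s \<in> S" for s using csubD(1)[OF assms] that by auto
  then show ?thesis by (force simp: set_add_def')
qed

lemma image_ker_subset:
  assumes V: "cvs V" "cvs W" and f: "linmap V W f" and S: "csub S V" "S \<subseteq> ker_of V W f"
  shows "f ` S = {\<zero>\<^bsub>W\<^esub>}"
  using csubD(2)[OF V(1) S(1)] S(2) by (auto simp: ker_of_def subset_iff intro: image_eqI[OF sym])

text \<open>The summand P is killed by f, so only G contributes to the image.\<close>

lemma image_complement_ker:
  assumes V: "cvs V" "cvs W" and f: "linmap V W f" and P: "csub P V" "P \<subseteq> ker_of V W f"
    and G: "complement_in V U P G"
  shows "f ` U = f ` G"
proof -
  have g: "csub G V" "G <+>\<^bsub>V\<^esub> P = U" using G by (auto simp: complement_in_def)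
  have "f ` U = f ` G <+>\<^bsub>W\<^esub> f ` P" using linmap_image_set_add[OF V f g(1) P(1)] g(2) by simp
  then show ?thesis
    using image_ker_subset[OF V f P] set_add_zero[OF V(2) csub_image[OF V f g(1)]] by simp
qed

text \<open>The model is B = H_BC, with r the map to K and f1, f2 the two maps from Aeppli classes.
  As \<G>2 is the preimage of the image of f1, its complement L2 accounts for exactly what f2 adds
  to that image.\<close>

lemma sum_of_images_decomposition:
  assumes cv: "cvs H1" "cvs H2" "cvs B" "cvs K"
    and lf1: "linmap H1 B f1" and lf2: "linmap H2 B f2" and r: "linmap B K r" "r ` carrier B = carrier K"
    and ker_r: "ker_of B K r = f1 ` carrier H1 <+>\<^bsub>B\<^esub> f2 ` carrier H2"
    and GG2: "\<G>2 = {x \<in> carrier H2. f2 x \<in> f1 ` carrier H1}"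
    and GG1: "csub \<G>1 H1"
    and cG1: "complement_in H1 \<G>1 (ker_of H1 B f1) G1"
    and cL1: "complement_in H1 (carrier H1) \<G>1 L1"
    and cL2: "complement_in H2 (carrier H2) \<G>2 L2"
  shows "B \<cong>\<^sub>L subsp B (f1 ` G1) \<boxplus> subsp B (f1 ` L1) \<boxplus> subsp B (f2 ` L2) \<boxplus> K"
proof -
  have g1: "csub G1 H1" "G1 <+>\<^bsub>H1\<^esub> ker_of H1 B f1 = \<G>1"
    and l1: "csub L1 H1" "L1 \<inter> \<G>1 = {\<zero>\<^bsub>H1\<^esub>}" "L1 <+>\<^bsub>H1\<^esub> \<G>1 = carrier H1"
    and l2: "csub L2 H2" "L2 \<inter> \<G>2 = {\<zero>\<^bsub>H2\<^esub>}" "L2 <+>\<^bsub>H2\<^esub> \<G>2 = carrier H2"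
    using cG1 cL1 cL2 by (auto simp: complement_in_def)
  have kf: "csub (ker_of H1 B f1) H1" by (rule csub_ker[OF cv(1,3) lf1])
  note im1 = csub_image[OF cv(1,3) lf1] and im2 = csub_image[OF cv(2,3) lf2]
  have F1: "csub (f1 ` carrier H1) B" by (rule im1[OF csub_carrier[OF cv(1)]])
  have z1: "f1 \<zero>\<^bsub>H1\<^esub> = \<zero>\<^bsub>B\<^esub>" by (rule linmap_zero[OF cv(1,3) lf1])
  have z2: "f2 \<zero>\<^bsub>H2\<^esub> = \<zero>\<^bsub>B\<^esub>" by (rule linmap_zero[OF cv(2,3) lf2])
  have G1sub: "G1 \<subseteq> \<G>1" "ker_of H1 B f1 \<subseteq> \<G>1"
    using csub_le_set_add[OF cv(1) g1(1) kf] g1(2) by auto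
  have s1: "f1 ` carrier H1 = f1 ` G1 <+>\<^bsub>B\<^esub> f1 ` L1"
  proof -
    have "f1 ` carrier H1 = f1 ` L1 <+>\<^bsub>B\<^esub> f1 ` \<G>1"
      using linmap_image_set_add[OF cv(1,3) lf1 l1(1) GG1] l1(3) by simp
    also have "f1 ` \<G>1 = f1 ` G1" by (rule image_complement_ker[OF cv(1,3) lf1 kf order_refl cG1])
    also have "f1 ` L1 <+>\<^bsub>B\<^esub> f1 ` G1 = f1 ` G1 <+>\<^bsub>B\<^esub> f1 ` L1"
      by (rule set_add_comm[OF cv(3) csubD(1)[OF cv(3) im1[OF l1(1)]] csubD(1)[OF cv(3) im1[OF g1(1)]]])
    finally show ?thesis .
  qed
  \<comment> \<open>If f1 g = f1 l, then l - g lies in the kernel and hence in \<G>1, which also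
    contains g. So l lies in both L1 and \<G>1, and is zero.\<close>
  have i1: "f1 ` G1 \<inter> f1 ` L1 = {\<zero>\<^bsub>B\<^esub>}"
  proof
    show "{\<zero>\<^bsub>B\<^esub>} \<subseteq> f1 ` G1 \<inter> f1 ` L1"
      using csubD(2)[OF cv(3) im1[OF g1(1)]] csubD(2)[OF cv(3) im1[OF l1(1)]] by simp
    show "f1 ` G1 \<inter> f1 ` L1 \<subseteq> {\<zero>\<^bsub>B\<^esub>}"
    proof
      fix b assume "b \<in> f1 ` G1 \<inter> f1 ` L1"
      then obtain g l where gl: "g \<in> G1" "l \<in> L1" "b = f1 g" "b = f1 l" by auto
      have c: "l \<in> carrier H1" "g \<in> carrier H1"
        using csubD(1)[OF cv(1) l1(1)] csubD(1)[OF cv(1) g1(1)] gl by auto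
      have "f1 (l \<ominus>\<^bsub>H1\<^esub> g) = f1 g \<ominus>\<^bsub>B\<^esub> f1 g"
        using linmap_minus[OF cv(1,3) lf1 c] gl(3,4) by simp
      also have "\<dots> = \<zero>\<^bsub>B\<^esub>" by (rule cvs_minus_self[OF cv(3) linmapD(1)[OF lf1 c(2)]])
      finally have "l \<ominus>\<^bsub>H1\<^esub> g \<in> ker_of H1 B f1"
        using csubD(6)[OF cv(1) csub_carrier[OF cv(1)] c] by (simp add: ker_of_def)
      then have "(l \<ominus>\<^bsub>H1\<^esub> g) \<oplus>\<^bsub>H1\<^esub> g \<in> \<G>1"
        using csubD(3)[OF cv(1) GG1] G1sub gl(1) by auto
      then have "l \<in> L1 \<inter> \<G>1" using gl(2) cvs_minus_add_cancel[OF cv(1) c] by simp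
      then have "l = \<zero>\<^bsub>H1\<^esub>" by (simp only: l1(2) singleton_iff)
      then show "b \<in> {\<zero>\<^bsub>B\<^esub>}" using gl(4) z1 by simp
    qed
  qed
  have i2: "f1 ` carrier H1 \<inter> f2 ` L2 = {\<zero>\<^bsub>B\<^esub>}"
  proof
    show "{\<zero>\<^bsub>B\<^esub>} \<subseteq> f1 ` carrier H1 \<inter> f2 ` L2"
      using csubD(2)[OF cv(3) F1] csubD(2)[OF cv(3) im2[OF l2(1)]] by simp
    show "f1 ` carrier H1 \<inter> f2 ` L2 \<subseteq> {\<zero>\<^bsub>B\<^esub>}"
    proof
      fix b assume b: "b \<in> f1 ` carrier H1 \<inter> f2 ` L2"
      then obtain l where l: "l \<in> L2" "b = f2 l" by auto
      then have "l \<in> L2 \<inter> \<G>2" using b csubD(1)[OF cv(2) l2(1)] by (auto simp: GG2)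
      then have "l = \<zero>\<^bsub>H2\<^esub>" by (simp only: l2(2) singleton_iff)
      then show "b \<in> {\<zero>\<^bsub>B\<^esub>}" using l(2) z2 by simp
    qed
  qed
  have GG2sub: "csub \<G>2 H2" unfolding GG2 by (rule csub_vimage[OF cv(2,3) lf2 F1])
  \<comment> \<open>When y is split as l + g with g in \<G>2, the element f2 g already lies in the
    image of f1 and is absorbed there.\<close>
  have s2: "f1 ` carrier H1 <+>\<^bsub>B\<^esub> f2 ` carrier H2 = f1 ` carrier H1 <+>\<^bsub>B\<^esub> f2 ` L2"
  proof
    interpret B: module complex_ring B by fact
    show "f1 ` carrier H1 <+>\<^bsub>B\<^esub> f2 ` L2 \<subseteq> f1 ` carrier H1 <+>\<^bsub>B\<^esub> f2 ` carrier H2"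
      using csubD(1)[OF cv(2) l2(1)] by (auto simp: set_add_def')
    show "f1 ` carrier H1 <+>\<^bsub>B\<^esub> f2 ` carrier H2 \<subseteq> f1 ` carrier H1 <+>\<^bsub>B\<^esub> f2 ` L2"
    proof
      fix b assume "b \<in> f1 ` carrier H1 <+>\<^bsub>B\<^esub> f2 ` carrier H2"
      then obtain a y where a: "a \<in> f1 ` carrier H1" "y \<in> carrier H2" "b = a \<oplus>\<^bsub>B\<^esub> f2 y"
        by (auto simp: in_set_add)
      then have "y \<in> L2 <+>\<^bsub>H2\<^esub> \<G>2" using l2(3) by simp
      then obtain l g where l: "l \<in> L2" "g \<in> \<G>2" "y = l \<oplus>\<^bsub>H2\<^esub> g" unfolding in_set_add by auto
      have lc: "l \<in> carrier H2" "g \<in> carrier H2" "f2 g \<in> f1 ` carrier H1"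
        using l csubD(1)[OF cv(2) l2(1)] by (auto simp: GG2)
      have c: "a \<in> carrier B" "f2 l \<in> carrier B" "f2 g \<in> carrier B"
        using a(1) lc csubD(1)[OF cv(3) F1] linmapD(1)[OF lf2] by auto
      have "b = (a \<oplus>\<^bsub>B\<^esub> f2 g) \<oplus>\<^bsub>B\<^esub> f2 l"
        using a(3) l(3) linmapD(2)[OF lf2 lc(1,2)] c by (simp add: B.M.a_ac)
      then show "b \<in> f1 ` carrier H1 <+>\<^bsub>B\<^esub> f2 ` L2"
        unfolding in_set_add using csubD(3)[OF cv(3) F1 a(1) lc(3)] l(1) by (intro bexI) auto
    qed
  qed
  have "subsp B (f1 ` carrier H1) \<cong>\<^sub>L subsp B (f1 ` G1) \<boxplus> subsp B (f1 ` L1)"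
    unfolding s1 by (rule lin_isomorphic_internal_sum[OF cv(3) im1[OF g1(1)] im1[OF l1(1)] i1])
  then have "subsp B (f1 ` carrier H1) \<boxplus> subsp B (f2 ` L2)
      \<cong>\<^sub>L (subsp B (f1 ` G1) \<boxplus> subsp B (f1 ` L1)) \<boxplus> subsp B (f2 ` L2)"
    by (rule lin_isomorphic_dsum[OF _ lin_isomorphic_refl])
  moreover have "subsp B (ker_of B K r) \<cong>\<^sub>L subsp B (f1 ` carrier H1) \<boxplus> subsp B (f2 ` L2)"
    unfolding ker_r s2 by (rule lin_isomorphic_internal_sum[OF cv(3) F1 im2[OF l2(1)] i2])
  ultimately have N: "subsp B (ker_of B K r) \<cong>\<^sub>L (subsp B (f1 ` G1) \<boxplus> subsp B (f1 ` L1)) \<boxplus> subsp B (f2 ` L2)"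
    by (rule lin_isomorphic_trans[rotated])
  have "B \<cong>\<^sub>L ((subsp B (f1 ` G1) \<boxplus> subsp B (f1 ` L1)) \<boxplus> subsp B (f2 ` L2)) \<boxplus> K"
    by (rule lin_isomorphic_trans[OF lin_isomorphic_ker_dsum[OF cv(3,4) r] lin_isomorphic_dsum[OF N lin_isomorphic_refl]])
  from lin_isomorphic_trans[OF lin_isomorphic_trans[OF this lin_isomorphic_dsum_assoc] lin_isomorphic_dsum_assoc]
  show ?thesis .
qed

text \<open>The image of \<pi> and \<G> form a two-step filtration of H. G and L represent its upper
  two quotients, and the first isomorphism theorem identifies the bottom step.\<close>

lemma filtration_decomposition:
  assumes cv: "cvs H" "cvs D" and \<pi>: "linmap D H \<pi>" and \<G>: "csub \<G> H"
    and G: "complement_in H \<G> (\<pi> ` carrier D) G" and L: "complement_in H (carrier H) \<G> L"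
  shows "H \<cong>\<^sub>L quot D (ker_of D H \<pi>) \<boxplus> subsp H G \<boxplus> subsp H L"
proof -
  have P: "csub (\<pi> ` carrier D) H" by (rule csub_image[OF cv(2,1) \<pi> csub_carrier[OF cv(2)]])
  have Q: "subsp H (\<pi> ` carrier D) \<cong>\<^sub>L quot D (ker_of D H \<pi>)"
    by (rule lin_isomorphic_sym[OF cvs_quot[OF cv(2) csub_ker[OF cv(2,1) \<pi>]] first_isomorphism[OF cv(2,1) \<pi>]])
  have "subsp H \<G> \<cong>\<^sub>L quot D (ker_of D H \<pi>) \<boxplus> subsp H G"
    by (rule lin_isomorphic_trans[OF lin_isomorphic_complement[OF cv(1) P G]
          lin_isomorphic_dsum[OF Q lin_isomorphic_refl]])
  from lin_isomorphic_trans[OF lin_isomorphic_complement[OF cv(1) \<G> L, unfolded subsp_carrier]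
      lin_isomorphic_dsum[OF this lin_isomorphic_refl]]
  show ?thesis by (rule lin_isomorphic_trans[OF _ lin_isomorphic_dsum_assoc])
qed

section \<open>Cohomology of a double complex\<close>

text \<open>Integer bidegrees avoid case distinctions at the border: every space has a predecessor
  in both directions, possibly a zero space. The sign in the last axiom is the one that the two
  operators on forms obey.\<close>

locale double_complex =
  fixes V :: "int \<Rightarrow> int \<Rightarrow> (complex, 'v) module" and d e :: "int \<Rightarrow> int \<Rightarrow> 'v \<Rightarrow> 'v"
  assumes cvs_V: "cvs (V p q)"
    and linmap_d: "linmap (V p q) (V (p + 1) q) (d p q)"
    and linmap_e: "linmap (V p q) (V p (q + 1)) (e p q)"
    and d_d: "x \<in> carrier (V p q) \<Longrightarrow> d (p + 1) q (d p q x) = \<zero>\<^bsub>V (p + 2) q\<^esub>"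
    and e_e: "x \<in> carrier (V p q) \<Longrightarrow> e p (q + 1) (e p q x) = \<zero>\<^bsub>V p (q + 2)\<^esub>"
    and d_e: "x \<in> carrier (V p q) \<Longrightarrow>
      d p (q + 1) (e p q x) = \<ominus>\<^bsub>V (p + 1) (q + 1)\<^esub> e (p + 1) q (d p q x)"
begin

definition "kd p q = {x \<in> carrier (V p q). d p q x = \<zero>\<^bsub>V (p + 1) q\<^esub>}"
definition "ke p q = {x \<in> carrier (V p q). e p q x = \<zero>\<^bsub>V p (q + 1)\<^esub>}"
definition "zA p q = {x \<in> carrier (V p q). d p (q + 1) (e p q x) = \<zero>\<^bsub>V (p + 1) (q + 1)\<^esub>}"
definition "imd p q = d (p - 1) q ` carrier (V (p - 1) q)"
definition "ime p q = e p (q - 1) ` carrier (V p (q - 1))"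
text \<open>The index \<open>q - 1 + 1\<close> has the shape that unfolding \<open>ddbar\<close>
  produces at (p - 1, q - 1).\<close>

definition "iB p q = (\<lambda>x. d (p - 1) (q - 1 + 1) (e (p - 1) (q - 1) x)) ` carrier (V (p - 1) (q - 1))"
definition "iS p q = imd p q <+>\<^bsub>V p q\<^esub> ime p q"
definition "iK p q = (imd p q \<inter> ke p q) <+>\<^bsub>V p q\<^esub> (ime p q \<inter> kd p q)"

text \<open>\<open>HA, HB, HK, HD, HE\<close> are \<open>H\<^sub>A, H\<^sub>B\<^sub>C, K, H\<^sub>\<partial>, H\<^sub>\<bar>\<^sub>\<partial>\<close>, with \<open>d\<close> and \<open>e\<close> in the roles of \<open>\<partial>\<close> and \<open>\<bar>\<partial>\<close>.\<close>

definition "HA p q = quot (subsp (V p q) (zA p q)) (iS p q)"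
definition "HB p q = quot (subsp (V p q) (kd p q \<inter> ke p q)) (iB p q)"
definition "HK p q = quot (subsp (V p q) (kd p q \<inter> ke p q)) (iK p q)"
definition "HD p q = quot (subsp (V p q) (kd p q)) (imd p q)"
definition "HE p q = quot (subsp (V p q) (ke p q)) (ime p q)"

definition "d_HB p q = class_map (V (p + 1) q) (iB (p + 1) q) (d p q)"
definition "e_HB p q = class_map (V p (q + 1)) (iB p (q + 1)) (e p q)"
definition "d_HE p q = class_map (V (p + 1) q) (ime (p + 1) q) (d p q)"
definition "e_HD p q = class_map (V p (q + 1)) (imd p (q + 1)) (e p q)"
definition "to_HA p q = class_map (V p q) (iS p q) (\<lambda>x. x)"
definition "to_HK p q = class_map (V p q) (iK p q) (\<lambda>x. x)"

abbreviation "cls W p q x \<equiv> W p q +>\<^bsub>V p q\<^esub> x"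

definition "GD p q = {C \<in> carrier (HA p q). d_HE p q C = \<zero>\<^bsub>HE (p + 1) q\<^esub>}"
definition "GE p q = {C \<in> carrier (HA p q). e_HD p q C = \<zero>\<^bsub>HD p (q + 1)\<^esub>}"

lemma d_closed: "x \<in> carrier (V p q) \<Longrightarrow> d p q x \<in> carrier (V (p + 1) q)"
  by (rule linmapD(1)[OF linmap_d])

lemma e_closed: "x \<in> carrier (V p q) \<Longrightarrow> e p q x \<in> carrier (V p (q + 1))"
  by (rule linmapD(1)[OF linmap_e])

lemma linmap_d': "linmap (V (p - 1) q) (V p q) (d (p - 1) q)"
  using linmap_d[of "p - 1" q] by simp

lemma linmap_e': "linmap (V p (q - 1)) (V p q) (e p (q - 1))"
  using linmap_e[of p "q - 1"] by simp

lemma d_zero: "d p q \<zero>\<^bsub>V p q\<^esub> = \<zero>\<^bsub>V (p + 1) q\<^esub>"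
  by (rule linmap_zero[OF cvs_V cvs_V linmap_d])

lemma neg_zero: "\<ominus>\<^bsub>V p q\<^esub> \<zero>\<^bsub>V p q\<^esub> = \<zero>\<^bsub>V p q\<^esub>"
proof -
  interpret module complex_ring "V p q" by (rule cvs_V)
  show ?thesis by simp
qed

lemma neg_neg: "x \<in> carrier (V p q) \<Longrightarrow> \<ominus>\<^bsub>V p q\<^esub> (\<ominus>\<^bsub>V p q\<^esub> x) = x"
proof -
  interpret module complex_ring "V p q" by (rule cvs_V)
  show "x \<in> carrier (V p q) \<Longrightarrow> ?thesis" by (rule M.minus_minus)
qed

lemma neg_closed: "x \<in> carrier (V p q) \<Longrightarrow> \<ominus>\<^bsub>V p q\<^esub> x \<in> carrier (V p q)"
proof -
  interpret module complex_ring "V p q" by (rule cvs_V)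
  show "x \<in> carrier (V p q) \<Longrightarrow> ?thesis" by (rule M.a_inv_closed)
qed

lemma e_d:
  assumes "x \<in> carrier (V p q)"
  shows "e (p + 1) q (d p q x) = \<ominus>\<^bsub>V (p + 1) (q + 1)\<^esub> d p (q + 1) (e p q x)"
  unfolding d_e[OF assms] by (rule neg_neg[symmetric]) (rule e_closed[OF d_closed[OF assms]])

text \<open>Every statement about \<open>d\<close> thus yields one about \<open>e\<close>.\<close>

lemma swapped: "double_complex (\<lambda>p q. V q p) (\<lambda>p q. e q p) (\<lambda>p q. d q p)"
  by (rule double_complex.intro) (simp_all add: cvs_V linmap_d linmap_e d_d e_e e_d)

lemma csub_kd: "csub (kd p q) (V p q)"
  using csub_ker[OF cvs_V cvs_V linmap_d, of p q] by (simp add: ker_of_def kd_def)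

lemma csub_ke: "csub (ke p q) (V p q)"
  using csub_ker[OF cvs_V cvs_V linmap_e, of p q] by (simp add: ker_of_def ke_def)

lemma csub_zA: "csub (zA p q) (V p q)"
  using csub_ker[OF cvs_V cvs_V linmap_comp[OF linmap_e linmap_d], of p q] by (simp add: ker_of_def zA_def)

lemma csub_imd: "csub (imd p q) (V p q)"
  unfolding imd_def by (rule csub_image[OF cvs_V cvs_V linmap_d' csub_carrier[OF cvs_V]])

lemma csub_ime: "csub (ime p q) (V p q)"
  unfolding ime_def by (rule csub_image[OF cvs_V cvs_V linmap_e' csub_carrier[OF cvs_V]])

lemma csub_iB: "csub (iB p q) (V p q)"
proof -
  have "linmap (V (p - 1) (q - 1)) (V p q) (\<lambda>x. d (p - 1) (q - 1 + 1) (e (p - 1) (q - 1) x))"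
    using linmap_comp[OF linmap_e[of "p - 1" "q - 1"] linmap_d[of "p - 1" "q - 1 + 1"]] by simp
  then show ?thesis unfolding iB_def by (rule csub_image[OF cvs_V cvs_V _ csub_carrier[OF cvs_V]])
qed

lemma csub_iS: "csub (iS p q) (V p q)"
  unfolding iS_def by (rule csub_set_add[OF cvs_V csub_imd csub_ime])

lemma csub_iK: "csub (iK p q) (V p q)"
  unfolding iK_def by (intro csub_set_add csub_Int cvs_V csub_imd csub_ime csub_kd csub_ke)

lemma csub_kd_ke: "csub (kd p q \<inter> ke p q) (V p q)"
  by (intro csub_Int cvs_V csub_kd csub_ke)

lemma imd_le_kd: "imd p q \<subseteq> kd p q"
  unfolding imd_def kd_def
proof (intro image_subsetI CollectI conjI)
  fix x assume x: "x \<in> carrier (V (p - 1) q)"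
  show "d (p - 1) q x \<in> carrier (V p q)" using d_closed[OF x] by simp
  show "d p q (d (p - 1) q x) = \<zero>\<^bsub>V (p + 1) q\<^esub>" using d_d[OF x] by (simp add: add.commute)
qed

lemma iB_le_imd: "iB p q \<subseteq> imd p q"
  unfolding iB_def imd_def
proof (intro image_subsetI)
  fix x assume x: "x \<in> carrier (V (p - 1) (q - 1))"
  show "d (p - 1) (q - 1 + 1) (e (p - 1) (q - 1) x) \<in> d (p - 1) q ` carrier (V (p - 1) q)"
    using e_closed[OF x] by simp
qed

section \<open>Exchange of the two differentials\<close>

text \<open>In the transposed complex the bidegree is read backwards, so \<open>e'\<close> raises
  the first index and \<open>d'\<close> the second; the instance is therefore
  \<open>double_complex V' e' d'\<close>, taken at (q, p).\<close>

abbreviation (input) "V' \<equiv> \<lambda>p q. V q p"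
abbreviation (input) "d' \<equiv> \<lambda>p q. d q p"
abbreviation (input) "e' \<equiv> \<lambda>p q. e q p"

lemma swap_zA: "double_complex.zA V' e' d' q p = zA p q"
proof -
  interpret sw: double_complex V' e' d' by (rule swapped)
  have "e (p + 1) q (d p q x) = \<zero>\<^bsub>V (p + 1) (q + 1)\<^esub> \<longleftrightarrow> d p (q + 1) (e p q x) = \<zero>\<^bsub>V (p + 1) (q + 1)\<^esub>"
    if x: "x \<in> carrier (V p q)" for x
    using e_d[OF x] d_e[OF x] neg_zero[of "p + 1" "q + 1"] by metis
  then show ?thesis by (auto simp: sw.zA_def zA_def)
qed

text \<open>The two composites differ by a sign only, and their common domain is closed under
  negation.\<close>

lemma iB_eq_e_d: "iB p q = (\<lambda>x. e (p - 1 + 1) (q - 1) (d (p - 1) (q - 1) x)) ` carrier (V (p - 1) (q - 1))"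
proof -
  let ?M = "V (p - 1) (q - 1)"
  let ?f = "\<lambda>x. d (p - 1) (q - 1 + 1) (e (p - 1) (q - 1) x)"
  let ?g = "\<lambda>x. e (p - 1 + 1) (q - 1) (d (p - 1) (q - 1) x)"
  have f: "linmap ?M (V p q) ?f"
    using linmap_comp[OF linmap_e[of "p - 1" "q - 1"] linmap_d[of "p - 1" "q - 1 + 1"]] by simp
  have g: "linmap ?M (V p q) ?g"
    using linmap_comp[OF linmap_d[of "p - 1" "q - 1"] linmap_e[of "p - 1 + 1" "q - 1"]] by simp
  have "?f x = ?g (\<ominus>\<^bsub>?M\<^esub> x)" if x: "x \<in> carrier ?M" for x
    using linmap_neg[OF cvs_V cvs_V g x] d_e[OF x] by simp
  moreover have "?g x = ?f (\<ominus>\<^bsub>?M\<^esub> x)" if x: "x \<in> carrier ?M" for x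
    using linmap_neg[OF cvs_V cvs_V f x] e_d[OF x] by simp
  ultimately show ?thesis unfolding iB_def using neg_closed[of _ "p - 1" "q - 1"]
    by (intro equalityI image_subsetI) (metis imageI)+
qed

lemma swap_defs:
  shows "double_complex.kd V' e' q p = ke p q"
    and "double_complex.ke V' d' q p = kd p q"
    and "double_complex.imd V' e' q p = ime p q"
    and "double_complex.ime V' d' q p = imd p q"
    and "double_complex.iB V' e' d' q p = iB p q"
    and "double_complex.iS V' e' d' q p = iS p q"
    and "double_complex.iK V' e' d' q p = iK p q"
proof -
  interpret sw: double_complex V' e' d' by (rule swapped)
  show 1: "sw.kd q p = ke p q" "sw.ke q p = kd p q" "sw.imd q p = ime p q" "sw.ime q p = imd p q"
    by (simp_all add: sw.kd_def kd_def sw.ke_def ke_def sw.imd_def imd_def sw.ime_def ime_def)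
  show "sw.iB q p = iB p q" unfolding iB_eq_e_d sw.iB_def by simp
  note sub = csubD(1)[OF cvs_V]
  show "sw.iS q p = iS p q"
    unfolding sw.iS_def iS_def 1 by (rule set_add_comm[OF cvs_V sub[OF csub_ime] sub[OF csub_imd]])
  show "sw.iK q p = iK p q"
    unfolding sw.iK_def iK_def 1
    by (rule set_add_comm[OF cvs_V]) (use sub[OF csub_ime, of p q] sub[OF csub_imd, of p q] in auto)
qed

text \<open>Rewriting with these equations turns a fact about the transposed complex into the
  original fact with d and e exchanged.\<close>

lemma swap_H:
  shows "double_complex.HA V' e' d' q p = HA p q"
    and "double_complex.HB V' e' d' q p = HB p q"
    and "double_complex.HK V' e' d' q p = HK p q"
    and "double_complex.HD V' e' q p = HE p q"
    and "double_complex.HE V' d' q p = HD p q"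
    and "double_complex.d_HB V' e' d' q p = e_HB p q"
    and "double_complex.e_HB V' e' d' q p = d_HB p q"
    and "double_complex.d_HE V' e' d' q p = e_HD p q"
    and "double_complex.e_HD V' e' d' q p = d_HE p q"
    and "double_complex.to_HA V' e' d' q p = to_HA p q"
    and "double_complex.GD V' e' d' q p = GE p q"
    and "double_complex.GE V' e' d' q p = GD p q"
proof -
  interpret sw: double_complex V' e' d' by (rule swapped)
  note 0 = swap_defs swap_zA
  show 1: "sw.HA q p = HA p q" for p q by (simp only: sw.HA_def HA_def 0)
  show "sw.HB q p = HB p q" "sw.HK q p = HK p q"
    by (simp_all only: sw.HB_def HB_def sw.HK_def HK_def 0 Int_commute)
  show 2: "sw.HD q p = HE p q" "sw.HE q p = HD p q" for p q
    by (simp_all only: sw.HD_def HD_def sw.HE_def HE_def 0)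
  show "sw.d_HB q p = e_HB p q" "sw.e_HB q p = d_HB p q" "sw.to_HA q p = to_HA p q"
    by (simp_all only: sw.d_HB_def d_HB_def sw.e_HB_def e_HB_def sw.to_HA_def to_HA_def 0)
  show 3: "sw.d_HE q p = e_HD p q" "sw.e_HD q p = d_HE p q" for p q
    by (simp_all only: sw.d_HE_def d_HE_def sw.e_HD_def e_HD_def 0)
  show "sw.GD q p = GE p q" "sw.GE q p = GD p q"
    by (simp_all only: sw.GD_def GD_def sw.GE_def GE_def 1 2 3)
qed

section \<open>Inclusions of subspaces and the induced maps\<close>

lemma ime_le_ke: "ime p q \<subseteq> ke p q"
  using double_complex.imd_le_kd[OF swapped, of q p] by (simp only: swap_defs)

lemma iB_le_ime: "iB p q \<subseteq> ime p q"
  using double_complex.iB_le_imd[OF swapped, of q p] by (simp only: swap_defs)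

lemma iB_le_kd_ke: "iB p q \<subseteq> kd p q \<inter> ke p q"
  using iB_le_imd iB_le_ime imd_le_kd ime_le_ke by (meson Int_greatest order_trans)

lemma ke_le_zA: "ke p q \<subseteq> zA p q"
  by (auto simp: ke_def zA_def d_zero)

lemma kd_le_zA: "kd p q \<subseteq> zA p q"
  using double_complex.ke_le_zA[OF swapped, of q p] by (simp only: swap_defs swap_zA)

lemma set_add_leI:
  assumes "csub T (V p q)" "S \<subseteq> T" "S' \<subseteq> T" shows "S <+>\<^bsub>V p q\<^esub> S' \<subseteq> T"
proof
  fix x assume "x \<in> S <+>\<^bsub>V p q\<^esub> S'"
  then obtain s t where "s \<in> S" "t \<in> S'" "x = s \<oplus>\<^bsub>V p q\<^esub> t" by (auto simp: in_set_add)
  then show "x \<in> T" using csubD(3)[OF cvs_V assms(1), of s t] assms(2,3) by auto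
qed

lemma iS_le_zA: "iS p q \<subseteq> zA p q"
  unfolding iS_def
  by (rule set_add_leI[OF csub_zA]) (use imd_le_kd kd_le_zA ime_le_ke ke_le_zA in \<open>meson order_trans\<close>)+

lemma imd_le_iS: "imd p q \<subseteq> iS p q" and ime_le_iS: "ime p q \<subseteq> iS p q"
  unfolding iS_def by (rule csub_le_set_add[OF cvs_V csub_imd csub_ime])+

lemma iK_le_kd_ke: "iK p q \<subseteq> kd p q \<inter> ke p q"
  unfolding iK_def
  by (rule set_add_leI[OF csub_kd_ke]) (use imd_le_kd ime_le_ke in blast)+

lemma iB_le_iK: "iB p q \<subseteq> iK p q"
proof -
  have "iB p q \<subseteq> imd p q \<inter> ke p q" using iB_le_imd iB_le_kd_ke by blast
  also have "\<dots> \<subseteq> iK p q"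
    unfolding iK_def by (intro csub_le_set_add csub_Int cvs_V csub_imd csub_ime csub_kd csub_ke)
  finally show ?thesis .
qed

lemma d_zA: "x \<in> zA p q \<Longrightarrow> d p q x \<in> kd (p + 1) q \<inter> ke (p + 1) q"
  using d_d[of x p q] e_d[of x p q] d_closed[of x p q] neg_zero
  by (simp add: zA_def kd_def ke_def add.assoc)

text \<open>Used when an element is known only as a preimage under d: it then represents an Aeppli
  class as soon as its differential is e-closed.\<close>

lemma zA_if_d_ke: "x \<in> carrier (V p q) \<Longrightarrow> d p q x \<in> ke (p + 1) q \<Longrightarrow> x \<in> zA p q"
  using d_e[of x p q] neg_zero by (simp add: zA_def ke_def)

text \<open>The summand in \<open>imd\<close> is killed by d, and d of the summand in
  \<open>ime\<close> is in \<open>iB\<close> by definition. Hence d descends to a map from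
  \<open>HA\<close> to \<open>HB\<close>.\<close>

lemma d_iS: "x \<in> iS p q \<Longrightarrow> d p q x \<in> iB (p + 1) q"
proof -
  assume "x \<in> iS p q"
  then obtain y z where yz: "y \<in> imd p q" "z \<in> carrier (V p (q - 1))" "x = y \<oplus>\<^bsub>V p q\<^esub> e p (q - 1) z"
    unfolding iS_def ime_def by (auto simp: in_set_add)
  have y: "y \<in> carrier (V p q)" "d p q y = \<zero>\<^bsub>V (p + 1) q\<^esub>" using yz(1) imd_le_kd[of p q] by (auto simp: kd_def)
  have z: "e p (q - 1) z \<in> carrier (V p q)" using e_closed[OF yz(2)] by simp
  interpret module complex_ring "V (p + 1) q" by (rule cvs_V)
  have "d p q x = d p q (e p (q - 1) z)"
    using linmapD(2)[OF linmap_d y(1) z] y(2) d_closed[OF z] yz(3) by simp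
  then show ?thesis using yz(2) by (simp add: iB_def)
qed

lemmas cvs_zA = cvs_subsp[OF cvs_V csub_zA]
  and cvs_kd = cvs_subsp[OF cvs_V csub_kd]
  and cvs_ke = cvs_subsp[OF cvs_V csub_ke]
  and cvs_kd_ke = cvs_subsp[OF cvs_V csub_kd_ke]
lemmas sub_zA = csub_subsp[OF cvs_V csub_zA csub_iS iS_le_zA]
  and sub_kd = csub_subsp[OF cvs_V csub_kd csub_imd imd_le_kd]
  and sub_ke = csub_subsp[OF cvs_V csub_ke csub_ime ime_le_ke]
  and sub_iB = csub_subsp[OF cvs_V csub_kd_ke csub_iB iB_le_kd_ke]
  and sub_iK = csub_subsp[OF cvs_V csub_kd_ke csub_iK iK_le_kd_ke]

lemma cvs_HA: "cvs (HA p q)" unfolding HA_def by (rule cvs_quot[OF cvs_zA sub_zA])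
lemma cvs_HB: "cvs (HB p q)" unfolding HB_def by (rule cvs_quot[OF cvs_kd_ke sub_iB])
lemma cvs_HK: "cvs (HK p q)" unfolding HK_def by (rule cvs_quot[OF cvs_kd_ke sub_iK])
lemma cvs_HD: "cvs (HD p q)" unfolding HD_def by (rule cvs_quot[OF cvs_kd sub_kd])
lemma cvs_HE: "cvs (HE p q)" unfolding HE_def by (rule cvs_quot[OF cvs_ke sub_ke])

lemma linmap_id_subsp: "S \<subseteq> T \<Longrightarrow> linmap (subsp W S) (subsp W T) (\<lambda>x. x)"
  by (rule linmapI) auto

lemma linmap_d_zA: "linmap (subsp (V p q) (zA p q)) (subsp (V (p + 1) q) (kd (p + 1) q \<inter> ke (p + 1) q)) (d p q)"
  by (rule linmap_restrict[OF linmap_d csubD(1)[OF cvs_V csub_zA]]) (auto dest: d_zA)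

lemma linmap_d_zA_ke: "linmap (subsp (V p q) (zA p q)) (subsp (V (p + 1) q) (ke (p + 1) q)) (d p q)"
  by (rule linmap_restrict[OF linmap_d csubD(1)[OF cvs_V csub_zA]]) (auto dest: d_zA)

lemma d_iS_iB: "d p q ` iS p q \<subseteq> iB (p + 1) q"
  using d_iS by (rule image_subsetI)

lemma d_iS_ime: "d p q ` iS p q \<subseteq> ime (p + 1) q"
  using d_iS_iB iB_le_ime by (rule order_trans)

lemma carrier_HA: "carrier (HA p q) = (\<lambda>x. cls iS p q x) ` zA p q"
  by (simp add: HA_def carrier_quot)

lemma carrier_HB: "carrier (HB p q) = (\<lambda>x. cls iB p q x) ` (kd p q \<inter> ke p q)"
  by (simp add: HB_def carrier_quot)

lemma carrier_HD: "carrier (HD p q) = (\<lambda>x. cls imd p q x) ` kd p q"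
  by (simp add: HD_def carrier_quot)

lemma d_HB_coset: "x \<in> zA p q \<Longrightarrow> d_HB p q (cls iS p q x) = cls iB (p + 1) q (d p q x)"
  using class_map_coset[OF cvs_zA sub_zA cvs_kd_ke sub_iB linmap_d_zA d_iS_iB, of x p q] by (simp add: d_HB_def)

lemma d_HE_coset: "x \<in> zA p q \<Longrightarrow> d_HE p q (cls iS p q x) = cls ime (p + 1) q (d p q x)"
  using class_map_coset[OF cvs_zA sub_zA cvs_ke sub_ke linmap_d_zA_ke d_iS_ime, of x p q] by (simp add: d_HE_def)

lemma to_HA_coset: "x \<in> kd p q \<Longrightarrow> to_HA p q (cls imd p q x) = cls iS p q x"
  using class_map_coset[OF cvs_kd sub_kd cvs_zA sub_zA linmap_id_subsp[OF kd_le_zA], of p q x] imd_le_iS[of p q]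
  by (simp add: to_HA_def)

lemma to_HK_coset: "x \<in> kd p q \<inter> ke p q \<Longrightarrow> to_HK p q (cls iB p q x) = cls iK p q x"
  using class_map_coset[OF cvs_kd_ke sub_iB cvs_kd_ke sub_iK linmap_id_subsp[OF order_refl], of p q x] iB_le_iK[of p q]
  by (simp add: to_HK_def)

lemma linmap_d_HB: "linmap (HA p q) (HB (p + 1) q) (d_HB p q)"
  using linmap_class_map[OF cvs_zA sub_zA cvs_kd_ke sub_iB linmap_d_zA d_iS_iB, of p q]
  by (simp add: HA_def HB_def d_HB_def)

lemma linmap_d_HE: "linmap (HA p q) (HE (p + 1) q) (d_HE p q)"
  using linmap_class_map[OF cvs_zA sub_zA cvs_ke sub_ke linmap_d_zA_ke d_iS_ime, of p q]
  by (simp add: HA_def HE_def d_HE_def)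

lemma linmap_to_HA: "linmap (HD p q) (HA p q) (to_HA p q)"
  using linmap_class_map[OF cvs_kd sub_kd cvs_zA sub_zA linmap_id_subsp[OF kd_le_zA], of p q] imd_le_iS[of p q]
  by (simp add: HA_def HD_def to_HA_def)

lemma linmap_to_HK: "linmap (HB p q) (HK p q) (to_HK p q)"
  using linmap_class_map[OF cvs_kd_ke sub_iB cvs_kd_ke sub_iK linmap_id_subsp[OF order_refl], of p q] iB_le_iK[of p q]
  by (simp add: HB_def HK_def to_HK_def)

lemma to_HK_surj: "to_HK p q ` carrier (HB p q) = carrier (HK p q)"
  unfolding carrier_HB HK_def carrier_quot image_image by (simp add: to_HK_coset cong: image_cong_simp)

section \<open>Kernels and preimages of the induced maps\<close>

lemma coset_iS_eq:
  assumes "x \<in> carrier (V p q)" "y \<in> carrier (V p q)" "x \<ominus>\<^bsub>V p q\<^esub> y \<in> iS p q"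
  shows "cls iS p q x = cls iS p q y"
  using coset_eq_iff[OF cvs_V csub_iS assms(1,2)] assms(3) by simp

text \<open>If \<open>d x = d e y\<close> then \<open>x - e y\<close> is \<open>d\<close>-closed and represents the same class as \<open>x\<close>.\<close>

lemma ker_d_HB: "ker_of (HA p q) (HB (p + 1) q) (d_HB p q) = to_HA p q ` carrier (HD p q)" (is "?K = ?S")
proof
  show "?K \<subseteq> ?S"
  proof
    fix C assume "C \<in> ?K"
    then obtain x where x: "x \<in> zA p q" "C = cls iS p q x" "d_HB p q C = iB (p + 1) q"
      by (auto simp: ker_of_def carrier_HA HB_def)
    have xc: "x \<in> carrier (V p q)" using x(1) by (simp add: zA_def)
    have "cls iB (p + 1) q (d p q x) = iB (p + 1) q" using d_HB_coset[OF x(1)] x(2,3) by simp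
    then have "d p q x \<in> iB (p + 1) q"
      using coset_eq_zero_iff[OF cvs_V csub_iB d_closed[OF xc]] by simp
    then obtain y where y: "y \<in> carrier (V p (q - 1))" "d p q x = d p q (e p (q - 1) y)"
      by (auto simp: iB_def)
    define w where "w = e p (q - 1) y"
    have w: "w \<in> carrier (V p q)" "w \<in> iS p q"
      using e_closed[OF y(1)] ime_le_iS[of p q] y(1) by (auto simp: w_def ime_def)
    interpret module complex_ring "V p q" by (rule cvs_V)
    have xw: "x \<ominus>\<^bsub>V p q\<^esub> w \<in> carrier (V p q)" using xc w by simp
    have "d p q (x \<ominus>\<^bsub>V p q\<^esub> w) = d p q x \<ominus>\<^bsub>V (p + 1) q\<^esub> d p q x"
      using linmap_minus[OF cvs_V cvs_V linmap_d xc w(1)] y(2) by (simp add: w_def)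
    also have "\<dots> = \<zero>\<^bsub>V (p + 1) q\<^esub>" by (rule cvs_minus_self[OF cvs_V d_closed[OF xc]])
    finally have k: "x \<ominus>\<^bsub>V p q\<^esub> w \<in> kd p q" using xw by (simp add: kd_def)
    have "x \<ominus>\<^bsub>V p q\<^esub> (x \<ominus>\<^bsub>V p q\<^esub> w) = w"
      using xc w(1) by (simp add: a_minus_def M.minus_add M.r_neg2)
    then have "C = cls iS p q (x \<ominus>\<^bsub>V p q\<^esub> w)"
      unfolding x(2) using w(2) by (intro coset_iS_eq[OF xc xw]) simp
    then have "C = to_HA p q (cls imd p q (x \<ominus>\<^bsub>V p q\<^esub> w))" using to_HA_coset[OF k] by simp
    then show "C \<in> ?S" using k by (auto simp: carrier_HD)
  qed
  show "?S \<subseteq> ?K"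
  proof
    fix C assume "C \<in> ?S"
    then obtain x where x: "x \<in> kd p q" "C = cls iS p q x" using to_HA_coset by (auto simp: carrier_HD)
    have xz: "x \<in> zA p q" using x(1) kd_le_zA by auto
    have "d_HB p q C = cls iB (p + 1) q (\<zero>\<^bsub>V (p + 1) q\<^esub>)"
      using d_HB_coset[OF xz] x by (simp add: kd_def)
    then have "d_HB p q C = iB (p + 1) q" using coset_zero[OF cvs_V csub_iB, of "p + 1" q] by simp
    then show "C \<in> ?K"
      using xz x(2) by (simp add: ker_of_def carrier_HA HB_def)
  qed
qed

lemma csub_GD: "csub (GD p q) (HA p q)"
  using csub_ker[OF cvs_HA cvs_HE linmap_d_HE, of p q] by (simp add: ker_of_def GD_def)

lemma csub_GE: "csub (GE p q) (HA p q)"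
  using double_complex.csub_GD[OF swapped, of q p] by (simp only: swap_H)

lemma e_HB_coset: "x \<in> zA p q \<Longrightarrow> e_HB p q (cls iS p q x) = cls iB p (q + 1) (e p q x)"
  using double_complex.d_HB_coset[OF swapped, of x q p] by (simp only: swap_H swap_defs swap_zA)

lemma e_HD_coset: "x \<in> zA p q \<Longrightarrow> e_HD p q (cls iS p q x) = cls imd p (q + 1) (e p q x)"
  using double_complex.d_HE_coset[OF swapped, of x q p] by (simp only: swap_H swap_defs swap_zA)

lemma linmap_e_HB: "linmap (HA p q) (HB p (q + 1)) (e_HB p q)"
  using double_complex.linmap_d_HB[OF swapped, of q p] by (simp only: swap_H)

lemma linmap_e_HD: "linmap (HA p q) (HD p (q + 1)) (e_HD p q)"
  using double_complex.linmap_d_HE[OF swapped, of q p] by (simp only: swap_H)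

lemma e_zA: "x \<in> zA p q \<Longrightarrow> e p q x \<in> kd p (q + 1) \<inter> ke p (q + 1)"
  using double_complex.d_zA[OF swapped, of x q p] by (simp only: swap_defs swap_zA Int_commute)

lemma zA_if_e_kd: "x \<in> carrier (V p q) \<Longrightarrow> e p q x \<in> kd p (q + 1) \<Longrightarrow> x \<in> zA p q"
  using double_complex.zA_if_d_ke[OF swapped, of x p q] by (simp only: swap_defs swap_zA)

text \<open>\<open>GD\<close> is defined by classes modulo \<open>ime\<close>, but the decomposition
  of \<open>HB\<close> needs classes modulo \<open>iB\<close>. If d x = e y, then y is in
  \<open>zA\<close> because d x is d-closed, so the class of d x is an \<open>e_HB\<close> image.
  Conversely, the discrepancy in \<open>iB\<close> is absorbed since \<open>iB\<close> is contained
  in \<open>ime\<close>.\<close>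

lemma GD_eq:
  "GD p q = {C \<in> carrier (HA p q). d_HB p q C \<in> e_HB (p + 1) (q - 1) ` carrier (HA (p + 1) (q - 1))}"
proof -
  let ?E = "e_HB (p + 1) (q - 1) ` carrier (HA (p + 1) (q - 1))"
  have "d_HE p q C = \<zero>\<^bsub>HE (p + 1) q\<^esub> \<longleftrightarrow> d_HB p q C \<in> ?E"
    if C: "C \<in> carrier (HA p q)" for C
  proof -
    obtain x where x: "x \<in> zA p q" "C = cls iS p q x" using C by (auto simp: carrier_HA)
    have dx: "d p q x \<in> kd (p + 1) q" "d p q x \<in> carrier (V (p + 1) q)" using d_zA[OF x(1)] by (auto simp: kd_def)
    have "d_HE p q C = \<zero>\<^bsub>HE (p + 1) q\<^esub> \<longleftrightarrow> d p q x \<in> ime (p + 1) q"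
      using coset_eq_zero_iff[OF cvs_V csub_ime dx(2)] d_HE_coset[OF x(1)] x(2) by (simp add: HE_def)
    also have "\<dots> \<longleftrightarrow> d_HB p q C \<in> ?E"
    proof
      assume "d p q x \<in> ime (p + 1) q"
      then obtain y where y: "y \<in> carrier (V (p + 1) (q - 1))" "d p q x = e (p + 1) (q - 1) y"
        by (auto simp: ime_def)
      then have yz: "y \<in> zA (p + 1) (q - 1)" using dx(1) zA_if_e_kd[OF y(1)] by simp
      have "d_HB p q C = e_HB (p + 1) (q - 1) (cls iS (p + 1) (q - 1) y)"
        using d_HB_coset[OF x(1)] x(2) e_HB_coset[OF yz] y(2) by simp
      then show "d_HB p q C \<in> ?E"
        using yz by (auto simp: carrier_HA)
    next
      assume "d_HB p q C \<in> ?E"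
      then obtain y where y: "y \<in> zA (p + 1) (q - 1)"
        "d_HB p q C = e_HB (p + 1) (q - 1) (cls iS (p + 1) (q - 1) y)"
        by (auto simp: carrier_HA)
      define w where "w = e (p + 1) (q - 1) y"
      have yc: "y \<in> carrier (V (p + 1) (q - 1))" using y(1) by (simp add: zA_def)
      have w: "w \<in> carrier (V (p + 1) q)" "w \<in> ime (p + 1) q"
        using e_closed[OF yc] yc by (auto simp: w_def ime_def)
      have "cls iB (p + 1) q (d p q x) = cls iB (p + 1) q w"
        using d_HB_coset[OF x(1)] x(2) e_HB_coset[OF y(1)] y(2) by (simp add: w_def)
      then have "d p q x \<ominus>\<^bsub>V (p + 1) q\<^esub> w \<in> ime (p + 1) q"
        using coset_eq_iff[OF cvs_V csub_iB dx(2) w(1)] iB_le_ime[of "p + 1" q] by auto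
      then have "(d p q x \<ominus>\<^bsub>V (p + 1) q\<^esub> w) \<oplus>\<^bsub>V (p + 1) q\<^esub> w \<in> ime (p + 1) q"
        by (rule csubD(3)[OF cvs_V csub_ime _ w(2)])
      then show "d p q x \<in> ime (p + 1) q" by (simp only: cvs_minus_add_cancel[OF cvs_V dx(2) w(1)])
    qed
    finally show ?thesis .
  qed
  then show ?thesis by (auto simp: GD_def)
qed

lemma GE_eq:
  "GE p q = {C \<in> carrier (HA p q). e_HB p q C \<in> d_HB (p - 1) (q + 1) ` carrier (HA (p - 1) (q + 1))}"
  using double_complex.GD_eq[OF swapped, of q p] by (simp only: swap_H)

text \<open>The extra closedness conditions in \<open>iK\<close> are exactly what is needed to lift
  to Aeppli classes: if d y is e-closed then y is in \<open>zA\<close>, and likewise if e z is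
  d-closed.\<close>

lemma ker_to_HK:
  "ker_of (HB p q) (HK p q) (to_HK p q) =
     d_HB (p - 1) q ` carrier (HA (p - 1) q) <+>\<^bsub>HB p q\<^esub> e_HB p (q - 1) ` carrier (HA p (q - 1))" (is "?K = ?S")
proof
  show "?K \<subseteq> ?S"
  proof
    fix C assume "C \<in> ?K"
    then obtain x where x: "x \<in> kd p q \<inter> ke p q" "C = cls iB p q x" "to_HK p q C = iK p q"
      by (auto simp: ker_of_def carrier_HB HK_def)
    have xc: "x \<in> carrier (V p q)" using x(1) by (simp add: kd_def)
    have "x \<in> iK p q"
      using to_HK_coset[OF x(1)] x(2,3) coset_eq_zero_iff[OF cvs_V csub_iK xc] by simp
    then obtain a b where ab: "a \<in> imd p q" "a \<in> ke p q" "b \<in> ime p q" "b \<in> kd p q" "x = a \<oplus>\<^bsub>V p q\<^esub> b"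
      unfolding iK_def by (auto simp: in_set_add)
    obtain y where y: "y \<in> carrier (V (p - 1) q)" "a = d (p - 1) q y" using ab(1) by (auto simp: imd_def)
    obtain z where z: "z \<in> carrier (V p (q - 1))" "b = e p (q - 1) z" using ab(3) by (auto simp: ime_def)
    have yz: "y \<in> zA (p - 1) q" "z \<in> zA p (q - 1)"
      using zA_if_d_ke[OF y(1)] zA_if_e_kd[OF z(1)] ab y(2) z(2) by simp_all
    have c: "a \<in> carrier (V p q)" "b \<in> carrier (V p q)" using ab(2,4) by (simp_all add: ke_def kd_def)
    have "C = (cls iB p q a) \<oplus>\<^bsub>HB p q\<^esub> (cls iB p q b)"
      using coset_add[OF cvs_V csub_iB c] x(2) ab(5) by (simp add: HB_def)
    moreover have "cls iB p q a \<in> d_HB (p - 1) q ` carrier (HA (p - 1) q)"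
      using d_HB_coset[OF yz(1)] yz(1) y(2) by (auto simp: carrier_HA image_iff)
    moreover have "cls iB p q b \<in> e_HB p (q - 1) ` carrier (HA p (q - 1))"
      using e_HB_coset[OF yz(2)] yz(2) z(2) by (auto simp: carrier_HA image_iff)
    ultimately show "C \<in> ?S"
      unfolding in_set_add by (intro bexI)
  qed
  show "?S \<subseteq> ?K"
  proof
    fix C assume "C \<in> ?S"
    then obtain y z where yz: "y \<in> zA (p - 1) q" "z \<in> zA p (q - 1)"
      "C = d_HB (p - 1) q (cls iS (p - 1) q y) \<oplus>\<^bsub>HB p q\<^esub>
           e_HB p (q - 1) (cls iS p (q - 1) z)"
      by (auto simp: in_set_add carrier_HA)
    define a b where "a = d (p - 1) q y" and "b = e p (q - 1) z"
    have a: "a \<in> kd p q \<inter> ke p q" "a \<in> imd p q" and b: "b \<in> kd p q \<inter> ke p q" "b \<in> ime p q"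
      using d_zA[OF yz(1)] e_zA[OF yz(2)] yz(1,2) by (auto simp: a_def b_def imd_def ime_def zA_def)
    have c: "a \<in> carrier (V p q)" "b \<in> carrier (V p q)" using a(1) b(1) by (simp_all add: ke_def kd_def)
    have C: "C = cls iB p q (a \<oplus>\<^bsub>V p q\<^esub> b)"
      using yz(3) d_HB_coset[OF yz(1)] e_HB_coset[OF yz(2)] coset_add[OF cvs_V csub_iB c]
      by (simp add: a_def b_def HB_def)
    have ab: "a \<oplus>\<^bsub>V p q\<^esub> b \<in> kd p q \<inter> ke p q" by (rule csubD(3)[OF cvs_V csub_kd_ke a(1) b(1)])
    have "a \<oplus>\<^bsub>V p q\<^esub> b \<in> iK p q" unfolding iK_def in_set_add using a b by (intro bexI[of _ a] bexI[of _ b]) auto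
    then have "cls iK p q (a \<oplus>\<^bsub>V p q\<^esub> b) = iK p q"
      using coset_eq_zero_iff[OF cvs_V csub_iK, of "a \<oplus>\<^bsub>V p q\<^esub> b" p q] ab by (simp add: kd_def)
    then show "C \<in> ?K"
      using ab to_HK_coset[OF ab] C by (simp add: ker_of_def carrier_HB HK_def)
  qed
qed

text \<open>Let x be d-closed and equal to y + e z with y in \<open>imd\<close>. Then e z = x - y is
  d-closed too, so z is in \<open>zA\<close>, and x has the same class modulo \<open>imd\<close> as
  e z.\<close>

lemma ker_to_HA:
  "ker_of (HD p q) (HA p q) (to_HA p q) = e_HD p (q - 1) ` carrier (HA p (q - 1))" (is "?K = ?S")
proof
  show "?K \<subseteq> ?S"
  proof
    fix C assume "C \<in> ?K"
    then obtain x where x: "x \<in> kd p q" "C = cls imd p q x" "to_HA p q C = iS p q"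
      by (auto simp: ker_of_def carrier_HD HA_def)
    have xc: "x \<in> carrier (V p q)" using x(1) by (simp add: kd_def)
    have "x \<in> iS p q"
      using to_HA_coset[OF x(1)] x(2,3) coset_eq_zero_iff[OF cvs_V csub_iS xc] by simp
    then obtain y z where yz: "y \<in> imd p q" "z \<in> carrier (V p (q - 1))" "x = y \<oplus>\<^bsub>V p q\<^esub> e p (q - 1) z"
      unfolding iS_def ime_def by (auto simp: in_set_add)
    define w where "w = e p (q - 1) z"
    have w: "w \<in> carrier (V p q)" using e_closed[OF yz(2)] by (simp add: w_def)
    have y: "y \<in> kd p q" "y \<in> carrier (V p q)" using yz(1) imd_le_kd[of p q] by (auto simp: kd_def)
    interpret module complex_ring "V p q" by (rule cvs_V)
    have "x = w \<oplus>\<^bsub>V p q\<^esub> y" using yz(3) y(2) w by (simp add: w_def M.a_comm)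
    then have "x \<ominus>\<^bsub>V p q\<^esub> y = w" using cvs_add_minus_cancel[OF cvs_V w y(2)] by simp
    then have "w \<in> kd p q" using csubD(6)[OF cvs_V csub_kd x(1) y(1)] by simp
    then have z: "z \<in> zA p (q - 1)" using zA_if_e_kd[OF yz(2)] by (simp add: w_def)
    have "x \<ominus>\<^bsub>V p q\<^esub> w \<in> imd p q"
      using cvs_add_minus_cancel[OF cvs_V y(2) w] yz(1,3) by (simp add: w_def)
    then have "C = cls imd p q w"
      using coset_eq_iff[OF cvs_V csub_imd xc w] x(2) by simp
    then have "C = e_HD p (q - 1) (cls iS p (q - 1) z)"
      using e_HD_coset[OF z] by (simp add: w_def)
    then show "C \<in> ?S" using z by (auto simp: carrier_HA)
  qed
  show "?S \<subseteq> ?K"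
  proof
    fix C assume "C \<in> ?S"
    then obtain z where z: "z \<in> zA p (q - 1)" "C = e_HD p (q - 1) (cls iS p (q - 1) z)"
      by (auto simp: carrier_HA)
    define w where "w = e p (q - 1) z"
    have w: "w \<in> kd p q" "w \<in> carrier (V p q)" "w \<in> ime p q"
      using e_zA[OF z(1)] z(1) by (auto simp: w_def ime_def zA_def kd_def)
    have C: "C = cls imd p q w" using z(2) e_HD_coset[OF z(1)] by (simp add: w_def)
    have "to_HA p q C = iS p q"
      using to_HA_coset[OF w(1)] C coset_eq_zero_iff[OF cvs_V csub_iS w(2)] w(3) ime_le_iS[of p q] by auto
    then show "C \<in> ?K"
      using C w(1) by (simp add: ker_of_def carrier_HD HA_def)
  qed
qed

text \<open>\<open>ker_d_HB\<close> turns a complement of the image of \<open>to_HA\<close> into a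
  complement of the kernel of \<open>d_HB\<close>, and \<open>GE_eq\<close> presents
  \<open>GE\<close> as a preimage; this is the shape that \<open>sum_of_images_decomposition\<close>
  asks for.\<close>

theorem HB_decomposition:
  assumes "complement_in (HA (p - 1) q) (GD (p - 1) q) (to_HA (p - 1) q ` carrier (HD (p - 1) q)) G"
    and "complement_in (HA (p - 1) q) (carrier (HA (p - 1) q)) (GD (p - 1) q) L"
    and "complement_in (HA p (q - 1)) (carrier (HA p (q - 1))) (GE p (q - 1)) L'"
  shows "HB p q \<cong>\<^sub>L subsp (HB p q) (d_HB (p - 1) q ` G) \<boxplus> subsp (HB p q) (d_HB (p - 1) q ` L) \<boxplus>
    subsp (HB p q) (e_HB p (q - 1) ` L') \<boxplus> HK p q"
proof (rule sum_of_images_decomposition[OF cvs_HA cvs_HA cvs_HB cvs_HK _ _ linmap_to_HK to_HK_surj ker_to_HK _ csub_GD])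
  show "linmap (HA (p - 1) q) (HB p q) (d_HB (p - 1) q)" using linmap_d_HB[of "p - 1" q] by simp
  show "linmap (HA p (q - 1)) (HB p q) (e_HB p (q - 1))" using linmap_e_HB[of p "q - 1"] by simp
  show "GE p (q - 1) = {x \<in> carrier (HA p (q - 1)). e_HB p (q - 1) x \<in> d_HB (p - 1) q ` carrier (HA (p - 1) q)}"
    using GE_eq[of p "q - 1"] by simp
  show "complement_in (HA (p - 1) q) (GD (p - 1) q) (ker_of (HA (p - 1) q) (HB p q) (d_HB (p - 1) q)) G"
    using assms(1) ker_d_HB[of "p - 1" q] by simp
qed (fact assms)+

theorem HA_decomposition:
  assumes "complement_in (HA p q) (GD p q) (to_HA p q ` carrier (HD p q)) G"
    and "complement_in (HA p q) (carrier (HA p q)) (GD p q) L"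
    and "complement_in (HA p (q - 1)) (carrier (HA p (q - 1))) (GE p (q - 1)) L'"
  shows "HA p q \<cong>\<^sub>L quot (HD p q) (e_HD p (q - 1) ` L') \<boxplus> subsp (HA p q) G \<boxplus> subsp (HA p q) L"
proof -
  have "linmap (HA p (q - 1)) (HD p q) (e_HD p (q - 1))" using linmap_e_HD[of p "q - 1"] by simp
  \<comment> \<open>\<open>GE\<close> is killed by \<open>e_HD\<close>, so its complement L' has the
    same image as the whole space, which by \<open>ker_to_HA\<close> is the kernel to be divided
    out.\<close>
  moreover have "GE p (q - 1) \<subseteq> ker_of (HA p (q - 1)) (HD p q) (e_HD p (q - 1))"
    by (simp add: GE_def ker_of_def)
  ultimately have "e_HD p (q - 1) ` carrier (HA p (q - 1)) = e_HD p (q - 1) ` L'"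
    by (rule image_complement_ker[OF cvs_HA cvs_HD _ csub_GE _ assms(3)])
  then show ?thesis
    using filtration_decomposition[OF cvs_HA cvs_HD linmap_to_HA csub_GD assms(1,2)] by (simp only: ker_to_HA)
qed

end

section \<open>The double complex of smooth forms\<close>

lemma forms_simps [simp]:
  "\<zero>\<^bsub>forms A p q\<^esub> = (\<lambda>c x v. 0)"
  "\<omega> \<oplus>\<^bsub>forms A p q\<^esub> \<eta> = (\<lambda>c x v. \<omega> c x v + \<eta> c x v)"
  "r \<odot>\<^bsub>forms A p q\<^esub> \<omega> = (\<lambda>c x v. r * \<omega> c x v)"
  by (simp_all add: forms_def)

lemma carrier_forms:
  "carrier (forms A p q) = (if 0 \<le> p \<and> 0 \<le> q then {\<omega>. smooth_pq_form A (nat p) (nat q) \<omega>} else {\<lambda>c x v. 0})"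
  by (simp add: forms_def)

text \<open>Passes from integer bidegrees to the natural ones of the chart computations; outside the
  first quadrant only the zero form is left.\<close>

lemma forms_cases:
  assumes "\<omega> \<in> carrier (forms A p q)"
  obtains "\<omega> = (\<lambda>c x v. 0)" "\<not> (0 \<le> p \<and> 0 \<le> q)"
  | m n where "p = int m" "q = int n" "smooth_pq_form A m n \<omega>"
proof (cases "0 \<le> p \<and> 0 \<le> q")
  case True
  then have "p = int (nat p)" "q = int (nat q)" "smooth_pq_form A (nat p) (nat q) \<omega>"
    using assms by (simp_all add: carrier_forms)
  then show ?thesis by (rule that(2))
next
  case False
  then have "\<omega> = (\<lambda>c x v. 0)" using assms unfolding carrier_forms if_not_P[OF False] by simp
  then show ?thesis using False by (rule that(1))
qed

lemma zero_in_forms: "(\<lambda>c x v. 0) \<in> carrier (forms A p q)"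
  by (simp add: carrier_forms smooth_pq_form_zero)

lemma smooth_pq_form_in_forms: "smooth_pq_form A m n \<omega> \<Longrightarrow> \<omega> \<in> carrier (forms A (int m) (int n))"
  by (simp add: carrier_forms)

context
  fixes X :: "'a topology" and A :: "('a, 'n::finite) chart set"
  assumes atlas: "complex_atlas X A"
begin

lemma forms_add:
  "\<omega> \<in> carrier (forms A p q) \<Longrightarrow> \<eta> \<in> carrier (forms A p q) \<Longrightarrow> (\<lambda>c x v. \<omega> c x v + \<eta> c x v) \<in> carrier (forms A p q)"
  using smooth_pq_form_add[OF atlas, of "nat p" "nat q" \<omega> \<eta>] by (auto simp: carrier_forms split: if_splits)

lemma forms_smult: "\<omega> \<in> carrier (forms A p q) \<Longrightarrow> (\<lambda>c x v. r * \<omega> c x v) \<in> carrier (forms A p q)"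
  using smooth_pq_form_smult[OF atlas, of "nat p" "nat q" \<omega> r] by (auto simp: carrier_forms split: if_splits)

lemma cvs_forms: "cvs (forms A p q)"
proof (rule moduleI[OF cring_complex_ring])
  show "abelian_group (forms A p q)"
  proof (rule abelian_groupI)
    fix \<omega> assume "\<omega> \<in> carrier (forms A p q)"
    from forms_smult[OF this, of "- 1"]
    show "\<exists>\<eta>\<in>carrier (forms A p q). \<eta> \<oplus>\<^bsub>forms A p q\<^esub> \<omega> = \<zero>\<^bsub>forms A p q\<^esub>"
      by (rule rev_bexI) simp
  qed (simp_all add: forms_add zero_in_forms add_ac)
qed (simp_all add: forms_smult algebra_simps)

text \<open>The case p = -1 can lead from a zero space into the first quadrant. There it suffices
  that the zero form has zero derivative and belongs to every bidegree.\<close>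

lemma del_closed:
  assumes "\<omega> \<in> carrier (forms A p q)"
  shows "del A p q \<omega> \<in> carrier (forms A (p + 1) q)"
  using assms
proof (cases rule: forms_cases)
  case 1
  then show ?thesis by (simp only: del_eq_form_del form_del_zero zero_in_forms)
next
  case (2 m n)
  have "int m + 1 = int (Suc m)" "nat (int m + int n) = m + n" by simp_all
  then show ?thesis
    using smooth_pq_form_in_forms[OF smooth_pq_form_del[OF atlas 2(3)]] 2(1,2) by (simp only: del_eq_form_del)
qed

lemma delbar_closed:
  assumes "\<omega> \<in> carrier (forms A p q)"
  shows "delbar A p q \<omega> \<in> carrier (forms A p (q + 1))"
  using assms
proof (cases rule: forms_cases)
  case 1
  then show ?thesis by (simp only: delbar_eq_form_del form_del_zero zero_in_forms)
next
  case (2 m n)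
  have "int n + 1 = int (Suc n)" "nat (int m + int n) = m + n" by simp_all
  then show ?thesis
    using smooth_pq_form_in_forms[OF smooth_pq_form_delbar[OF atlas 2(3)]] 2(1,2) by (simp only: delbar_eq_form_del)
qed

lemma forms_form_del_add:
  assumes "\<omega> \<in> carrier (forms A p q)" "\<eta> \<in> carrier (forms A p q)"
  shows "form_del s A k (\<lambda>c x v. \<omega> c x v + \<eta> c x v) = (\<lambda>c x v. form_del s A k \<omega> c x v + form_del s A k \<eta> c x v)"
proof (cases "0 \<le> p \<and> 0 \<le> q")
  case True
  then show ?thesis using assms by (intro form_del_add[OF atlas]) (simp_all add: carrier_forms)
next
  case False
  then have "\<omega> = (\<lambda>c x v. 0)" "\<eta> = (\<lambda>c x v. 0)" using assms unfolding carrier_forms if_not_P[OF False] by simp_all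
  then show ?thesis by (simp add: form_del_zero)
qed

lemma forms_form_del_smult:
  assumes "\<omega> \<in> carrier (forms A p q)"
  shows "form_del s A k (\<lambda>c x v. r * \<omega> c x v) = (\<lambda>c x v. r * form_del s A k \<omega> c x v)"
proof (cases "0 \<le> p \<and> 0 \<le> q")
  case True
  then show ?thesis using assms by (intro form_del_smult[OF atlas]) (simp_all add: carrier_forms)
next
  case False
  then have "\<omega> = (\<lambda>c x v. 0)" using assms unfolding carrier_forms if_not_P[OF False] by simp
  then show ?thesis by (simp add: form_del_zero)
qed

lemma forms_form_del_twice:
  assumes "\<omega> \<in> carrier (forms A p q)"
  shows "form_del s A (nat (p + q + 1)) (form_del s A (nat (p + q)) \<omega>) = (\<lambda>c x v. 0)"
  using assms
proof (cases rule: forms_cases)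
  \<comment> \<open>The function \<open>nat\<close> may truncate the degrees here, but the form is
    zero.\<close>
  case 1 then show ?thesis by (simp add: form_del_zero)
next
  case (2 m n)
  then have "nat (p + q + 1) = Suc (m + n)" "nat (p + q) = m + n" by simp_all
  then show ?thesis using form_del_twice[OF atlas 2(3)] by (simp only:)
qed

text \<open>The negative is written as a multiple by -1, the form in which \<open>cvs_neg\<close>
  expresses the additive inverse in \<open>forms\<close>.\<close>

lemma forms_form_del_anticommute:
  assumes "\<omega> \<in> carrier (forms A p q)"
  shows "form_del s A (nat (p + q + 1)) (form_del t A (nat (p + q)) \<omega>) =
    (\<lambda>c x v. - 1 * form_del t A (nat (p + q + 1)) (form_del s A (nat (p + q)) \<omega>) c x v)"
  using assms
proof (cases rule: forms_cases)
  case 1 then show ?thesis by (simp add: form_del_zero)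
next
  case (2 m n)
  then have "nat (p + q + 1) = Suc (m + n)" "nat (p + q) = m + n" by simp_all
  then show ?thesis
    by (intro ext) (simp only: mult_minus1, rule form_del_anticommute[OF atlas 2(3)])
qed

lemma double_complex_forms: "double_complex (forms A) (del A) (delbar A)"
proof (rule double_complex.intro)
  fix p q
  show "cvs (forms A p q)" by (rule cvs_forms)
  show "linmap (forms A p q) (forms A (p + 1) q) (del A p q)"
    by (rule linmapI) (simp_all add: del_closed, simp_all add: del_eq_form_del forms_form_del_add forms_form_del_smult)
  show "linmap (forms A p q) (forms A p (q + 1)) (delbar A p q)"
    by (rule linmapI) (simp_all add: delbar_closed, simp_all add: delbar_eq_form_del forms_form_del_add forms_form_del_smult)
  fix \<omega> assume w: "\<omega> \<in> carrier (forms A p q)"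
  show "del A (p + 1) q (del A p q \<omega>) = \<zero>\<^bsub>forms A (p + 2) q\<^esub>"
    using forms_form_del_twice[OF w, of 1] by (simp add: del_eq_form_del algebra_simps)
  show "delbar A p (q + 1) (delbar A p q \<omega>) = \<zero>\<^bsub>forms A p (q + 2)\<^esub>"
    using forms_form_del_twice[OF w, of "- 1"] by (simp add: delbar_eq_form_del algebra_simps)
  have c: "delbar A (p + 1) q (del A p q \<omega>) \<in> carrier (forms A (p + 1) (q + 1))"
    by (intro delbar_closed del_closed w)
  have "p + 1 + q = p + q + 1" "p + (q + 1) = p + q + 1" by simp_all
  then show "del A p (q + 1) (delbar A p q \<omega>) = \<ominus>\<^bsub>forms A (p + 1) (q + 1)\<^esub> delbar A (p + 1) q (del A p q \<omega>)"
    unfolding cvs_neg[OF cvs_forms c] unfolding forms_simps del_eq_form_del delbar_eq_form_del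
    using forms_form_del_anticommute[OF w, of 1 "- 1"] by (simp only:)
qed

end

theorem lemma5p2:
  fixes X :: "'a topology"
    and A :: "('a, 'n::finite) chart set"
    and G L G' L' :: "int \<Rightarrow> int \<Rightarrow> ('a, 'n) form set set"
    and p q :: int
  assumes "compact_complex_manifold X A"
    and "GL_del A G L"
    and "GL_delbar A G' L'"
  shows "H_BC A p q \<cong>\<^sub>L
      subsp (H_BC A p q) (del_to_H_BC A (p - 1) q ` G (p - 1) q) \<boxplus>
      subsp (H_BC A p q) (del_to_H_BC A (p - 1) q ` L (p - 1) q) \<boxplus>
      subsp (H_BC A p q) (delbar_to_H_BC A p (q - 1) ` L' p (q - 1)) \<boxplus>
      H_K A p q
    \<and> H_BC A p q \<cong>\<^sub>L
      subsp (H_BC A p q) (delbar_to_H_BC A p (q - 1) ` G' p (q - 1)) \<boxplus>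
      subsp (H_BC A p q) (delbar_to_H_BC A p (q - 1) ` L' p (q - 1)) \<boxplus>
      subsp (H_BC A p q) (del_to_H_BC A (p - 1) q ` L (p - 1) q) \<boxplus>
      H_K A p q
    \<and> H_A A p q \<cong>\<^sub>L
      quot (H_del A p q) (delbar_to_H_del A p (q - 1) ` L' p (q - 1)) \<boxplus>
      subsp (H_A A p q) (G p q) \<boxplus>
      subsp (H_A A p q) (L p q)
    \<and> H_A A p q \<cong>\<^sub>L
      quot (H_delbar A p q) (del_to_H_delbar A (p - 1) q ` L (p - 1) q) \<boxplus>
      subsp (H_A A p q) (G' p q) \<boxplus>
      subsp (H_A A p q) (L' p q)"
proof -
  have "complex_atlas X A" using assms(1) by (simp add: compact_complex_manifold_def)
  then interpret dc: double_complex "forms A" "del A" "delbar A"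
    by (rule double_complex_forms)
  \<comment> \<open>The notions of the abstract double complex are identified with those for forms,
    first the subspaces, then the quotients and the maps built from them.\<close>
  have ker: "dc.kd = ker_del A" "dc.ke = ker_delbar A" "dc.zA = ker_ddbar A"
    by (intro ext; simp add: dc.kd_def ker_del_def dc.ke_def ker_delbar_def dc.zA_def ker_ddbar_def ddbar_def)+
  have im: "dc.imd = im_del A" "dc.ime = im_delbar A" "dc.iB = im_ddbar A"
    by (intro ext; simp add: dc.imd_def im_del_def dc.ime_def im_delbar_def dc.iB_def im_ddbar_def ddbar_def)+
  have sum: "dc.iS = im_sum A" by (intro ext) (simp add: dc.iS_def im_sum_def im)
  have H: "dc.HA = H_A A" "dc.HB = H_BC A" "dc.HD = H_del A" "dc.HE = H_delbar A" "dc.HK = H_K A"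
    by (intro ext; simp only: dc.HA_def H_A_def dc.HB_def H_BC_def dc.HD_def H_del_def
        dc.HE_def H_delbar_def dc.HK_def dc.iK_def H_K_def ker im sum)+
  have maps: "dc.d_HB = del_to_H_BC A" "dc.e_HB = delbar_to_H_BC A" "dc.d_HE = del_to_H_delbar A"
     "dc.e_HD = delbar_to_H_del A" "dc.to_HA = pi_A A"
    by (intro ext; simp only: dc.d_HB_def del_to_H_BC_def dc.e_HB_def delbar_to_H_BC_def dc.d_HE_def
        del_to_H_delbar_def dc.e_HD_def delbar_to_H_del_def dc.to_HA_def pi_A_def im sum)+
  have G: "dc.GD = calG_del A" "dc.GE = calG_delbar A"
    by (intro ext; simp only: dc.GD_def calG_del_def dc.GE_def calG_delbar_def H maps)+
  have del: "complement_in (H_A A p q) (calG_del A p q) (pi_A A p q ` carrier (H_del A p q)) (G p q)"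
     "complement_in (H_A A p q) (carrier (H_A A p q)) (calG_del A p q) (L p q)" for p q
    using assms(2) by (simp_all add: GL_del_def)
  have delbar: "complement_in (H_A A p q) (calG_delbar A p q) (pi_A A p q ` carrier (H_delbar A p q)) (G' p q)"
     "complement_in (H_A A p q) (carrier (H_A A p q)) (calG_delbar A p q) (L' p q)" for p q
    using assms(3) by (simp_all add: GL_delbar_def)
  \<comment> \<open>The transposed complex, read back through \<open>swap_H\<close>, supplies the
    second and the fourth isomorphism.\<close>
  note swapped_HB = double_complex.HB_decomposition[OF dc.swapped, unfolded dc.swap_H H maps G]
  note swapped_HA = double_complex.HA_decomposition[OF dc.swapped, unfolded dc.swap_H H maps G]
  show ?thesis
    by (intro conjI dc.HB_decomposition[unfolded H maps G, OF del(1) del(2) delbar(2)]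
        swapped_HB[OF delbar(1) delbar(2) del(2)]
        dc.HA_decomposition[unfolded H maps G, OF del(1) del(2) delbar(2)]
        swapped_HA[OF delbar(1) delbar(2) del(2)])
qed

end
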